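(* Let $(M,g)$ be a Riemannian manifold with Levi-Civita connection $\nabla$ and curvature tensor $\mathfrak R$, and let $m_1,m_2,m_3\in\mathbb{R}$ satisfy $m_1>0$, $m_3>0$, $\Delta:=m_1m_3-m_2^2>0$. Equip $TM$ with the Riemannian metric $\bar g$ determined by $$\bar g_{(p,u)}(X^{\bar h},Y^{\bar h})=m_1g_p(X,Y),\quad \bar g_{(p,u)}(X^{\bar h},Y^{\bar v})=m_2g_p(X,Y),\quad \bar g_{(p,u)}(X^{\bar v},Y^{\bar v})=m_3g_p(X,Y),$$ with Levi-Civita connection $\bar\nabla$. Let $\bar X,\bar Y$ be vector fields on $TM$ and $(p,u)\in TM$. Write $\bar X_{(p,u)}=F^{\bar h}+G^{\bar v}$ with $F,G\in T_pM$, and let $\bar Y$ be decomposed near $(p,u)$ as $$\bar Y=A^{\bar h}+B^{\bar v}+\bar C+\bar D,$$ where $A,B$ are vector fields on $M$ defined near $p$, $\bar C$ is a horizontal vector field and $\bar D$ a vertical vector field on a neighborhood of $(p,u)$ in $TM$, and $\bar C=\bar D=0$ at $(p,u)$ and along horizontal curves passing through $(p,u)$. Then at $(p,u)$ $$\bar\nabla_{\bar X}\bar Y=\bar\nabla_{(F^{\bar h}+G^{\bar v})}\left(A^{\bar h}+B^{\bar v}\right)+\tilde\nabla_{G^{\bar v}}\left(\bar C+\bar D\right),$$ where $\tilde\nabla$ is the usual flat directional derivative along the fiber $T_pM$, and the first term on the right is the vector in $T_{(p,u)}TM$ with $$d\pi\left(\bar\nabla_{(F^{\bar h}+G^{\bar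 v})}(A^{\bar h}+B^{\bar v})\right)=\nabla_FA+\frac1\Delta\left(m_2m_3\mathfrak R(u,F)A+\frac{m_2m_3}{2}\mathfrak R(F,A)u+\frac{m_3^2}{2}\mathfrak R(u,B)F+\frac{m_3^2}{2}\mathfrak R(u,G)A\right),$$ $$K\left(\bar\nabla_{(F^{\bar h}+G^{\bar v})}(A^{\bar h}+B^{\bar v})\right)=\nabla_FB-\frac1\Delta\left(m_2^2\mathfrak R(u,F)A+\frac{m_1m_3}{2}\mathfrak R(F,A)u+\frac{m_2m_3}{2}\mathfrak R(u,B)F+\frac{m_2m_3}{2}\mathfrak R(u,G)A\right).$$
   Context: $(M,g)$ is an $n$-dimensional Riemannian manifold and $\pi:TM\to M$ is the bundle projection; points of $TM$ are pairs $(p,u)$ with $p\in M$, $u\in T_pM$. The connection map $K_{(p,u)}:T_{(p,u)}TM\to T_pM$ of $\nabla$ is $K(\bar X)=d(\exp_p\circ R_{-u}\circ\tau)(\bar X)$, where, for a normal neighborhood $U$ of $p$, $\tau:\pi^{-1}(U)\to T_pM$ is parallel transport of each $Y\in\pi^{-1}(U)$ from $\pi(Y)$ to $p$ (along the geodesic in $U$), and $R_{-u}:T_pM\to T_pM$, $R_{-u}(X)=X-u$; equivalently, $K(dZ(X))=\nabla_XZ$ for a vector field $Z:M\to TM$. One has $T_{(p,u)}TM=\mathcal H_{(p,u)}\oplus\mathcal V_{(p,u)}$ with $\mathcal H=\ker K$ (horizontal subspace), $\mathcal V=\ker d\pi$ (vertical subspace). A curve in $TM$ is horizontal if its tangent vector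 lies in $\mathcal H$ at all times; a vector field on (an open subset of) $TM$ is horizontal (vertical) if its values lie in $\mathcal H$ (in $\mathcal V$). For a vector field $X$ on $M$, the horizontal lift $X^{\bar h}$ and vertical lift $X^{\bar v}$ are the unique vector fields on $TM$ with $d\pi(X^{\bar h})_{(p,u)}=X_p$, $K(X^{\bar h})_{(p,u)}=0$, and $d\pi(X^{\bar v})_{(p,u)}=0$, $K(X^{\bar v})_{(p,u)}=X_p$; lifts of a single tangent vector in $T_pM$ to $T_{(p,u)}TM$ are defined by the same formulas. Curvature sign convention: $\mathfrak R(X,Y)Z=\nabla_X\nabla_YZ-\nabla_Y\nabla_XZ-\nabla_{[X,Y]}Z$ (so that $[X^{\bar h},Y^{\bar h}]_{(p,u)}=([X,Y])^{\bar h}_{(p,u)}-(\mathfrak R(X,Y)u)^{\bar v}_{(p,u)}$). Meaning of $\tilde\nabla$: along the fiber $T_pM$ (a flat vector space), the maps $w\mapsto c(w):=d\pi(\bar C_{(p,w)})$ and $w\mapsto d(w):=K(\bar D_{(p,w)})$ take values in the fixed vector space $T_pM$, and $\tilde\nabla_{G^{\bar v}}(\bar C+\bar D)$ at $(p,u)$ is the vector with $d\pi$-component $\frac{d}{dt}\big|_{t=0}c(u+tG)$ and $K$-component $\frac{d}{dt}\big|_{t=0}d(u+tG)$. *)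

theory Defs
  imports "HOL-Analysis.Analysis"
begin

section \<open>Smooth functions on open sets of normed spaces\<close>

primrec Ck_on :: "nat \<Rightarrow> 'a::real_normed_vector set \<Rightarrow> ('a \<Rightarrow> 'b::real_normed_vector) \<Rightarrow> bool" where
  "Ck_on 0 S f \<longleftrightarrow> continuous_on S f"
| "Ck_on (Suc k) S f \<longleftrightarrow>
     (\<forall>x\<in>S. f differentiable at x) \<and> (\<forall>v. Ck_on k S (\<lambda>x. frechet_derivative f (at x) v))"

definition smooth_on :: "'a::real_normed_vector set \<Rightarrow> ('a \<Rightarrow> 'b::real_normed_vector) \<Rightarrow> bool" where
  "smooth_on S f \<longleftrightarrow> (\<forall>k. Ck_on k S f)"


section \<open>Smooth manifolds\<close>

text \<open>A manifold is represented by a smooth atlas; its dimension is that of the model space.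
  The values of \<open>cmap c\<close> outside \<open>cdom c\<close> are irrelevant.\<close>

datatype ('a, 'e) chart = Chart (cdom: "'a set") (cmap: "'a \<Rightarrow> 'e")

type_synonym ('a, 'e) atlas = "('a, 'e) chart set"

definition cinv :: "('a, 'e) chart \<Rightarrow> 'e \<Rightarrow> 'a" where
  "cinv c = inv_into (cdom c) (cmap c)"

definition points :: "('a, 'e) atlas \<Rightarrow> 'a set" where
  "points M = (\<Union>c\<in>M. cdom c)"

definition smooth_atlas :: "('a, 'e::euclidean_space) atlas \<Rightarrow> bool" where
  "smooth_atlas M \<longleftrightarrow>
     (\<forall>c\<in>M. inj_on (cmap c) (cdom c) \<and> open (cmap c ` cdom c)) \<and>
     (\<forall>c\<in>M. \<forall>d\<in>M. open (cmap c ` (cdom c \<inter> cdom d)) \<and>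
        smooth_on (cmap c ` (cdom c \<inter> cdom d)) (cmap d \<circ> cinv c))"

text \<open>Injectivity of the charts is part of the following predicate only to make it a topology
  for arbitrary \<open>M\<close>; it is implied by \<open>smooth_atlas M\<close>.\<close>

definition atlas_open :: "('a, 'e::euclidean_space) atlas \<Rightarrow> 'a set \<Rightarrow> bool" where
  "atlas_open M U \<longleftrightarrow> U \<subseteq> points M \<and>
     (\<forall>c\<in>M. inj_on (cmap c) (cdom c) \<longrightarrow> open (cmap c ` (U \<inter> cdom c)))"

definition mtopology :: "('a, 'e::euclidean_space) atlas \<Rightarrow> 'a topology" where
  "mtopology M = topology (atlas_open M)"

lemma openin_mtopology: "openin (mtopology M) U \<longleftrightarrow> atlas_open M U"
proof -
  have "istopology (atlas_open M)"
    unfolding istopology_def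
  proof (intro conjI allI impI)
    fix S T assume S: "atlas_open M S" and T: "atlas_open M T"
    have "open (cmap c ` (S \<inter> T \<inter> cdom c))" if c: "c \<in> M" "inj_on (cmap c) (cdom c)" for c
    proof -
      have "cmap c ` (S \<inter> T \<inter> cdom c) = cmap c ` (S \<inter> cdom c) \<inter> cmap c ` (T \<inter> cdom c)"
        using c(2) by (auto simp: inj_on_def)
      then show ?thesis using S T c unfolding atlas_open_def by auto
    qed
    then show "atlas_open M (S \<inter> T)" using S unfolding atlas_open_def by auto
  next
    fix \<K> assume K: "\<forall>k\<in>\<K>. atlas_open M k"
    have "open (cmap c ` (\<Union>\<K> \<inter> cdom c))" if c: "c \<in> M" "inj_on (cmap c) (cdom c)" for c
    proof -
      have "cmap c ` (\<Union>\<K> \<inter> cdom c) = (\<Union>k\<in>\<K>. cmap c ` (k \<inter> cdom c))" by auto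
      then show ?thesis using K c unfolding atlas_open_def by auto
    qed
    then show "atlas_open M (\<Union>\<K>)" using K unfolding atlas_open_def by auto
  qed
  then show ?thesis unfolding mtopology_def by (simp add: topology_inverse')
qed

definition smooth_manifold :: "('a, 'e::euclidean_space) atlas \<Rightarrow> bool" where
  "smooth_manifold M \<longleftrightarrow>
     smooth_atlas M \<and> Hausdorff_space (mtopology M) \<and> second_countable (mtopology M)"

definition smooth_fun :: "('a, 'e::euclidean_space) atlas \<Rightarrow> 'a set \<Rightarrow> ('a \<Rightarrow> real) \<Rightarrow> bool" where
  "smooth_fun M U f \<longleftrightarrow> (\<forall>c\<in>M. smooth_on (cmap c ` (U \<inter> cdom c)) (f \<circ> cinv c))"

definition chart_at :: "('a, 'e) atlas \<Rightarrow> 'a \<Rightarrow> ('a, 'e) chart" where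
  "chart_at M p = (SOME c. c \<in> M \<and> p \<in> cdom c)"


section \<open>Tangent vectors and the tangent bundle\<close>

text \<open>A tangent vector at \<open>p\<close> is a family of coordinate vectors, one for each chart of the atlas
  around \<open>p\<close>, related by the derivatives of the transition maps. The coordinates with respect to
  all other charts are set to \<open>0\<close>, which makes the representation unique.\<close>

datatype ('a, 'e) tvec = TVec (tbase: 'a) (tcoord: "('a, 'e) chart \<Rightarrow> 'e")

definition tspace :: "('a, 'e::euclidean_space) atlas \<Rightarrow> 'a \<Rightarrow> ('a, 'e) tvec set" where
  "tspace M p = {\<xi>. tbase \<xi> = p \<and>
     (\<forall>c\<in>M. \<forall>d\<in>M. p \<in> cdom c \<inter> cdom d \<longrightarrow>
        tcoord \<xi> d = frechet_derivative (cmap d \<circ> cinv c) (at (cmap c p)) (tcoord \<xi> c)) \<and>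
     (\<forall>c. \<not> (c \<in> M \<and> p \<in> cdom c) \<longrightarrow> tcoord \<xi> c = 0)}"

definition tzero :: "'a \<Rightarrow> ('a, 'e::real_vector) tvec" where
  "tzero p = TVec p (\<lambda>c. 0)"

definition tplus :: "('a, 'e::real_vector) tvec \<Rightarrow> ('a, 'e) tvec \<Rightarrow> ('a, 'e) tvec"
    (infixl "+\<^sub>T" 65) where
  "\<xi> +\<^sub>T \<eta> = TVec (tbase \<xi>) (\<lambda>c. tcoord \<xi> c + tcoord \<eta> c)"

definition tminus :: "('a, 'e::real_vector) tvec \<Rightarrow> ('a, 'e) tvec \<Rightarrow> ('a, 'e) tvec"
    (infixl "-\<^sub>T" 65) where
  "\<xi> -\<^sub>T \<eta> = TVec (tbase \<xi>) (\<lambda>c. tcoord \<xi> c - tcoord \<eta> c)"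

definition tscale :: "real \<Rightarrow> ('a, 'e::real_vector) tvec \<Rightarrow> ('a, 'e) tvec"
    (infixr "*\<^sub>T" 75) where
  "r *\<^sub>T \<xi> = TVec (tbase \<xi>) (\<lambda>c. r *\<^sub>R tcoord \<xi> c)"

text \<open>The tangent bundle is again an atlas, now on the type of tangent vectors and modelled on
  \<open>'e \<times> 'e\<close>. Its points are the tangent vectors of \<open>M\<close>: the pair \<open>(p, u)\<close> with \<open>u \<in> T\<^sub>pM\<close>
  is the single object \<open>u\<close>, with \<open>p = tbase u\<close>.\<close>

definition tchart :: "('a, 'e::euclidean_space) atlas \<Rightarrow> ('a, 'e) chart \<Rightarrow>
    (('a, 'e) tvec, 'e \<times> 'e) chart" where
  "tchart M c = Chart (\<Union>p\<in>cdom c. tspace M p) (\<lambda>\<xi>. (cmap c (tbase \<xi>), tcoord \<xi> c))"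

definition TM :: "('a, 'e::euclidean_space) atlas \<Rightarrow> (('a, 'e) tvec, 'e \<times> 'e) atlas" where
  "TM M = tchart M ` M"

definition tdiff :: "('a, 'e::euclidean_space) atlas \<Rightarrow> ('b, 'f::euclidean_space) atlas \<Rightarrow>
    ('a \<Rightarrow> 'b) \<Rightarrow> ('a, 'e) tvec \<Rightarrow> ('b, 'f) tvec" where
  "tdiff M N f \<xi> = (let p = tbase \<xi>; c = chart_at M p in
     TVec (f p) (\<lambda>d. if d \<in> N \<and> f p \<in> cdom d
       then frechet_derivative (cmap d \<circ> f \<circ> cinv c) (at (cmap c p)) (tcoord \<xi> c) else 0))"

abbreviation dpi :: "('a, 'e::euclidean_space) atlas \<Rightarrow>
    (('a, 'e) tvec, 'e \<times> 'e) tvec \<Rightarrow> ('a, 'e) tvec" where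
  "dpi M \<equiv> tdiff (TM M) M tbase"

definition dir_deriv :: "('a, 'e::euclidean_space) atlas \<Rightarrow> ('a, 'e) tvec \<Rightarrow> ('a \<Rightarrow> real) \<Rightarrow> real" where
  "dir_deriv M \<xi> f = (let p = tbase \<xi>; c = chart_at M p in
     frechet_derivative (f \<circ> cinv c) (at (cmap c p)) (tcoord \<xi> c))"

definition smooth_vf :: "('a, 'e::euclidean_space) atlas \<Rightarrow> 'a set \<Rightarrow>
    ('a \<Rightarrow> ('a, 'e) tvec) \<Rightarrow> bool" where
  "smooth_vf M U X \<longleftrightarrow> (\<forall>p\<in>U. X p \<in> tspace M p) \<and>
     (\<forall>c\<in>M. smooth_on (cmap c ` (U \<inter> cdom c)) (\<lambda>x. tcoord (X (cinv c x)) c))"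

definition lie_bracket :: "('a, 'e::euclidean_space) atlas \<Rightarrow> ('a \<Rightarrow> ('a, 'e) tvec) \<Rightarrow>
    ('a \<Rightarrow> ('a, 'e) tvec) \<Rightarrow> 'a \<Rightarrow> ('a, 'e) tvec" where
  "lie_bracket M X Y p = TVec p (\<lambda>c. if c \<in> M \<and> p \<in> cdom c then
     frechet_derivative (\<lambda>x. tcoord (Y (cinv c x)) c) (at (cmap c p)) (tcoord (X p) c) -
     frechet_derivative (\<lambda>x. tcoord (X (cinv c x)) c) (at (cmap c p)) (tcoord (Y p) c) else 0)"

definition smooth_curve :: "('a, 'e::euclidean_space) atlas \<Rightarrow> real set \<Rightarrow> (real \<Rightarrow> 'a) \<Rightarrow> bool" where
  "smooth_curve M I \<gamma> \<longleftrightarrow> \<gamma> ` I \<subseteq> points M \<and>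
     (\<forall>c\<in>M. open {t\<in>I. \<gamma> t \<in> cdom c} \<and> smooth_on {t\<in>I. \<gamma> t \<in> cdom c} (cmap c \<circ> \<gamma>))"

definition velocity :: "('a, 'e::euclidean_space) atlas \<Rightarrow> (real \<Rightarrow> 'a) \<Rightarrow> real \<Rightarrow> ('a, 'e) tvec" where
  "velocity M \<gamma> t = TVec (\<gamma> t) (\<lambda>c. if c \<in> M \<and> \<gamma> t \<in> cdom c
     then vector_derivative (cmap c \<circ> \<gamma>) (at t) else 0)"


section \<open>Riemannian metrics, the Levi-Civita connection, curvature\<close>

definition riemannian_metric :: "('a, 'e::euclidean_space) atlas \<Rightarrow>
    (('a, 'e) tvec \<Rightarrow> ('a, 'e) tvec \<Rightarrow> real) \<Rightarrow> bool" where
  "riemannian_metric M g \<longleftrightarrow>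
     (\<forall>p\<in>points M. \<forall>x\<in>tspace M p. \<forall>y\<in>tspace M p. \<forall>z\<in>tspace M p. \<forall>r.
        g x y = g y x \<and> g (x +\<^sub>T y) z = g x z + g y z \<and> g (r *\<^sub>T x) y = r * g x y) \<and>
     (\<forall>p\<in>points M. \<forall>x\<in>tspace M p. x \<noteq> tzero p \<longrightarrow> g x x > 0) \<and>
     (\<forall>U X Y. openin (mtopology M) U \<and> smooth_vf M U X \<and> smooth_vf M U Y \<longrightarrow>
        smooth_fun M U (\<lambda>p. g (X p) (Y p)))"

text \<open>A connection \<open>nab\<close> takes a tangent vector \<open>x\<close> at \<open>p\<close> and a vector field \<open>Y\<close> that is smooth
  on some neighbourhood of \<open>p\<close>. Since fields are total functions, the statement that \<open>nab x Y\<close>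
  depends only on \<open>Y\<close> near \<open>p\<close> is made explicit.\<close>

definition affine_connection :: "('a, 'e::euclidean_space) atlas \<Rightarrow>
    (('a, 'e) tvec \<Rightarrow> ('a \<Rightarrow> ('a, 'e) tvec) \<Rightarrow> ('a, 'e) tvec) \<Rightarrow> bool" where
  "affine_connection M nab \<longleftrightarrow>
     (\<forall>U Y. openin (mtopology M) U \<and> smooth_vf M U Y \<longrightarrow>
        (\<forall>p\<in>U. \<forall>x\<in>tspace M p.
           nab x Y \<in> tspace M p \<and>
           (\<forall>r. nab (r *\<^sub>T x) Y = r *\<^sub>T nab x Y) \<and>
           (\<forall>x'\<in>tspace M p. nab (x +\<^sub>T x') Y = nab x Y +\<^sub>T nab x' Y) \<and>
           (\<forall>Y'. smooth_vf M U Y' \<longrightarrow> nab x (\<lambda>q. Y q +\<^sub>T Y' q) = nab x Y +\<^sub>T nab x Y') \<and>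
           (\<forall>f. smooth_fun M U f \<longrightarrow>
              nab x (\<lambda>q. f q *\<^sub>T Y q) = dir_deriv M x f *\<^sub>T Y p +\<^sub>T f p *\<^sub>T nab x Y) \<and>
           (\<forall>Y'. (\<forall>q\<in>U. Y' q = Y q) \<longrightarrow> nab x Y' = nab x Y)) \<and>
        (\<forall>X. smooth_vf M U X \<longrightarrow> smooth_vf M U (\<lambda>q. nab (X q) Y)))"

definition levi_civita :: "('a, 'e::euclidean_space) atlas \<Rightarrow>
    (('a, 'e) tvec \<Rightarrow> ('a, 'e) tvec \<Rightarrow> real) \<Rightarrow>
    (('a, 'e) tvec \<Rightarrow> ('a \<Rightarrow> ('a, 'e) tvec) \<Rightarrow> ('a, 'e) tvec) \<Rightarrow> bool" where
  "levi_civita M g nab \<longleftrightarrow> affine_connection M nab \<and>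
     (\<forall>U X Y. openin (mtopology M) U \<and> smooth_vf M U X \<and> smooth_vf M U Y \<longrightarrow>
        (\<forall>p\<in>U. nab (X p) Y -\<^sub>T nab (Y p) X = lie_bracket M X Y p)) \<and>
     (\<forall>U Y Z. openin (mtopology M) U \<and> smooth_vf M U Y \<and> smooth_vf M U Z \<longrightarrow>
        (\<forall>p\<in>U. \<forall>x\<in>tspace M p.
           dir_deriv M x (\<lambda>q. g (Y q) (Z q)) = g (nab x Y) (Z p) + g (Y p) (nab x Z)))"

text \<open>The curvature tensor on tangent vectors at a common point is the value of the usual
  expression for arbitrary smooth local extensions to vector fields.\<close>

definition curvature :: "('a, 'e::euclidean_space) atlas \<Rightarrow>
    (('a, 'e) tvec \<Rightarrow> ('a \<Rightarrow> ('a, 'e) tvec) \<Rightarrow> ('a, 'e) tvec) \<Rightarrow>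
    ('a, 'e) tvec \<Rightarrow> ('a, 'e) tvec \<Rightarrow> ('a, 'e) tvec \<Rightarrow> ('a, 'e) tvec" where
  "curvature M nab x y z = (THE w. \<forall>U X Y Z.
     openin (mtopology M) U \<and> tbase x \<in> U \<and> smooth_vf M U X \<and> smooth_vf M U Y \<and> smooth_vf M U Z \<and>
     X (tbase x) = x \<and> Y (tbase x) = y \<and> Z (tbase x) = z \<longrightarrow>
     w = nab x (\<lambda>q. nab (Y q) Z) -\<^sub>T nab y (\<lambda>q. nab (X q) Z) -\<^sub>T nab (lie_bracket M X Y (tbase x)) Z)"


section \<open>Connection map, horizontal and vertical vectors, lifts\<close>

text \<open>The connection map is the fibrewise linear map \<open>TTM \<rightarrow> TM\<close> with \<open>K (dZ X) = \<nabla>\<^sub>X Z\<close>.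
  A vector of \<open>TTM\<close> at \<open>u\<close> that is not vertical is of the form \<open>dZ X\<close> with \<open>Z\<close> a local field
  through \<open>u\<close>, and vertical vectors are differences of such vectors, so \<open>K\<close> is determined uniquely
  on all vectors tangent to \<open>TM\<close>.\<close>

definition connection_map :: "('a, 'e::euclidean_space) atlas \<Rightarrow>
    (('a, 'e) tvec \<Rightarrow> ('a \<Rightarrow> ('a, 'e) tvec) \<Rightarrow> ('a, 'e) tvec) \<Rightarrow>
    ((('a, 'e) tvec, 'e \<times> 'e) tvec \<Rightarrow> ('a, 'e) tvec) \<Rightarrow> bool" where
  "connection_map M nab K \<longleftrightarrow>
     (\<forall>u\<in>points (TM M). \<forall>\<xi>\<in>tspace (TM M) u.
        K \<xi> \<in> tspace M (tbase u) \<and>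
        (\<forall>\<eta>\<in>tspace (TM M) u. K (\<xi> +\<^sub>T \<eta>) = K \<xi> +\<^sub>T K \<eta>) \<and>
        (\<forall>r. K (r *\<^sub>T \<xi>) = r *\<^sub>T K \<xi>)) \<and>
     (\<forall>U Z. openin (mtopology M) U \<and> smooth_vf M U Z \<longrightarrow>
        (\<forall>p\<in>U. \<forall>X\<in>tspace M p. K (tdiff M (TM M) Z X) = nab X Z))"

definition hspace :: "('a, 'e::euclidean_space) atlas \<Rightarrow>
    ((('a, 'e) tvec, 'e \<times> 'e) tvec \<Rightarrow> ('a, 'e) tvec) \<Rightarrow>
    ('a, 'e) tvec \<Rightarrow> (('a, 'e) tvec, 'e \<times> 'e) tvec set" where
  "hspace M K u = {\<xi> \<in> tspace (TM M) u. K \<xi> = tzero (tbase u)}"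

definition vspace :: "('a, 'e::euclidean_space) atlas \<Rightarrow>
    ('a, 'e) tvec \<Rightarrow> (('a, 'e) tvec, 'e \<times> 'e) tvec set" where
  "vspace M u = {\<xi> \<in> tspace (TM M) u. dpi M \<xi> = tzero (tbase u)}"

definition tvec_with :: "('a, 'e::euclidean_space) atlas \<Rightarrow>
    ((('a, 'e) tvec, 'e \<times> 'e) tvec \<Rightarrow> ('a, 'e) tvec) \<Rightarrow>
    ('a, 'e) tvec \<Rightarrow> ('a, 'e) tvec \<Rightarrow> ('a, 'e) tvec \<Rightarrow> (('a, 'e) tvec, 'e \<times> 'e) tvec" where
  "tvec_with M K u X Y = (THE \<xi>. \<xi> \<in> tspace (TM M) u \<and> dpi M \<xi> = X \<and> K \<xi> = Y)"

definition hlift :: "('a, 'e::euclidean_space) atlas \<Rightarrow>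
    ((('a, 'e) tvec, 'e \<times> 'e) tvec \<Rightarrow> ('a, 'e) tvec) \<Rightarrow>
    ('a, 'e) tvec \<Rightarrow> ('a, 'e) tvec \<Rightarrow> (('a, 'e) tvec, 'e \<times> 'e) tvec" where
  "hlift M K u X = tvec_with M K u X (tzero (tbase u))"

definition vlift :: "('a, 'e::euclidean_space) atlas \<Rightarrow>
    ((('a, 'e) tvec, 'e \<times> 'e) tvec \<Rightarrow> ('a, 'e) tvec) \<Rightarrow>
    ('a, 'e) tvec \<Rightarrow> ('a, 'e) tvec \<Rightarrow> (('a, 'e) tvec, 'e \<times> 'e) tvec" where
  "vlift M K u X = tvec_with M K u (tzero (tbase u)) X"

definition hlift_vf :: "('a, 'e::euclidean_space) atlas \<Rightarrow>
    ((('a, 'e) tvec, 'e \<times> 'e) tvec \<Rightarrow> ('a, 'e) tvec) \<Rightarrow>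
    ('a \<Rightarrow> ('a, 'e) tvec) \<Rightarrow> ('a, 'e) tvec \<Rightarrow> (('a, 'e) tvec, 'e \<times> 'e) tvec" where
  "hlift_vf M K A w = hlift M K w (A (tbase w))"

definition vlift_vf :: "('a, 'e::euclidean_space) atlas \<Rightarrow>
    ((('a, 'e) tvec, 'e \<times> 'e) tvec \<Rightarrow> ('a, 'e) tvec) \<Rightarrow>
    ('a \<Rightarrow> ('a, 'e) tvec) \<Rightarrow> ('a, 'e) tvec \<Rightarrow> (('a, 'e) tvec, 'e \<times> 'e) tvec" where
  "vlift_vf M K B w = vlift M K w (B (tbase w))"

definition horizontal_curve :: "('a, 'e::euclidean_space) atlas \<Rightarrow>
    ((('a, 'e) tvec, 'e \<times> 'e) tvec \<Rightarrow> ('a, 'e) tvec) \<Rightarrow> real set \<Rightarrow> (real \<Rightarrow> ('a, 'e) tvec) \<Rightarrow> bool" where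
  "horizontal_curve M K I \<gamma> \<longleftrightarrow>
     smooth_curve (TM M) I \<gamma> \<and> (\<forall>t\<in>I. velocity (TM M) \<gamma> t \<in> hspace M K (\<gamma> t))"

text \<open>The curves ranging in the neighbourhood \<open>W\<close> on which \<open>E\<close> is defined, parametrised by open
  intervals.\<close>

definition vanishes_horizontally :: "('a, 'e::euclidean_space) atlas \<Rightarrow>
    ((('a, 'e) tvec, 'e \<times> 'e) tvec \<Rightarrow> ('a, 'e) tvec) \<Rightarrow> ('a, 'e) tvec set \<Rightarrow> ('a, 'e) tvec \<Rightarrow>
    (('a, 'e) tvec \<Rightarrow> (('a, 'e) tvec, 'e \<times> 'e) tvec) \<Rightarrow> bool" where
  "vanishes_horizontally M K W u E \<longleftrightarrow> E u = tzero u \<and>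
     (\<forall>a b \<gamma>. horizontal_curve M K {a<..<b} \<gamma> \<and> \<gamma> ` {a<..<b} \<subseteq> W \<and> u \<in> \<gamma> ` {a<..<b} \<longrightarrow>
        (\<forall>t\<in>{a<..<b}. E (\<gamma> t) = tzero (\<gamma> t)))"

text \<open>Derivative at \<open>0\<close> of a curve \<open>c\<close> in the fixed vector space \<open>T\<^sub>pM\<close>.\<close>

definition fibre_deriv :: "('a, 'e::euclidean_space) atlas \<Rightarrow> 'a \<Rightarrow> (real \<Rightarrow> ('a, 'e) tvec) \<Rightarrow> ('a, 'e) tvec" where
  "fibre_deriv M p c = TVec p (\<lambda>ch. if ch \<in> M \<and> p \<in> cdom ch
     then vector_derivative (\<lambda>t. tcoord (c t) ch) (at 0) else 0)"

text \<open>Flat derivative of \<open>C + D\<close> (\<open>C\<close> horizontal, \<open>D\<close> vertical) at \<open>u\<close> in the direction of the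
  vertical lift of \<open>G\<close>.\<close>

definition flat_deriv :: "('a, 'e::euclidean_space) atlas \<Rightarrow>
    ((('a, 'e) tvec, 'e \<times> 'e) tvec \<Rightarrow> ('a, 'e) tvec) \<Rightarrow> ('a, 'e) tvec \<Rightarrow> ('a, 'e) tvec \<Rightarrow>
    (('a, 'e) tvec \<Rightarrow> (('a, 'e) tvec, 'e \<times> 'e) tvec) \<Rightarrow>
    (('a, 'e) tvec \<Rightarrow> (('a, 'e) tvec, 'e \<times> 'e) tvec) \<Rightarrow> (('a, 'e) tvec, 'e \<times> 'e) tvec" where
  "flat_deriv M K u G C D = tvec_with M K u
     (fibre_deriv M (tbase u) (\<lambda>t. dpi M (C (u +\<^sub>T t *\<^sub>T G))))
     (fibre_deriv M (tbase u) (\<lambda>t. K (D (u +\<^sub>T t *\<^sub>T G))))"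

end

theory Submission
  imports Defs
begin

text \<open>Everything is computed in the coordinates \<open>(x, v)\<close> of \<open>TM\<close> induced by one chart of \<open>M\<close>. There
  \<open>d\<pi>(a, b) = a\<close> and \<open>K(a, b) = b + \<Gamma>\<^sub>x(a, v)\<close>, so the metric of \<open>TM\<close> is an explicit expression in the metric and the
  Christoffel symbols of \<open>M\<close>. Differentiating it yields, by the Koszul identity for constant coordinate
  fields, the Christoffel symbols of \<open>TM\<close>; the derivatives of \<open>\<Gamma>\<close> enter only through the curvature of \<open>M\<close>, whose
  symmetries bring the result into the stated form. A field that vanishes along horizontal curves has zero
  derivative in horizontal directions, because a horizontal curve through \<open>u\<close> with any given horizontal velocity
  exists (a linear differential equation); what remains of the covariant derivative of such a field is
  its flat derivative along the fibre.\<close>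

section \<open>Smooth functions on open sets\<close>

text \<open>In the components (d\<pi>, K) the metric of \<open>TM M\<close> is that of
  \<open>M\<close> with the constant weights m1, m2, m3, but coordinate fields are not adapted to
  this splitting: the K-component of a constant coordinate field varies with the point. Its
  derivative \<open>dKc\<close> is not tensorial and appears throughout the Koszul identity. It
  never has to be evaluated. Exchanging the two vectors in it costs one curvature term and
  Christoffel terms (\<open>dKc_commute\<close>), and in the covariant derivative of a lifted field
  the remaining \<open>dKc\<close> cancels against the derivative of the correction -\<Gamma>(A, v)
  in the coordinates of the horizontal lift. A second obstacle is that the connection map is given
  only through its values on the vectors dZ(X). Nonzero vertical vectors are not of this form, so
  the formula for K in coordinates has to be derived (\<open>tcoord_K\<close>). Once it is
  available, lifts and the metric on lifts become explicit.\<close>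

lemma frechet_derivative_eqI:
  "(f has_derivative f') (at x) \<Longrightarrow> frechet_derivative f (at x) = f'"
  using frechet_derivative_at by metis

lemma frechet_derivative_worksI:
  "f differentiable at x \<Longrightarrow> (f has_derivative frechet_derivative f (at x)) (at x)"
  using frechet_derivative_works by blast

text \<open>The second difference \<open>Q h\<close> is symmetric in \<open>v\<close> and
  \<open>w\<close>. Two applications of the mean value theorem turn it into \<open>h * h\<close>
  times a second derivative at a nearby point, with either order of \<open>v\<close> and
  \<open>w\<close>; continuity of both second derivatives at \<open>x\<close> then forces them to
  agree there.\<close>

lemma real_mixed_derivatives_commute:
  fixes f :: "'a::real_normed_vector \<Rightarrow> real"
  assumes "open S" "x \<in> S" "Ck_on 2 S f"
  shows "frechet_derivative (\<lambda>y. frechet_derivative f (at y) v) (at x) w =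
    frechet_derivative (\<lambda>y. frechet_derivative f (at y) w) (at x) v"
proof -
  define D where "D v y = frechet_derivative f (at y) v" for v y
  define H where "H v w y = frechet_derivative (D v) (at y) w" for v w y
  have D: "(f has_derivative (\<lambda>v. D v y)) (at y)" if "y \<in> S" for y
    using assms(3) that by (simp add: D_def frechet_derivative_works numeral_2_eq_2)
  have H: "(D v has_derivative (\<lambda>w. H v w y)) (at y)" if "y \<in> S" for y v
    using assms(3) that unfolding H_def by (simp add: D_def[abs_def] frechet_derivative_works[symmetric] numeral_2_eq_2)
  have Hc: "continuous_on S (H v w)" for v w
    using assms(3) unfolding H_def[abs_def] by (simp add: D_def[abs_def] numeral_2_eq_2)
  obtain r where r: "r > 0" "cball x r \<subseteq> S" using assms(1,2) open_contains_cball by blast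
  \<comment> \<open>\<open>h * N\<close> bounds the distance from \<open>x\<close> to every point of
    the parallelogram with sides \<open>h *\<^sub>R v\<close> and \<open>h *\<^sub>R w\<close>; the
    summand 1 keeps \<open>N\<close> positive when both vectors vanish.\<close>
  define N where "N = norm v + norm w + 1"
  have N: "N > 0" unfolding N_def by (simp add: add_nonneg_pos)
  define Q where "Q h = f (x + h *\<^sub>R v + h *\<^sub>R w) - f (x + h *\<^sub>R v) - f (x + h *\<^sub>R w) + f x" for h
  have inS: "x + s *\<^sub>R v + t *\<^sub>R w \<in> S \<and> dist (x + s *\<^sub>R v + t *\<^sub>R w) x \<le> h * N"
    if "0 \<le> s" "s \<le> h" "0 \<le> t" "t \<le> h" "h * N \<le> r" for s t h
  proof -
    have "norm (s *\<^sub>R v + t *\<^sub>R w) \<le> s * norm v + t * norm w"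
      using that by (metis abs_of_nonneg norm_scaleR norm_triangle_ineq)
    also have "\<dots> \<le> h * norm v + h * norm w"
      using that by (intro add_mono mult_right_mono) auto
    also have "\<dots> \<le> h * N" unfolding N_def using that by (simp add: algebra_simps)
    finally have *: "dist (x + s *\<^sub>R v + t *\<^sub>R w) x \<le> h * N" by (simp add: dist_norm algebra_simps)
    then show ?thesis using r(2) that(5) by (auto simp: dist_commute subset_iff)
  qed
  \<comment> \<open>\<open>v\<close> and \<open>w\<close> are generalised, and the facts about the
    parallelogram and \<open>Q h\<close> are premises, so that the same argument serves with the two
    sides exchanged.\<close>
  have quot: "\<exists>y. y \<in> S \<and> dist y x \<le> h * N \<and> Q h = h * h * H v w y"
    if h: "0 < h" "h * N \<le> r" and inS: "\<And>s t. 0 \<le> s \<Longrightarrow> s \<le> h \<Longrightarrow> 0 \<le> t \<Longrightarrow> t \<le> h \<Longrightarrow>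
       x + s *\<^sub>R v + t *\<^sub>R w \<in> S \<and> dist (x + s *\<^sub>R v + t *\<^sub>R w) x \<le> h * N"
      and Q: "Q h = f (x + h *\<^sub>R v + h *\<^sub>R w) - f (x + h *\<^sub>R v) - f (x + h *\<^sub>R w) + f x"
    for h v w
  proof -
    have d1: "((\<lambda>s. f (x + s *\<^sub>R v + t *\<^sub>R w)) has_real_derivative D v (x + s *\<^sub>R v + t *\<^sub>R w)) (at s)"
      if "0 \<le> s" "s \<le> h" "0 \<le> t" "t \<le> h" for s t
    proof -
      have "((\<lambda>s. f (x + s *\<^sub>R v + t *\<^sub>R w)) has_derivative
          (\<lambda>k. D (k *\<^sub>R v) (x + s *\<^sub>R v + t *\<^sub>R w))) (at s)"
        using D[of "x + s *\<^sub>R v + t *\<^sub>R w"] inS[OF that]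
        by (intro has_derivative_compose[of "\<lambda>s. x + s *\<^sub>R v + t *\<^sub>R w" _ s UNIV f])
          (auto intro!: derivative_eq_intros)
      moreover have "D (k *\<^sub>R v) (x + s *\<^sub>R v + t *\<^sub>R w) = D v (x + s *\<^sub>R v + t *\<^sub>R w) * k" for k
        using linear_scale[OF has_derivative_linear[OF D], of "x + s *\<^sub>R v + t *\<^sub>R w" k v] inS[OF that] by simp
      ultimately show ?thesis by (simp add: has_field_derivative_def)
    qed
    have d2: "((\<lambda>t. D v (x + s *\<^sub>R v + t *\<^sub>R w)) has_real_derivative H v w (x + s *\<^sub>R v + t *\<^sub>R w)) (at t)"
      if "0 \<le> s" "s \<le> h" "0 \<le> t" "t \<le> h" for s t
    proof -
      have "((\<lambda>t. D v (x + s *\<^sub>R v + t *\<^sub>R w)) has_derivative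
          (\<lambda>k. H v (k *\<^sub>R w) (x + s *\<^sub>R v + t *\<^sub>R w))) (at t)"
        using H[of "x + s *\<^sub>R v + t *\<^sub>R w" v] inS[OF that]
        by (intro has_derivative_compose[of "\<lambda>t. x + s *\<^sub>R v + t *\<^sub>R w" _ t UNIV "D v"])
          (auto intro!: derivative_eq_intros)
      moreover have "H v (k *\<^sub>R w) (x + s *\<^sub>R v + t *\<^sub>R w) = H v w (x + s *\<^sub>R v + t *\<^sub>R w) * k" for k
        using linear_scale[OF has_derivative_linear[OF H], of "x + s *\<^sub>R v + t *\<^sub>R w" v k w] inS[OF that] by simp
      ultimately show ?thesis by (simp add: has_field_derivative_def)
    qed
    define \<phi> where "\<phi> s = f (x + s *\<^sub>R v + h *\<^sub>R w) - f (x + s *\<^sub>R v + 0 *\<^sub>R w)" for s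
    have "\<exists>s. 0 < s \<and> s < h \<and> \<phi> h - \<phi> 0 =
        (h - 0) * (D v (x + s *\<^sub>R v + h *\<^sub>R w) - D v (x + s *\<^sub>R v + 0 *\<^sub>R w))"
      unfolding \<phi>_def
    proof (rule MVT2[OF h(1)])
      fix s assume "0 \<le> s" "s \<le> h"
      then show "((\<lambda>s. f (x + s *\<^sub>R v + h *\<^sub>R w) - f (x + s *\<^sub>R v + 0 *\<^sub>R w)) has_real_derivative
          D v (x + s *\<^sub>R v + h *\<^sub>R w) - D v (x + s *\<^sub>R v + 0 *\<^sub>R w)) (at s)"
        using h by (intro DERIV_diff d1) auto
    qed
    then obtain s where s: "0 < s" "s < h" and
      \<phi>: "\<phi> h - \<phi> 0 = h * (D v (x + s *\<^sub>R v + h *\<^sub>R w) - D v (x + s *\<^sub>R v + 0 *\<^sub>R w))" by auto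
    have "\<exists>t. 0 < t \<and> t < h \<and> D v (x + s *\<^sub>R v + h *\<^sub>R w) - D v (x + s *\<^sub>R v + 0 *\<^sub>R w) =
        (h - 0) * H v w (x + s *\<^sub>R v + t *\<^sub>R w)"
      by (rule MVT2[OF h(1)], rule d2) (use s in auto)
    then obtain t where t: "0 < t" "t < h" and
      "D v (x + s *\<^sub>R v + h *\<^sub>R w) - D v (x + s *\<^sub>R v + 0 *\<^sub>R w) = h * H v w (x + s *\<^sub>R v + t *\<^sub>R w)"
      by auto
    with \<phi> have "Q h = h * h * H v w (x + s *\<^sub>R v + t *\<^sub>R w)"
      unfolding Q \<phi>_def by simp
    then show ?thesis using inS[of s t] s t h by auto
  qed
  have "\<bar>H v w x - H w v x\<bar> < e" if e: "e > 0" for e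
  proof -
    have "\<exists>d>0. \<forall>y\<in>S. dist y x < d \<longrightarrow> dist (H v w y) (H v w x) < e/2" for v w
      using Hc[of v w] e assms(2) unfolding continuous_on_iff by (meson half_gt_zero)
    then obtain d1 d2 where d: "d1 > 0" "d2 > 0"
      "\<And>y. y \<in> S \<Longrightarrow> dist y x < d1 \<Longrightarrow> dist (H v w y) (H v w x) < e/2"
      "\<And>y. y \<in> S \<Longrightarrow> dist y x < d2 \<Longrightarrow> dist (H w v y) (H w v x) < e/2" by metis
    \<comment> \<open>The factor 2 makes \<open>h * N\<close> strictly smaller than both
      \<open>d1\<close> and \<open>d2\<close>.\<close>
    define h where "h = min r (min d1 d2) / (2 * N)"
    have h: "h > 0" "h * N \<le> r" "h * N < d1" "h * N < d2"
      unfolding h_def using r d N by (auto simp: field_simps min_def)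
    obtain y where y: "y \<in> S" "dist y x \<le> h * N" "Q h = h * h * H v w y"
      using quot[OF h(1,2), of v w] inS h(1,2) unfolding Q_def by metis
    obtain z where z: "z \<in> S" "dist z x \<le> h * N" "Q h = h * h * H w v z"
    proof -
      have "x + s *\<^sub>R w + t *\<^sub>R v \<in> S \<and> dist (x + s *\<^sub>R w + t *\<^sub>R v) x \<le> h * N"
        if "0 \<le> s" "s \<le> h" "0 \<le> t" "t \<le> h" for s t
        using inS[of t h s] that h by (simp add: add.commute add.left_commute)
      moreover have "Q h = f (x + h *\<^sub>R w + h *\<^sub>R v) - f (x + h *\<^sub>R w) - f (x + h *\<^sub>R v) + f x"
        unfolding Q_def by (simp add: add.commute add.left_commute)
      ultimately show ?thesis using quot[OF h(1,2), of w v] that by metis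
    qed
    have "H v w y = H w v z" using y(3) z(3) h(1) by simp
    then show ?thesis using d(3)[of y] d(4)[of z] y z h unfolding dist_real_def by linarith
  qed
  then have "H v w x = H w v x" by (metis less_irrefl zero_less_abs_iff right_minus_eq)
  then show ?thesis unfolding H_def D_def[abs_def] .
qed

section \<open>Closure properties of C^k and smooth maps\<close>

lemma has_derivative_cong_open:
  assumes "open S" "x \<in> S" "\<And>y. y \<in> S \<Longrightarrow> f y = g y"
  shows "(f has_derivative f') (at x) \<longleftrightarrow> (g has_derivative f') (at x)"
  using has_derivative_transform_within_open[OF _ assms(1,2), of f f' UNIV g]
    has_derivative_transform_within_open[OF _ assms(1,2), of g f' UNIV f] assms(3) by auto

lemma frechet_derivative_cong_open:
  assumes "open S" "x \<in> S" "\<And>y. y \<in> S \<Longrightarrow> f y = g y"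
  shows "frechet_derivative f (at x) = frechet_derivative g (at x)"
  unfolding frechet_derivative_def using has_derivative_cong_open[OF assms] by simp

lemma differentiable_cong_open:
  assumes "open S" "x \<in> S" "\<And>y. y \<in> S \<Longrightarrow> f y = g y"
  shows "f differentiable at x \<longleftrightarrow> g differentiable at x"
  unfolding differentiable_def using has_derivative_cong_open[OF assms] by simp

text \<open>Openness matters: a derivative at a point sees the function on a neighbourhood, so
  agreement on \<open>S\<close> passes to all derivatives when \<open>S\<close> is open.\<close>

lemma Ck_on_cong:
  assumes "open S" "\<And>x. x \<in> S \<Longrightarrow> f x = g x"
  shows "Ck_on k S f \<longleftrightarrow> Ck_on k S g"
  using assms(2)
proof (induction k arbitrary: f g)
  case 0
  then show ?case by (auto intro: continuous_on_cong)
next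
  case (Suc k)
  have "Ck_on k S (\<lambda>x. frechet_derivative f (at x) v) \<longleftrightarrow>
      Ck_on k S (\<lambda>x. frechet_derivative g (at x) v)" for v
    by (rule Suc.IH) (simp only: frechet_derivative_cong_open[OF assms(1) _ Suc.prems])
  then show ?case using differentiable_cong_open[OF assms(1) _ Suc.prems] by simp
qed

lemma Ck_on_transform:
  "open S \<Longrightarrow> Ck_on k S g \<Longrightarrow> (\<And>x. x \<in> S \<Longrightarrow> f x = g x) \<Longrightarrow> Ck_on k S f"
  by (simp only: Ck_on_cong[of S f g])

lemma Ck_on_subset: "Ck_on k S f \<Longrightarrow> T \<subseteq> S \<Longrightarrow> Ck_on k T f"
  by (induction k arbitrary: f) (auto intro: continuous_on_subset)

lemma Ck_on_Suc_imp: "Ck_on (Suc k) S f \<Longrightarrow> Ck_on k S f"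
proof (induction k arbitrary: f)
  case 0
  then show ?case by (auto intro!: continuous_at_imp_continuous_on differentiable_imp_continuous_within)
next
  case (Suc k)
  then show ?case by (metis Ck_on.simps(2))
qed

lemma Ck_on_const: "Ck_on k S (\<lambda>x. c)"
  by (induction k arbitrary: c) (simp_all add: frechet_derivative_const)

lemma Ck_on_bounded_linear: "bounded_linear f \<Longrightarrow> Ck_on k S f"
proof (cases k)
  case (Suc m)
  assume f: "bounded_linear f"
  then have "frechet_derivative f (at x) = f" for x
    by (intro frechet_derivative_eqI bounded_linear_imp_has_derivative)
  then show ?thesis using Suc f by (simp add: Ck_on_const bounded_linear_imp_differentiable)
qed (simp add: linear_continuous_on)

lemma Ck_on_add:
  assumes "open S" "Ck_on k S f" "Ck_on k S g"
  shows "Ck_on k S (\<lambda>x. f x + g x)"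
  using assms(2,3)
proof (induction k arbitrary: f g)
  case 0
  then show ?case by (auto intro: continuous_intros)
next
  case (Suc k)
  have "frechet_derivative (\<lambda>x. f x + g x) (at x) v =
      frechet_derivative f (at x) v + frechet_derivative g (at x) v" if "x \<in> S" for x v
    by (subst frechet_derivative_eqI[OF has_derivative_add]; (rule frechet_derivative_worksI refl)?)
      (use Suc.prems that in auto)
  moreover have "Ck_on k S (\<lambda>x. frechet_derivative f (at x) v + frechet_derivative g (at x) v)" for v
    by (rule Suc.IH) (use Suc.prems in auto)
  ultimately have "Ck_on k S (\<lambda>x. frechet_derivative (\<lambda>x. f x + g x) (at x) v)" for v
    by - (rule Ck_on_transform[OF assms(1)], assumption, simp)
  then show ?case using Suc.prems by simp
qed

lemma Ck_on_Pair:
  assumes "open S" "Ck_on k S f" "Ck_on k S g"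
  shows "Ck_on k S (\<lambda>x. (f x, g x))"
  using assms(2,3)
proof (induction k arbitrary: f g)
  case 0
  then show ?case by (auto intro: continuous_intros)
next
  case (Suc k)
  have D: "((\<lambda>x. (f x, g x)) has_derivative (\<lambda>v. (frechet_derivative f (at x) v, frechet_derivative g (at x) v))) (at x)"
    if "x \<in> S" for x
    using Suc.prems that by (intro has_derivative_Pair) (auto simp: frechet_derivative_works)
  then have "frechet_derivative (\<lambda>x. (f x, g x)) (at x) v =
      (frechet_derivative f (at x) v, frechet_derivative g (at x) v)" if "x \<in> S" for x v
    using frechet_derivative_eqI[OF D[OF that]] by simp
  moreover have "Ck_on k S (\<lambda>x. (frechet_derivative f (at x) v, frechet_derivative g (at x) v))" for v
    by (rule Suc.IH) (use Suc.prems in auto)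
  ultimately have "Ck_on k S (\<lambda>x. frechet_derivative (\<lambda>x. (f x, g x)) (at x) v)" for v
    by - (rule Ck_on_transform[OF assms(1)], assumption, simp)
  then show ?case using D unfolding Ck_on.simps differentiable_def by blast
qed

text \<open>The product rule leaves one factor undifferentiated in each summand, so the induction
  also uses that C^(k+1) maps are C^k.\<close>

lemma Ck_on_bilinear:
  assumes "bounded_bilinear b" "open S" "Ck_on k S f" "Ck_on k S g"
  shows "Ck_on k S (\<lambda>x. b (f x) (g x))"
  using assms(3,4)
proof (induction k arbitrary: f g)
  case 0
  then show ?case using bounded_bilinear.continuous_on[OF assms(1)] by auto
next
  case (Suc k)
  have D: "((\<lambda>x. b (f x) (g x)) has_derivative (\<lambda>v. b (f x) (frechet_derivative g (at x) v) +
      b (frechet_derivative f (at x) v) (g x))) (at x)"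
    if "x \<in> S" for x
    by (intro bounded_bilinear.FDERIV[OF assms(1)] frechet_derivative_worksI) (use Suc.prems that in auto)
  then have "frechet_derivative (\<lambda>x. b (f x) (g x)) (at x) v = b (f x) (frechet_derivative g (at x) v) +
      b (frechet_derivative f (at x) v) (g x)" if "x \<in> S" for x v
    using frechet_derivative_eqI[OF D[OF that]] by simp
  moreover have "Ck_on k S (\<lambda>x. b (f x) (frechet_derivative g (at x) v) +
      b (frechet_derivative f (at x) v) (g x))" for v
    using Suc.prems Ck_on_Suc_imp[OF Suc.prems(1)] Ck_on_Suc_imp[OF Suc.prems(2)]
    by (intro Ck_on_add[OF assms(2)] Suc.IH) (simp_all only: Ck_on.simps)
  ultimately have "Ck_on k S (\<lambda>x. frechet_derivative (\<lambda>x. b (f x) (g x)) (at x) v)" for v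
    by - (rule Ck_on_transform[OF assms(2)], assumption, simp)
  then show ?case using D unfolding Ck_on.simps differentiable_def by blast
qed

lemma Ck_on_sum:
  assumes "open S" "\<And>i. i \<in> I \<Longrightarrow> Ck_on k S (f i)"
  shows "Ck_on k S (\<lambda>x. \<Sum>i\<in>I. f i x)"
  using assms(2) by (induction I rule: infinite_finite_induct) (simp_all add: Ck_on_const Ck_on_add[OF assms(1)])

lemma linear_eq_sum_Basis:
  fixes f :: "'a::euclidean_space \<Rightarrow> 'b::real_vector"
  assumes "linear f"
  shows "f v = (\<Sum>i\<in>Basis. (v \<bullet> i) *\<^sub>R f i)"
proof -
  have "f v = f (\<Sum>i\<in>Basis. (v \<bullet> i) *\<^sub>R i)" by (simp add: euclidean_representation)
  then show ?thesis using assms by (simp add: linear_sum linear_scale)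
qed

text \<open>The chain rule differentiates \<open>f\<close> in a direction that moves with
  \<open>x\<close>, whereas \<open>Ck_on\<close> controls only fixed directions. Expanding the
  moving direction in a basis reduces one to the other; this is why \<open>g\<close> takes values in
  a Euclidean space.\<close>

lemma Ck_on_compose:
  fixes g :: "'a::real_normed_vector \<Rightarrow> 'b::euclidean_space"
  assumes "open S" "open T" "Ck_on k T f" "Ck_on k S g" "g ` S \<subseteq> T"
  shows "Ck_on k S (\<lambda>x. f (g x))"
  using assms(3,4)
proof (induction k arbitrary: f)
  case 0
  then show ?case using assms(5) by (auto intro: continuous_on_compose2)
next
  case (Suc k)
  have D: "((\<lambda>x. f (g x)) has_derivative
      (\<lambda>v. frechet_derivative f (at (g x)) (frechet_derivative g (at x) v))) (at x)"
    if "x \<in> S" for x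
    using Suc.prems that assms(5)
    by (intro has_derivative_compose[of g _ x UNIV f]) (auto simp: frechet_derivative_works image_subset_iff)
  have "frechet_derivative (\<lambda>x. f (g x)) (at x) v =
      (\<Sum>i\<in>Basis. (frechet_derivative g (at x) v \<bullet> i) *\<^sub>R frechet_derivative f (at (g x)) i)"
    if "x \<in> S" for x v
    unfolding frechet_derivative_eqI[OF D[OF that]]
    by (intro linear_eq_sum_Basis linear_frechet_derivative) (use Suc.prems that assms(5) in auto)
  moreover have "Ck_on k S (\<lambda>x. \<Sum>i\<in>Basis. (frechet_derivative g (at x) v \<bullet> i) *\<^sub>R frechet_derivative f (at (g x)) i)"
    for v
  proof (intro Ck_on_sum[OF assms(1)] Ck_on_bilinear[OF bounded_bilinear_scaleR assms(1)]
      Ck_on_bilinear[OF bounded_bilinear_inner assms(1)] Ck_on_const)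
    show "Ck_on k S (\<lambda>x. frechet_derivative g (at x) v)" using Suc.prems by simp
    show "Ck_on k S (\<lambda>x. frechet_derivative f (at (g x)) i)" for i
      using Suc.prems Ck_on_Suc_imp[of k S] by (intro Suc.IH) auto
  qed
  ultimately have "Ck_on k S (\<lambda>x. frechet_derivative (\<lambda>x. f (g x)) (at x) v)" for v
    by - (rule Ck_on_transform[OF assms(1)], assumption, simp)
  then show ?case using D unfolding Ck_on.simps differentiable_def by blast
qed

lemma smooth_on_cong:
  "open S \<Longrightarrow> (\<And>x. x \<in> S \<Longrightarrow> f x = g x) \<Longrightarrow> smooth_on S f \<longleftrightarrow> smooth_on S g"
  unfolding smooth_on_def by (simp only: Ck_on_cong[of S f g])

lemma smooth_on_transform:
  "open S \<Longrightarrow> smooth_on S g \<Longrightarrow> (\<And>x. x \<in> S \<Longrightarrow> f x = g x) \<Longrightarrow> smooth_on S f"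
  by (simp only: smooth_on_cong[of S f g])

lemma smooth_on_subset: "smooth_on S f \<Longrightarrow> T \<subseteq> S \<Longrightarrow> smooth_on T f"
  unfolding smooth_on_def using Ck_on_subset by blast

lemma smooth_on_const: "smooth_on S (\<lambda>x. c)"
  unfolding smooth_on_def using Ck_on_const by blast

lemma smooth_on_bounded_linear: "bounded_linear f \<Longrightarrow> smooth_on S f"
  unfolding smooth_on_def using Ck_on_bounded_linear by blast

lemma smooth_on_add: "open S \<Longrightarrow> smooth_on S f \<Longrightarrow> smooth_on S g \<Longrightarrow> smooth_on S (\<lambda>x. f x + g x)"
  unfolding smooth_on_def using Ck_on_add by blast

lemma smooth_on_Pair: "open S \<Longrightarrow> smooth_on S f \<Longrightarrow> smooth_on S g \<Longrightarrow> smooth_on S (\<lambda>x. (f x, g x))"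
  unfolding smooth_on_def using Ck_on_Pair by blast

lemma smooth_on_bilinear:
  "bounded_bilinear b \<Longrightarrow> open S \<Longrightarrow> smooth_on S f \<Longrightarrow> smooth_on S g \<Longrightarrow> smooth_on S (\<lambda>x. b (f x) (g x))"
  unfolding smooth_on_def by (intro allI, rule Ck_on_bilinear) simp_all

lemmas smooth_on_scaleR = smooth_on_bilinear[OF bounded_bilinear_scaleR]
lemmas smooth_on_inner = smooth_on_bilinear[OF bounded_bilinear_inner]

lemma smooth_on_sum:
  "open S \<Longrightarrow> (\<And>i. i \<in> I \<Longrightarrow> smooth_on S (f i)) \<Longrightarrow> smooth_on S (\<lambda>x. \<Sum>i\<in>I. f i x)"
  unfolding smooth_on_def by (intro allI Ck_on_sum) simp_all

lemma smooth_on_compose: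
  fixes g :: "'a::real_normed_vector \<Rightarrow> 'b::euclidean_space"
  shows "open S \<Longrightarrow> open T \<Longrightarrow> smooth_on T f \<Longrightarrow> smooth_on S g \<Longrightarrow> g ` S \<subseteq> T \<Longrightarrow> smooth_on S (\<lambda>x. f (g x))"
  unfolding smooth_on_def by (intro allI, rule Ck_on_compose[of S T]) simp_all

lemma smooth_on_diff:
  assumes "open S" "smooth_on S f" "smooth_on S g"
  shows "smooth_on S (\<lambda>x. f x - g x)"
  using smooth_on_add[OF assms(1,2) smooth_on_scaleR[OF assms(1) smooth_on_const[of S "-1"] assms(3)]] by simp

lemma smooth_on_imp_differentiable: "smooth_on S f \<Longrightarrow> x \<in> S \<Longrightarrow> f differentiable at x"
  unfolding smooth_on_def by (auto dest: spec[of _ "Suc 0"])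

lemma smooth_on_has_derivative:
  "smooth_on S f \<Longrightarrow> x \<in> S \<Longrightarrow> (f has_derivative frechet_derivative f (at x)) (at x)"
  by (intro frechet_derivative_worksI smooth_on_imp_differentiable)

lemma smooth_on_frechet_derivative:
  "smooth_on S f \<Longrightarrow> smooth_on S (\<lambda>x. frechet_derivative f (at x) v)"
  unfolding smooth_on_def
proof
  fix k assume "\<forall>k. Ck_on k S f"
  then have "Ck_on (Suc k) S f" ..
  then show "Ck_on k S (\<lambda>x. frechet_derivative f (at x) v)" by simp
qed

lemma smooth_on_imp_continuous_on: "smooth_on S f \<Longrightarrow> continuous_on S f"
  unfolding smooth_on_def by (auto dest: spec[of _ 0])

text \<open>Again the direction is expanded in a basis. Coordinate changes of vector fields and the
  transition maps of the tangent bundle have this form.\<close>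

lemma smooth_on_frechet_derivative_apply:
  fixes f :: "'a::euclidean_space \<Rightarrow> 'b::real_normed_vector"
  assumes "open S" "open T" "smooth_on T f" "smooth_on S g" "g ` S \<subseteq> T" "smooth_on S h"
  shows "smooth_on S (\<lambda>x. frechet_derivative f (at (g x)) (h x))"
proof -
  have "smooth_on S (\<lambda>x. \<Sum>i\<in>Basis. (h x \<bullet> i) *\<^sub>R frechet_derivative f (at (g x)) i)"
    by (intro smooth_on_sum smooth_on_scaleR smooth_on_inner assms smooth_on_const
        smooth_on_compose[OF assms(1,2) smooth_on_frechet_derivative])
  moreover have "frechet_derivative f (at (g x)) (h x) =
      (\<Sum>i\<in>Basis. (h x \<bullet> i) *\<^sub>R frechet_derivative f (at (g x)) i)" if "x \<in> S" for x
    by (intro linear_eq_sum_Basis linear_frechet_derivative)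
      (use assms(3,5) that smooth_on_imp_differentiable in blast)
  ultimately show ?thesis by - (rule smooth_on_transform[OF assms(1)], assumption, simp)
qed

text \<open>Taking the inner product with a basis vector commutes with differentiation, which
  reduces the claim to real-valued functions.\<close>

lemma mixed_derivatives_commute:
  fixes f :: "'a::real_normed_vector \<Rightarrow> 'b::euclidean_space"
  assumes "open S" "x \<in> S" "smooth_on S f"
  shows "frechet_derivative (\<lambda>y. frechet_derivative f (at y) v) (at x) w =
    frechet_derivative (\<lambda>y. frechet_derivative f (at y) w) (at x) v"
proof (rule euclidean_eqI)
  fix b :: 'b assume "b \<in> Basis"
  have inner: "frechet_derivative (\<lambda>y. h y \<bullet> b) (at y) = (\<lambda>v. frechet_derivative h (at y) v \<bullet> b)"
    if "h differentiable at y" for h :: "'a \<Rightarrow> 'b" and y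
    by (rule frechet_derivative_eqI[OF has_derivative_inner_left[OF frechet_derivative_worksI[OF that]]])
  have "frechet_derivative (\<lambda>y. frechet_derivative f (at y) v) (at x) w \<bullet> b =
      frechet_derivative (\<lambda>y. frechet_derivative (\<lambda>y. f y \<bullet> b) (at y) v) (at x) w" for v w
  proof -
    have "frechet_derivative (\<lambda>y. frechet_derivative (\<lambda>y. f y \<bullet> b) (at y) v) (at x) =
        frechet_derivative (\<lambda>y. frechet_derivative f (at y) v \<bullet> b) (at x)"
    proof (rule frechet_derivative_cong_open[OF assms(1,2)])
      fix y assume "y \<in> S"
      then show "frechet_derivative (\<lambda>y. f y \<bullet> b) (at y) v = frechet_derivative f (at y) v \<bullet> b"
        using inner[OF smooth_on_imp_differentiable[OF assms(3)]] by metis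
    qed
    then show ?thesis
      using inner[OF smooth_on_imp_differentiable[OF smooth_on_frechet_derivative[OF assms(3)] assms(2)]]
      by metis
  qed
  moreover have "Ck_on 2 S (\<lambda>y. f y \<bullet> b)"
    using smooth_on_inner[OF assms(1,3) smooth_on_const] unfolding smooth_on_def by blast
  ultimately show "frechet_derivative (\<lambda>y. frechet_derivative f (at y) v) (at x) w \<bullet> b =
      frechet_derivative (\<lambda>y. frechet_derivative f (at y) w) (at x) v \<bullet> b"
    using real_mixed_derivatives_commute[OF assms(1,2)] by metis
qed

section \<open>Bilinear maps depending on a parameter\<close>

lemma bilinear_eq_sum_Basis:
  fixes f :: "'y::euclidean_space \<Rightarrow> 'z::euclidean_space \<Rightarrow> 'c::real_vector"
  assumes "bilinear f"
  shows "f y z = (\<Sum>i\<in>Basis. \<Sum>j\<in>Basis. ((y \<bullet> i) * (z \<bullet> j)) *\<^sub>R f i j)"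
proof -
  have "f y z = (\<Sum>i\<in>Basis. (y \<bullet> i) *\<^sub>R f i z)"
    using linear_eq_sum_Basis[of "\<lambda>y. f y z"] assms unfolding bilinear_def by blast
  moreover have "f i z = (\<Sum>j\<in>Basis. (z \<bullet> j) *\<^sub>R f i j)" for i
    using linear_eq_sum_Basis[of "f i"] assms unfolding bilinear_def by blast
  ultimately show ?thesis by (simp add: scaleR_sum_right)
qed

text \<open>For Christoffel symbols and metrics in coordinates. Expanding in bases reduces joint differentiability
  to that of the coefficients.\<close>

lemma has_derivative_bilinear_param:
  fixes f :: "'x::real_normed_vector \<Rightarrow> 'y::euclidean_space \<Rightarrow> 'z::euclidean_space \<Rightarrow> 'c::real_normed_vector"
    and x :: "'t::real_normed_vector \<Rightarrow> 'x"
  assumes S: "open S" "x t \<in> S" and f: "\<And>p. p \<in> S \<Longrightarrow> bilinear (f p)"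
    and fd: "\<And>b c. (\<lambda>p. f p b c) differentiable at (x t)"
    and x: "(x has_derivative x') (at t)" and y: "(y has_derivative y') (at t)"
    and z: "(z has_derivative z') (at t)"
  shows "((\<lambda>s. f (x s) (y s) (z s)) has_derivative
    (\<lambda>h. frechet_derivative (\<lambda>p. f p (y t) (z t)) (at (x t)) (x' h) + f (x t) (y' h) (z t) + f (x t) (y t) (z' h)))
    (at t)"
proof -
  define d where "d b c = frechet_derivative (\<lambda>p. f p b c) (at (x t))" for b c
  have fd': "((\<lambda>p. f p b c) has_derivative d b c) (at (x t))" for b c
    unfolding d_def by (rule frechet_derivative_worksI[OF fd])
  \<comment> \<open>The derivative in the parameter inherits bilinearity in \<open>b\<close> and
    \<open>c\<close>; it is read off by differentiating the basis expansion and using uniqueness of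
    derivatives.\<close>
  have d_sum: "d b c = (\<lambda>h. \<Sum>i\<in>Basis. \<Sum>j\<in>Basis. ((b \<bullet> i) * (c \<bullet> j)) *\<^sub>R d i j h)" for b c
  proof -
    have "((\<lambda>p. \<Sum>i\<in>Basis. \<Sum>j\<in>Basis. ((b \<bullet> i) * (c \<bullet> j)) *\<^sub>R f p i j) has_derivative
        (\<lambda>h. \<Sum>i\<in>Basis. \<Sum>j\<in>Basis. ((b \<bullet> i) * (c \<bullet> j)) *\<^sub>R d i j h)) (at (x t))"
      by (intro has_derivative_sum has_derivative_scaleR_right fd')
    then have "((\<lambda>p. f p b c) has_derivative
        (\<lambda>h. \<Sum>i\<in>Basis. \<Sum>j\<in>Basis. ((b \<bullet> i) * (c \<bullet> j)) *\<^sub>R d i j h)) (at (x t))"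
      by (rule has_derivative_cong_open[OF S, THEN iffD2, rotated]) (rule bilinear_eq_sum_Basis[OF f])
    then show ?thesis by (rule has_derivative_unique[OF fd'])
  qed
  \<comment> \<open>The basis expansion of \<open>f (x s)\<close> is valid only where
    \<open>x s\<close> lies in \<open>S\<close>, hence for \<open>s\<close> near
    \<open>t\<close>.\<close>
  obtain T where T: "open T" "t \<in> T" "x ` T \<subseteq> S"
  proof -
    have "isCont x t" using has_derivative_continuous[OF x] .
    then obtain T where "open T" "t \<in> T" "\<forall>s\<in>T. x s \<in> S" using S unfolding continuous_at_open by blast
    then show thesis by (intro that[of T]) auto
  qed
  have "((\<lambda>s. f (x s) i j) has_derivative (\<lambda>h. d i j (x' h))) (at t)" for i j
    by (rule has_derivative_compose[OF x fd'])
  then have "((\<lambda>s. \<Sum>i\<in>Basis. \<Sum>j\<in>Basis. ((y s \<bullet> i) * (z s \<bullet> j)) *\<^sub>R f (x s) i j) has_derivative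
      (\<lambda>h. \<Sum>i\<in>Basis. \<Sum>j\<in>Basis. ((y t \<bullet> i) * (z t \<bullet> j)) *\<^sub>R d i j (x' h) +
        ((y t \<bullet> i) * (z' h \<bullet> j) + (y' h \<bullet> i) * (z t \<bullet> j)) *\<^sub>R f (x t) i j)) (at t)"
    by (intro has_derivative_sum has_derivative_scaleR has_derivative_mult has_derivative_inner_left y z)
  moreover have "(\<Sum>i\<in>Basis. \<Sum>j\<in>Basis. ((y t \<bullet> i) * (z t \<bullet> j)) *\<^sub>R d i j (x' h) +
        ((y t \<bullet> i) * (z' h \<bullet> j) + (y' h \<bullet> i) * (z t \<bullet> j)) *\<^sub>R f (x t) i j) =
      d (y t) (z t) (x' h) + f (x t) (y' h) (z t) + f (x t) (y t) (z' h)" for h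
    unfolding d_sum[of "y t" "z t"] bilinear_eq_sum_Basis[OF f[OF S(2)], of "y' h" "z t"]
      bilinear_eq_sum_Basis[OF f[OF S(2)], of "y t" "z' h"]
    by (simp add: sum.distrib scaleR_add_left)
  ultimately have "((\<lambda>s. \<Sum>i\<in>Basis. \<Sum>j\<in>Basis. ((y s \<bullet> i) * (z s \<bullet> j)) *\<^sub>R f (x s) i j) has_derivative
      (\<lambda>h. d (y t) (z t) (x' h) + f (x t) (y' h) (z t) + f (x t) (y t) (z' h))) (at t)" by (simp only:)
  then show ?thesis unfolding d_def
    by (rule has_derivative_cong_open[OF T(1,2), THEN iffD2, rotated])
      (rule bilinear_eq_sum_Basis[OF f], use T(3) in auto)
qed

section \<open>Linear differential equations\<close>

text \<open>Picard iteration: the integral equation is a contraction on a short interval, and its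
  fixed point is differentiable by the fundamental theorem of calculus. Smoothness follows by
  bootstrapping.\<close>

lemma linear_ode_local_solution:
  fixes A :: "real \<Rightarrow> 'e::euclidean_space \<Rightarrow> 'e"
  assumes r: "r > 0" and lin: "\<And>t. t \<in> {-r<..<r} \<Longrightarrow> linear (A t)"
    and sm: "\<And>b. smooth_on {-r<..<r} (\<lambda>t. A t b)"
  obtains \<delta> y where "0 < \<delta>" "\<delta> \<le> r" "y 0 = y0" "smooth_on {-\<delta><..<\<delta>} y"
    "\<And>t. t \<in> {-\<delta><..<\<delta>} \<Longrightarrow> (y has_vector_derivative A t (y t)) (at t)"
proof -
  have Asum: "A t v = (\<Sum>b\<in>Basis. (v \<bullet> b) *\<^sub>R A t b)" if "t \<in> {-r<..<r}" for t v
    by (rule linear_eq_sum_Basis[OF lin[OF that]])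
  \<comment> \<open>A bound for the operator norm of \<open>A t\<close>. Being continuous, it is
    bounded by some \<open>m\<close> on the compact half-size interval.\<close>
  define N where "N t = (\<Sum>b\<in>Basis. norm (A t b))" for t
  have sub: "{-(r/2)..r/2} \<subseteq> {-r<..<r}" using r by auto
  have "continuous_on {-(r/2)..r/2} N"
    unfolding N_def by (intro continuous_intros continuous_on_subset[OF smooth_on_imp_continuous_on[OF sm] sub])
  then have "bounded (N ` {-(r/2)..r/2})"
    by (intro compact_imp_bounded compact_continuous_image) auto
  then obtain m where m: "\<And>t. t \<in> {-(r/2)..r/2} \<Longrightarrow> norm (N t) \<le> m" "m > 0"
    unfolding bounded_pos by (metis imageI)
  have bound: "norm (A t v) \<le> m * norm v" if t: "t \<in> {-(r/2)..r/2}" for t v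
  proof -
    have "norm (A t v) \<le> (\<Sum>b\<in>Basis. norm ((v \<bullet> b) *\<^sub>R A t b))"
      using Asum[of t v] t sub norm_sum[of "\<lambda>b. (v \<bullet> b) *\<^sub>R A t b" Basis] by auto
    also have "\<dots> \<le> (\<Sum>b\<in>Basis. norm v * norm (A t b))"
      by (intro sum_mono) (auto intro!: mult_right_mono Basis_le_norm)
    also have "\<dots> = N t * norm v" unfolding N_def by (simp add: sum_distrib_left mult.commute)
    also have "\<dots> \<le> m * norm v" using m(1)[OF t] by (intro mult_right_mono) auto
    finally show ?thesis .
  qed
  \<comment> \<open>\<open>r/2\<close> keeps the interval inside the region where \<open>m\<close>
    is a bound. \<open>T\<close> involves two integrals over intervals of length at most 2\<delta>,
    so its Lipschitz constant is at most 4\<delta>m, which \<open>1 / (8 * m)\<close> makes at most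
    1/2.\<close>
  define \<delta> where "\<delta> = min (r/2) (1 / (8 * m))"
  have \<delta>: "0 < \<delta>" "\<delta> \<le> r/2" "4 * \<delta> * m \<le> 1/2" unfolding \<delta>_def using r m(2) by (auto simp: min_def field_simps)
  have sub\<delta>: "{-\<delta>..\<delta>} \<subseteq> {-(r/2)..r/2}" using \<delta> by auto
  have cont: "continuous_on {-\<delta>..\<delta>} (\<lambda>s. A s (f s))" if f: "continuous_on {-\<delta>..\<delta>} f" for f
  proof -
    have "continuous_on {-\<delta>..\<delta>} (\<lambda>s. \<Sum>b\<in>Basis. (f s \<bullet> b) *\<^sub>R A s b)"
      using sub sub\<delta> by (intro continuous_intros f continuous_on_subset[OF smooth_on_imp_continuous_on[OF sm]]) auto
    then show ?thesis
      by (rule continuous_on_cong[THEN iffD1, rotated 2]) (use Asum sub sub\<delta> in \<open>auto simp: subset_iff\<close>)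
  qed
  \<comment> \<open>The integral starts at -\<delta> because an integral over \<open>{0..t}\<close>
    is zero for negative \<open>t\<close>; the difference \<open>I f t - I f 0\<close> is the
    oriented integral from 0 to \<open>t\<close>.\<close>
  define I where "I f t = integral {-\<delta>..t} (\<lambda>s. A s (f s))" for f t
  \<comment> \<open>Clamping the time to [-\<delta>, \<delta>] turns functions on the interval into
    bounded continuous functions on the whole line, a complete metric space given as a type, where
    Banach's theorem applies.\<close>
  define cl where "cl t = max (-\<delta>) (min \<delta> t)" for t
  have cl: "cl t \<in> {-\<delta>..\<delta>}" "t \<in> {-\<delta>..\<delta>} \<Longrightarrow> cl t = t" for t unfolding cl_def using \<delta> by auto
  define T where "T \<phi> t = y0 + (I (apply_bcontfun \<phi>) (cl t) - I (apply_bcontfun \<phi>) 0)" for \<phi> t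
  have int: "(\<lambda>s. A s (f s)) integrable_on {-\<delta>..t}" if "continuous_on {-\<delta>..\<delta>} f" "t \<in> {-\<delta>..\<delta>}" for f t
    by (intro integrable_continuous_real continuous_on_subset[OF cont[OF that(1)]]) (use that(2) in auto)
  have I_cont: "continuous_on {-\<delta>..\<delta>} (I f)" if "continuous_on {-\<delta>..\<delta>} f" for f
    unfolding I_def by (intro indefinite_integral_continuous_1 int[OF that]) (use \<delta> in auto)
  have T_mem: "T \<phi> \<in> bcontfun" for \<phi>
  proof -
    have c: "continuous_on {-\<delta>..\<delta>} (I (apply_bcontfun \<phi>))" by (intro I_cont) auto
    have "bounded (I (apply_bcontfun \<phi>) ` {-\<delta>..\<delta>})"
      by (intro compact_imp_bounded compact_continuous_image c) auto
    then obtain B where B: "\<And>t. t \<in> {-\<delta>..\<delta>} \<Longrightarrow> norm (I (apply_bcontfun \<phi>) t) \<le> B"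
      unfolding bounded_iff by (metis imageI)
    show ?thesis
    proof (rule bcontfun_normI)
      have "continuous_on UNIV cl" unfolding cl_def by (intro continuous_intros)
      then have "continuous_on UNIV (\<lambda>t. I (apply_bcontfun \<phi>) (cl t))"
        by (rule continuous_on_compose2[OF c]) (use cl in auto)
      then show "continuous_on UNIV (T \<phi>)" unfolding T_def by (intro continuous_intros)
      show "norm (T \<phi> t) \<le> norm y0 + (B + B)" for t
        unfolding T_def using B[OF cl(1)[of t]] B[of 0] \<delta>
        by (intro norm_triangle_le add_mono norm_triangle_le_diff) auto
    qed
  qed
  define \<Phi> where "\<Phi> \<phi> = Bcontfun (T \<phi>)" for \<phi>
  have \<Phi>: "apply_bcontfun (\<Phi> \<phi>) t = T \<phi> t" for \<phi> t
    unfolding \<Phi>_def using Bcontfun_inverse[OF T_mem] by simp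
  have "\<exists>!\<phi>. \<Phi> \<phi> = \<phi>"
  proof (rule banach_fix_type[of "1/2"])
    show "\<forall>\<phi> \<psi>. dist (\<Phi> \<phi>) (\<Phi> \<psi>) \<le> 1/2 * dist \<phi> \<psi>"
    proof (intro allI dist_bound)
      fix \<phi> \<psi> :: "real \<Rightarrow>\<^sub>C 'e" and t
      have le: "norm (I (apply_bcontfun \<phi>) u - I (apply_bcontfun \<psi>) u) \<le> 2 * \<delta> * m * dist \<phi> \<psi>"
        if u: "u \<in> {-\<delta>..\<delta>}" for u
      proof -
        have "I (apply_bcontfun \<phi>) u - I (apply_bcontfun \<psi>) u =
            integral {-\<delta>..u} (\<lambda>s. A s (apply_bcontfun \<phi> s) - A s (apply_bcontfun \<psi> s))"
          unfolding I_def by (intro integral_diff[symmetric] int u) auto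
        moreover have "norm (integral {-\<delta>..u} (\<lambda>s. A s (apply_bcontfun \<phi> s) - A s (apply_bcontfun \<psi> s)))
            \<le> m * dist \<phi> \<psi> * (u - (-\<delta>))"
        proof (rule integral_bound)
          show "-\<delta> \<le> u" using u by auto
          show "continuous_on {-\<delta>..u} (\<lambda>s. A s (apply_bcontfun \<phi> s) - A s (apply_bcontfun \<psi> s))"
            by (intro continuous_intros continuous_on_subset[OF cont]) (use u in auto)
          fix s assume "s \<in> {-\<delta>..u}"
          then have s: "s \<in> {-(r/2)..r/2}" using u sub\<delta> by auto
          have "A s (apply_bcontfun \<phi> s) - A s (apply_bcontfun \<psi> s) = A s (apply_bcontfun \<phi> s - apply_bcontfun \<psi> s)"
            using lin[of s] s sub by (auto simp: linear_diff subset_iff)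
          then have "norm (A s (apply_bcontfun \<phi> s) - A s (apply_bcontfun \<psi> s)) \<le> m * norm (apply_bcontfun \<phi> s - apply_bcontfun \<psi> s)"
            using bound[OF s] by simp
          also have "\<dots> \<le> m * dist \<phi> \<psi>"
            using m(2) dist_bounded[of \<phi> s \<psi>] by (simp add: dist_norm)
          finally show "norm (A s (apply_bcontfun \<phi> s) - A s (apply_bcontfun \<psi> s)) \<le> m * dist \<phi> \<psi>" .
        qed
        moreover have "m * dist \<phi> \<psi> * (u - (-\<delta>)) \<le> m * dist \<phi> \<psi> * (2 * \<delta>)"
          using u m(2) by (intro mult_left_mono) auto
        ultimately show ?thesis by (simp add: mult_ac)
      qed
      have "dist (\<Phi> \<phi> t) (\<Phi> \<psi> t) = norm ((I (apply_bcontfun \<phi>) (cl t) - I (apply_bcontfun \<psi>) (cl t)) -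
          (I (apply_bcontfun \<phi>) 0 - I (apply_bcontfun \<psi>) 0))"
        unfolding \<Phi> T_def dist_norm by (simp add: algebra_simps)
      also have "\<dots> \<le> 2 * \<delta> * m * dist \<phi> \<psi> + 2 * \<delta> * m * dist \<phi> \<psi>"
        using \<delta> by (intro norm_triangle_le_diff add_mono le cl) auto
      also have "\<dots> = (4 * \<delta> * m) * dist \<phi> \<psi>" by simp
      also have "\<dots> \<le> 1/2 * dist \<phi> \<psi>" using \<delta>(3) by (intro mult_right_mono) auto
      finally show "dist (\<Phi> \<phi> t) (\<Phi> \<psi> t) \<le> 1/2 * dist \<phi> \<psi>" .
    qed
  qed auto
  then obtain \<phi> where \<phi>: "\<Phi> \<phi> = \<phi>" by blast
  define y where "y = apply_bcontfun \<phi>"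
  have y: "y t = y0 + (I y (cl t) - I y 0)" for t
    using \<Phi>[of \<phi> t] unfolding \<phi> T_def y_def by simp
  have y_cont: "continuous_on S y" for S unfolding y_def by simp
  let ?J = "{-\<delta><..<\<delta>}"
  have deriv: "(y has_vector_derivative A t (y t)) (at t)" if t: "t \<in> ?J" for t
  proof -
    have "(I y has_vector_derivative A t (y t)) (at t within {-\<delta>..\<delta>})"
      unfolding I_def by (rule integral_has_vector_derivative[OF cont[OF y_cont]]) (use t in auto)
    then have "(I y has_vector_derivative A t (y t)) (at t)"
      using at_within_interior[of t "{-\<delta>..\<delta>}"] t by simp
    then have "((\<lambda>t. y0 + (I y t - I y 0)) has_vector_derivative A t (y t)) (at t)"
      by (auto intro!: derivative_eq_intros)
    then show ?thesis
      by (rule has_vector_derivative_transform_within_open[of _ _ _ ?J]) (use t y cl in auto)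
  qed
  \<comment> \<open>If \<open>y\<close> is C^k then so is the right-hand side of the equation, which
    is the derivative of \<open>y\<close>; hence \<open>y\<close> is C^(k+1).\<close>
  have Ck: "Ck_on k ?J y" for k
  proof (induction k)
    case 0
    then show ?case using y_cont by simp
  next
    case (Suc k)
    have D: "(y has_derivative (\<lambda>v. v *\<^sub>R A t (y t))) (at t)" if "t \<in> ?J" for t
      using deriv[OF that] unfolding has_vector_derivative_def .
    have J: "?J \<subseteq> {-r<..<r}" using \<delta> by auto
    have "Ck_on k ?J (\<lambda>t. frechet_derivative y (at t) v)" for v
    proof (rule Ck_on_transform)
      show "Ck_on k ?J (\<lambda>t. v *\<^sub>R (\<Sum>b\<in>Basis. (y t \<bullet> b) *\<^sub>R A t b))"
      proof (intro Ck_on_bilinear[OF bounded_bilinear_scaleR] Ck_on_bilinear[OF bounded_bilinear_inner] Ck_on_sum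
        Ck_on_const Suc)
        show "Ck_on k ?J (\<lambda>t. A t b)" for b
          using sm[of b] J unfolding smooth_on_def by (auto intro: Ck_on_subset)
      qed auto
      show "frechet_derivative y (at t) v = v *\<^sub>R (\<Sum>b\<in>Basis. (y t \<bullet> b) *\<^sub>R A t b)" if "t \<in> ?J" for t
        unfolding frechet_derivative_eqI[OF D[OF that]] using Asum that J by auto
    qed auto
    then show ?case using D unfolding Ck_on.simps differentiable_def by blast
  qed
  show thesis
  proof (rule that[of \<delta> y])
    show "y 0 = y0" using y[of 0] cl \<delta> by simp
    show "smooth_on ?J y" unfolding smooth_on_def using Ck by blast
  qed (use \<delta> r deriv in auto)
qed

section \<open>Tangent vectors in charts\<close>

text \<open>Instantiated both for \<open>M\<close> and for \<open>TM M\<close>, so that one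
  development of charts serves the manifold and its tangent bundle.\<close>

locale atlas =
  fixes M :: "('a, 'e::euclidean_space) atlas"
  assumes smooth_atlas: "smooth_atlas M"
begin

lemma inj_cmap: "c \<in> M \<Longrightarrow> inj_on (cmap c) (cdom c)"
  using smooth_atlas unfolding smooth_atlas_def by blast

lemma cinv_cmap [simp]: "c \<in> M \<Longrightarrow> p \<in> cdom c \<Longrightarrow> cinv c (cmap c p) = p"
  unfolding cinv_def using inj_cmap by (simp add: inv_into_f_f)

lemma cmap_cinv: "x \<in> cmap c ` S \<Longrightarrow> S \<subseteq> cdom c \<Longrightarrow> cmap c (cinv c x) = x"
  unfolding cinv_def by (rule f_inv_into_f) blast

lemma cinv_mem: "c \<in> M \<Longrightarrow> x \<in> cmap c ` S \<Longrightarrow> S \<subseteq> cdom c \<Longrightarrow> cinv c x \<in> S"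
  using cinv_cmap by auto

lemma open_chart_image: "openin (mtopology M) U \<Longrightarrow> c \<in> M \<Longrightarrow> open (cmap c ` (U \<inter> cdom c))"
  using inj_cmap unfolding openin_mtopology atlas_open_def by blast

lemma openin_cdom: "c \<in> M \<Longrightarrow> openin (mtopology M) (cdom c)"
  using smooth_atlas unfolding openin_mtopology atlas_open_def points_def smooth_atlas_def
  by (auto simp: Int_commute)

lemma openin_Int_cdom: "openin (mtopology M) U \<Longrightarrow> c \<in> M \<Longrightarrow> openin (mtopology M) (U \<inter> cdom c)"
  using openin_cdom by blast

lemma open_chart_subset: "openin (mtopology M) U \<Longrightarrow> c \<in> M \<Longrightarrow> U \<subseteq> cdom c \<Longrightarrow> open (cmap c ` U)"
  using open_chart_image[of U c] by (simp add: Int_absorb2)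

lemma open_cmap_cdom: "c \<in> M \<Longrightarrow> open (cmap c ` cdom c)"
  using open_chart_subset[OF openin_cdom] by simp

lemma open_overlap: "c \<in> M \<Longrightarrow> d \<in> M \<Longrightarrow> open (cmap c ` (cdom c \<inter> cdom d))"
  using smooth_atlas unfolding smooth_atlas_def by blast

lemma smooth_transition: "c \<in> M \<Longrightarrow> d \<in> M \<Longrightarrow> smooth_on (cmap c ` (cdom c \<inter> cdom d)) (cmap d \<circ> cinv c)"
  using smooth_atlas unfolding smooth_atlas_def by blast

lemma transition_has_derivative:
  assumes "c \<in> M" "d \<in> M" "p \<in> cdom c" "p \<in> cdom d"
  shows "((cmap d \<circ> cinv c) has_derivative frechet_derivative (cmap d \<circ> cinv c) (at (cmap c p))) (at (cmap c p))"
  using smooth_on_has_derivative[OF smooth_transition[OF assms(1,2)]] assms by blast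

lemma linear_transition_derivative:
  assumes "c \<in> M" "d \<in> M" "p \<in> cdom c" "p \<in> cdom d"
  shows "linear (frechet_derivative (cmap d \<circ> cinv c) (at (cmap c p)))"
  using transition_has_derivative[OF assms] by (rule has_derivative_linear)

text \<open>Near \<open>p\<close> the two chart representations of \<open>f\<close> differ by a
  transition map, so this is the chain rule. It makes notions defined through the arbitrary chart
  \<open>chart_at\<close> computable in any chart.\<close>

lemma has_derivative_change_chart:
  assumes c: "c \<in> M" "p \<in> cdom c" and d: "d \<in> M" "p \<in> cdom d"
    and f: "((f \<circ> cinv d) has_derivative f') (at (cmap d p))"
  shows "((f \<circ> cinv c) has_derivative (\<lambda>v. f' (frechet_derivative (cmap d \<circ> cinv c) (at (cmap c p)) v)))
    (at (cmap c p))"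
proof -
  have "((\<lambda>x. (f \<circ> cinv d) ((cmap d \<circ> cinv c) x)) has_derivative
      (\<lambda>v. f' (frechet_derivative (cmap d \<circ> cinv c) (at (cmap c p)) v))) (at (cmap c p))"
    using c d f by (intro has_derivative_compose[OF transition_has_derivative, where g = "f \<circ> cinv d"]) auto
  then show ?thesis
    by (rule has_derivative_transform_within_open[OF _ open_overlap[OF c(1) d(1)]]) (use c d in auto)
qed

text \<open>The cocycle identity: it makes coordinates prescribed in a single chart extend to a
  consistent family, that is, to a tangent vector.\<close>

lemma transition_derivative_chain:
  assumes "c \<in> M" "d \<in> M" "e \<in> M" "p \<in> cdom c" "p \<in> cdom d" "p \<in> cdom e"
  shows "frechet_derivative (cmap e \<circ> cinv c) (at (cmap c p)) v =
    frechet_derivative (cmap e \<circ> cinv d) (at (cmap d p)) (frechet_derivative (cmap d \<circ> cinv c) (at (cmap c p)) v)"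
  using frechet_derivative_eqI[OF has_derivative_change_chart[OF assms(1,4,2,5) transition_has_derivative]] assms
  by metis

lemma transition_derivative_self:
  assumes "c \<in> M" "p \<in> cdom c"
  shows "frechet_derivative (cmap c \<circ> cinv c) (at (cmap c p)) v = v"
proof -
  have "((cmap c \<circ> cinv c) has_derivative (\<lambda>v. v)) (at (cmap c p))"
    by (rule has_derivative_transform_within_open[OF has_derivative_ident open_cmap_cdom[OF assms(1)]])
      (use assms in auto)
  then show ?thesis by (simp add: frechet_derivative_eqI)
qed

lemma tspaceD:
  assumes "\<xi> \<in> tspace M p"
  shows "tbase \<xi> = p"
    and "\<lbrakk>c \<in> M; d \<in> M; p \<in> cdom c; p \<in> cdom d\<rbrakk> \<Longrightarrow>
      tcoord \<xi> d = frechet_derivative (cmap d \<circ> cinv c) (at (cmap c p)) (tcoord \<xi> c)"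
    and "\<not> (c \<in> M \<and> p \<in> cdom c) \<Longrightarrow> tcoord \<xi> c = 0"
proof -
  have *: "tbase \<xi> = p \<and> (\<forall>c\<in>M. \<forall>d\<in>M. p \<in> cdom c \<inter> cdom d \<longrightarrow>
        tcoord \<xi> d = frechet_derivative (cmap d \<circ> cinv c) (at (cmap c p)) (tcoord \<xi> c)) \<and>
      (\<forall>c. \<not> (c \<in> M \<and> p \<in> cdom c) \<longrightarrow> tcoord \<xi> c = 0)"
    using assms unfolding tspace_def mem_Collect_eq .
  show "tbase \<xi> = p" by (rule conjunct1[OF *])
  show "tcoord \<xi> d = frechet_derivative (cmap d \<circ> cinv c) (at (cmap c p)) (tcoord \<xi> c)"
    if "c \<in> M" "d \<in> M" "p \<in> cdom c" "p \<in> cdom d"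
    by (rule conjunct1[OF conjunct2[OF *], rule_format, OF that(1,2) IntI[OF that(3,4)]])
  show "tcoord \<xi> c = 0" if "\<not> (c \<in> M \<and> p \<in> cdom c)"
    by (rule conjunct2[OF conjunct2[OF *], rule_format, OF that])
qed

text \<open>Through this rule every later identity between tangent vectors becomes a computation in
  one chart.\<close>

lemma tspace_eqI:
  assumes "\<xi> \<in> tspace M p" "\<eta> \<in> tspace M p" "c \<in> M" "p \<in> cdom c" "tcoord \<xi> c = tcoord \<eta> c"
  shows "\<xi> = \<eta>"
proof (rule tvec.expand, intro conjI ext)
  show "tbase \<xi> = tbase \<eta>" using tspaceD(1) assms(1,2) by metis
  show "tcoord \<xi> d = tcoord \<eta> d" for d
    using tspaceD(2)[OF assms(1,3)] tspaceD(2)[OF assms(2,3)] tspaceD(3)[OF assms(1)] tspaceD(3)[OF assms(2)]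
      assms(4,5) by metis
qed

end

text \<open>Inverse of the coordinate map of the chart \<open>c\<close> at \<open>p\<close>. With
  \<open>v\<close> fixed and the point varying it is a constant coordinate field.\<close>

definition tvec_of :: "('a, 'e::euclidean_space) atlas \<Rightarrow> ('a, 'e) chart \<Rightarrow> 'a \<Rightarrow> 'e \<Rightarrow> ('a, 'e) tvec" where
  "tvec_of M c p v = TVec p (\<lambda>d. if d \<in> M \<and> p \<in> cdom d
     then frechet_derivative (cmap d \<circ> cinv c) (at (cmap c p)) v else 0)"

lemma tbase_simps [simp]:
  "tbase (\<xi> +\<^sub>T \<eta>) = tbase \<xi>" "tbase (\<xi> -\<^sub>T \<eta>) = tbase \<xi>" "tbase (r *\<^sub>T \<xi>) = tbase \<xi>" "tbase (tzero p) = p"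
  "tbase (tvec_of M c p v) = p"
  by (simp_all add: tplus_def tminus_def tscale_def tzero_def tvec_of_def)

lemma tcoord_simps [simp]:
  "tcoord (\<xi> +\<^sub>T \<eta>) c = tcoord \<xi> c + tcoord \<eta> c" "tcoord (\<xi> -\<^sub>T \<eta>) c = tcoord \<xi> c - tcoord \<eta> c"
  "tcoord (r *\<^sub>T \<xi>) c = r *\<^sub>R tcoord \<xi> c" "tcoord (tzero p) c = 0"
  by (simp_all add: tplus_def tminus_def tscale_def tzero_def)

context atlas begin

lemma tspaceI_transition:
  assumes "tbase \<xi> = p"
    and "\<And>c d. c \<in> M \<Longrightarrow> d \<in> M \<Longrightarrow> p \<in> cdom c \<Longrightarrow> p \<in> cdom d \<Longrightarrow>
      tcoord \<xi> d = frechet_derivative (cmap d \<circ> cinv c) (at (cmap c p)) (tcoord \<xi> c)"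
    and "\<And>c. \<not> (c \<in> M \<and> p \<in> cdom c) \<Longrightarrow> tcoord \<xi> c = 0"
  shows "\<xi> \<in> tspace M p"
  unfolding tspace_def mem_Collect_eq
proof (intro conjI ballI allI impI)
  fix c d assume "c \<in> M" "d \<in> M" "p \<in> cdom c \<inter> cdom d"
  then show "tcoord \<xi> d = frechet_derivative (cmap d \<circ> cinv c) (at (cmap c p)) (tcoord \<xi> c)"
    by (intro assms(2)) blast+
qed (fact assms)+

lemma tspaceI:
  assumes "tbase \<xi> = p" and c: "c \<in> M" "p \<in> cdom c"
    and \<xi>: "\<And>d. d \<in> M \<Longrightarrow> p \<in> cdom d \<Longrightarrow> tcoord \<xi> d = frechet_derivative (cmap d \<circ> cinv c) (at (cmap c p)) v"
    and "\<And>d. \<not> (d \<in> M \<and> p \<in> cdom d) \<Longrightarrow> tcoord \<xi> d = 0"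
  shows "\<xi> \<in> tspace M p"
proof (rule tspaceI_transition)
  fix d e assume d: "d \<in> M" "p \<in> cdom d" and e: "e \<in> M" "p \<in> cdom e"
  show "tcoord \<xi> e = frechet_derivative (cmap e \<circ> cinv d) (at (cmap d p)) (tcoord \<xi> d)"
    unfolding \<xi>[OF d] \<xi>[OF e] by (rule transition_derivative_chain[OF c(1) d(1) e(1) c(2) d(2) e(2)])
qed (use assms in blast)+

lemma tvec_of_tspace [simp]: "c \<in> M \<Longrightarrow> p \<in> cdom c \<Longrightarrow> tvec_of M c p v \<in> tspace M p"
  by (rule tspaceI[of _ p c v]) (auto simp: tvec_of_def)

lemma tcoord_tvec_of [simp]: "c \<in> M \<Longrightarrow> p \<in> cdom c \<Longrightarrow> tcoord (tvec_of M c p v) c = v"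
  by (simp add: tvec_of_def transition_derivative_self)

lemma tvec_of_tcoord [simp]: "c \<in> M \<Longrightarrow> p \<in> cdom c \<Longrightarrow> \<xi> \<in> tspace M p \<Longrightarrow> tvec_of M c p (tcoord \<xi> c) = \<xi>"
  by (rule tspace_eqI[of _ p _ c]) auto

lemma tplus_tspace [simp]:
  assumes "\<xi> \<in> tspace M p" "\<eta> \<in> tspace M p"
  shows "\<xi> +\<^sub>T \<eta> \<in> tspace M p"
proof (rule tspaceI_transition)
  fix c d assume a: "c \<in> M" "d \<in> M" "p \<in> cdom c" "p \<in> cdom d"
  show "tcoord (\<xi> +\<^sub>T \<eta>) d = frechet_derivative (cmap d \<circ> cinv c) (at (cmap c p)) (tcoord (\<xi> +\<^sub>T \<eta>) c)"
    unfolding tcoord_simps linear_add[OF linear_transition_derivative[OF a]]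
    using tspaceD(2)[OF assms(1) a] tspaceD(2)[OF assms(2) a] by argo
qed (use tspaceD(1,3)[OF assms(1)] tspaceD(3)[OF assms(2)] in auto)

lemma tscale_tspace [simp]:
  assumes "\<xi> \<in> tspace M p"
  shows "r *\<^sub>T \<xi> \<in> tspace M p"
proof (rule tspaceI_transition)
  fix c d assume a: "c \<in> M" "d \<in> M" "p \<in> cdom c" "p \<in> cdom d"
  show "tcoord (r *\<^sub>T \<xi>) d = frechet_derivative (cmap d \<circ> cinv c) (at (cmap c p)) (tcoord (r *\<^sub>T \<xi>) c)"
    unfolding tcoord_simps linear_scale[OF linear_transition_derivative[OF a]]
    using tspaceD(2)[OF assms(1) a] by argo
qed (use tspaceD(1,3)[OF assms(1)] in auto)

lemma tzero_tspace [simp]: "tzero p \<in> tspace M p"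
  by (rule tspaceI_transition) (simp_all add: linear_0[OF linear_transition_derivative])

lemma tminus_eq: "\<xi> -\<^sub>T \<eta> = \<xi> +\<^sub>T (-1) *\<^sub>T \<eta>"
  by (simp add: tplus_def tminus_def tscale_def)

lemma tminus_tspace [simp]: "\<xi> \<in> tspace M p \<Longrightarrow> \<eta> \<in> tspace M p \<Longrightarrow> \<xi> -\<^sub>T \<eta> \<in> tspace M p"
  by (simp add: tminus_eq)

lemma tvec_of_add: "c \<in> M \<Longrightarrow> p \<in> cdom c \<Longrightarrow> tvec_of M c p (v + w) = tvec_of M c p v +\<^sub>T tvec_of M c p w"
  by (rule tspace_eqI[of _ p _ c]) auto

lemma tvec_of_scale: "c \<in> M \<Longrightarrow> p \<in> cdom c \<Longrightarrow> tvec_of M c p (r *\<^sub>R v) = r *\<^sub>T tvec_of M c p v"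
  by (rule tspace_eqI[of _ p _ c]) auto

section \<open>Smoothness and derivatives read in one chart\<close>

text \<open>The coordinates in another chart are the derivative of the transition map, taken at the
  moving point, applied to those in \<open>c\<close>; this expression is smooth jointly in point and
  vector.\<close>

lemma smooth_vf_chartI:
  assumes c: "c \<in> M" and U: "openin (mtopology M) U" "U \<subseteq> cdom c"
    and X: "\<And>p. p \<in> U \<Longrightarrow> X p \<in> tspace M p"
    and sm: "smooth_on (cmap c ` U) (\<lambda>x. tcoord (X (cinv c x)) c)"
  shows "smooth_vf M U X"
  unfolding smooth_vf_def
proof (intro conjI ballI X)
  fix d assume d: "d \<in> M"
  let ?S = "cmap d ` (U \<inter> cdom d)"
  have S: "open ?S" by (rule open_chart_image[OF U(1) d])
  have sub: "?S \<subseteq> cmap d ` (cdom d \<inter> cdom c)" using U(2) by auto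
  have g: "smooth_on ?S (cmap c \<circ> cinv d)"
    by (rule smooth_on_subset[OF smooth_transition[OF d c] sub])
  have im: "(cmap c \<circ> cinv d) ` ?S \<subseteq> cmap c ` (cdom c \<inter> cdom d)" using d U(2) by auto
  have im': "(cmap c \<circ> cinv d) ` ?S \<subseteq> cmap c ` U" using d by auto
  have "smooth_on ?S (\<lambda>x. tcoord (X (cinv c ((cmap c \<circ> cinv d) x))) c)"
    by (rule smooth_on_compose[OF S open_chart_subset[OF U(1) c U(2)] sm g im'])
  then have "smooth_on ?S (\<lambda>x. frechet_derivative (cmap d \<circ> cinv c) (at ((cmap c \<circ> cinv d) x))
      (tcoord (X (cinv c ((cmap c \<circ> cinv d) x))) c))"
    by (rule smooth_on_frechet_derivative_apply[OF S open_overlap[OF c d] smooth_transition[OF c d] g im])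
  then show "smooth_on ?S (\<lambda>x. tcoord (X (cinv d x)) d)"
  proof (rule smooth_on_transform[OF S])
    fix x assume "x \<in> ?S"
    then obtain p where p: "p \<in> U" "p \<in> cdom d" "x = cmap d p" by blast
    then have "p \<in> cdom c" using U(2) by auto
    then show "tcoord (X (cinv d x)) d = frechet_derivative (cmap d \<circ> cinv c) (at ((cmap c \<circ> cinv d) x))
      (tcoord (X (cinv c ((cmap c \<circ> cinv d) x))) c)"
      using tspaceD(2)[OF X[OF p(1)] c d] p c d by simp
  qed
qed

lemma smooth_fun_chartI:
  assumes c: "c \<in> M" and U: "openin (mtopology M) U" "U \<subseteq> cdom c"
    and sm: "smooth_on (cmap c ` U) (f \<circ> cinv c)"
  shows "smooth_fun M U f"
  unfolding smooth_fun_def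
proof (intro ballI)
  fix d assume d: "d \<in> M"
  let ?S = "cmap d ` (U \<inter> cdom d)"
  have S: "open ?S" by (rule open_chart_image[OF U(1) d])
  have g: "smooth_on ?S (cmap c \<circ> cinv d)"
    by (rule smooth_on_subset[OF smooth_transition[OF d c]]) (use U(2) in auto)
  have im': "(cmap c \<circ> cinv d) ` ?S \<subseteq> cmap c ` U" using d by auto
  have "smooth_on ?S (\<lambda>x. (f \<circ> cinv c) ((cmap c \<circ> cinv d) x))"
    by (rule smooth_on_compose[OF S open_chart_subset[OF U(1) c U(2)] sm g im'])
  then show "smooth_on ?S (f \<circ> cinv d)"
  proof (rule smooth_on_transform[OF S])
    fix x assume "x \<in> ?S"
    then obtain p where p: "p \<in> U" "p \<in> cdom d" "x = cmap d p" by blast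
    then show "(f \<circ> cinv d) x = (f \<circ> cinv c) ((cmap c \<circ> cinv d) x)"
      using U(2) c d by (auto simp: subset_iff)
  qed
qed

lemma smooth_vf_subset: "smooth_vf M U X \<Longrightarrow> V \<subseteq> U \<Longrightarrow> smooth_vf M V X"
  unfolding smooth_vf_def by (meson Int_mono image_mono order_refl smooth_on_subset subsetD)

lemma smooth_vfD:
  assumes "smooth_vf M U X"
  shows "p \<in> U \<Longrightarrow> X p \<in> tspace M p"
    and "c \<in> M \<Longrightarrow> smooth_on (cmap c ` (U \<inter> cdom c)) (\<lambda>x. tcoord (X (cinv c x)) c)"
  using assms unfolding smooth_vf_def by blast+

lemma smooth_vf_const:
  assumes c: "c \<in> M" and U: "openin (mtopology M) U" "U \<subseteq> cdom c"
  shows "smooth_vf M U (\<lambda>q. tvec_of M c q v)"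
proof (rule smooth_vf_chartI[OF c U])
  show "smooth_on (cmap c ` U) (\<lambda>x. tcoord (tvec_of M c (cinv c x) v) c)"
    by (rule smooth_on_transform[OF open_chart_subset[OF U(1) c U(2)] smooth_on_const[of _ v]])
      (use U(2) c cinv_mem in auto)
qed (use U(2) c in auto)

lemma chart_at: "p \<in> points M \<Longrightarrow> chart_at M p \<in> M \<and> p \<in> cdom (chart_at M p)"
  unfolding chart_at_def points_def by (rule someI_ex) auto

text \<open>\<open>tdiff\<close> is computed in the chosen chart \<open>chart_at M p\<close>; the
  change of chart cancels against the transformation of the coordinates of \<xi>, so any chart
  around \<open>p\<close> may be used.\<close>

lemma tcoord_tdiff:
  assumes c: "c \<in> M" "p \<in> cdom c" and \<xi>: "\<xi> \<in> tspace M p" and d: "d \<in> N" "f p \<in> cdom d"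
    and f: "((cmap d \<circ> f \<circ> cinv c) has_derivative f') (at (cmap c p))"
  shows "tcoord (tdiff M N f \<xi>) d = f' (tcoord \<xi> c)"
proof -
  let ?c = "chart_at M p"
  have c': "?c \<in> M" "p \<in> cdom ?c" using chart_at c unfolding points_def by blast+
  have "((cmap d \<circ> f \<circ> cinv ?c) has_derivative
      (\<lambda>v. f' (frechet_derivative (cmap c \<circ> cinv ?c) (at (cmap ?c p)) v))) (at (cmap ?c p))"
    by (rule has_derivative_change_chart[OF c' c f])
  then show ?thesis
    using tspaceD(1)[OF \<xi>] tspaceD(2)[OF \<xi> c'(1) c(1) c'(2) c(2)] d unfolding tdiff_def Let_def
    by (simp add: frechet_derivative_eqI)
qed

lemma dir_deriv_eq:
  assumes c: "c \<in> M" "p \<in> cdom c" and \<xi>: "\<xi> \<in> tspace M p"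
    and f: "((f \<circ> cinv c) has_derivative f') (at (cmap c p))"
  shows "dir_deriv M \<xi> f = f' (tcoord \<xi> c)"
proof -
  let ?c = "chart_at M p"
  have c': "?c \<in> M" "p \<in> cdom ?c" using chart_at c unfolding points_def by blast+
  have "((f \<circ> cinv ?c) has_derivative
      (\<lambda>v. f' (frechet_derivative (cmap c \<circ> cinv ?c) (at (cmap ?c p)) v))) (at (cmap ?c p))"
    by (rule has_derivative_change_chart[OF c' c f])
  then show ?thesis
    using tspaceD(1)[OF \<xi>] tspaceD(2)[OF \<xi> c'(1) c(1) c'(2) c(2)] unfolding dir_deriv_def Let_def
    by (simp add: frechet_derivative_eqI)
qed

lemma smooth_on_tcoord_subset:
  assumes "smooth_vf M U X" "c \<in> M" "V \<subseteq> U" "V \<subseteq> cdom c"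
  shows "smooth_on (cmap c ` V) (\<lambda>x. tcoord (X (cinv c x)) c)"
  by (rule smooth_on_subset[OF smooth_vfD(2)[OF assms(1,2)]]) (use assms(3,4) in auto)

lemma smooth_vf_minus:
  assumes U: "openin (mtopology M) U" and "smooth_vf M U X" "smooth_vf M U Y"
  shows "smooth_vf M U (\<lambda>q. X q -\<^sub>T Y q)"
  unfolding smooth_vf_def
proof (intro conjI ballI)
  fix c assume c: "c \<in> M"
  show "smooth_on (cmap c ` (U \<inter> cdom c)) (\<lambda>x. tcoord (X (cinv c x) -\<^sub>T Y (cinv c x)) c)"
    unfolding tcoord_simps
    by (rule smooth_on_diff[OF open_chart_image[OF U c] smooth_vfD(2)[OF assms(2) c] smooth_vfD(2)[OF assms(3) c]])
qed (use smooth_vfD(1)[OF assms(2)] smooth_vfD(1)[OF assms(3)] in simp)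

lemma smooth_vf_plus:
  assumes U: "openin (mtopology M) U" and "smooth_vf M U X" "smooth_vf M U Y"
  shows "smooth_vf M U (\<lambda>q. X q +\<^sub>T Y q)"
  unfolding smooth_vf_def
proof (intro conjI ballI)
  fix c assume c: "c \<in> M"
  show "smooth_on (cmap c ` (U \<inter> cdom c)) (\<lambda>x. tcoord (X (cinv c x) +\<^sub>T Y (cinv c x)) c)"
    unfolding tcoord_simps
    by (rule smooth_on_add[OF open_chart_image[OF U c] smooth_vfD(2)[OF assms(2) c] smooth_vfD(2)[OF assms(3) c]])
qed (use smooth_vfD(1)[OF assms(2)] smooth_vfD(1)[OF assms(3)] in simp)

lemma smooth_vf_cong:
  assumes U: "openin (mtopology M) U" and X: "smooth_vf M U X" and eq: "\<And>q. q \<in> U \<Longrightarrow> Y q = X q"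
  shows "smooth_vf M U Y"
  unfolding smooth_vf_def
proof (intro conjI ballI)
  fix c assume c: "c \<in> M"
  show "smooth_on (cmap c ` (U \<inter> cdom c)) (\<lambda>x. tcoord (Y (cinv c x)) c)"
    by (rule smooth_on_transform[OF open_chart_image[OF U c] smooth_vfD(2)[OF X c]]) (use eq c in auto)
qed (use eq smooth_vfD(1)[OF X] in auto)

lemma tcoord_has_derivative:
  assumes "openin (mtopology M) U" "smooth_vf M U X" "c \<in> M" "p \<in> U" "p \<in> cdom c"
  shows "((\<lambda>x. tcoord (X (cinv c x)) c) has_derivative
    frechet_derivative (\<lambda>x. tcoord (X (cinv c x)) c) (at (cmap c p))) (at (cmap c p))"
  by (rule smooth_on_has_derivative[OF smooth_vfD(2)[OF assms(2,3)]]) (use assms in auto)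

end

section \<open>Connections and metrics in charts\<close>

locale atlas_connection = atlas M for M :: "('a, 'e::euclidean_space) atlas" +
  fixes nab :: "('a, 'e) tvec \<Rightarrow> ('a \<Rightarrow> ('a, 'e) tvec) \<Rightarrow> ('a, 'e) tvec"
  assumes connection: "affine_connection M nab"
begin

text \<open>The Christoffel symbol \<Gamma> at the coordinate point \<open>x\<close>, kept as a map
  on coordinate vectors rather than as a family of components: \<open>v\<close> is the direction,
  \<open>w\<close> the constant coordinate field.\<close>

definition Gam :: "('a, 'e) chart \<Rightarrow> 'e \<Rightarrow> 'e \<Rightarrow> 'e \<Rightarrow> 'e" where
  "Gam c x v w = tcoord (nab (tvec_of M c (cinv c x) v) (\<lambda>q. tvec_of M c q w)) c"

lemma nab_axioms:
  assumes "openin (mtopology M) U" "smooth_vf M U Y" "p \<in> U" "x \<in> tspace M p"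
  shows nab_tspace: "nab x Y \<in> tspace M p"
    and nab_scale: "nab (r *\<^sub>T x) Y = r *\<^sub>T nab x Y"
    and nab_add: "x' \<in> tspace M p \<Longrightarrow> nab (x +\<^sub>T x') Y = nab x Y +\<^sub>T nab x' Y"
    and nab_add_field: "smooth_vf M U Y' \<Longrightarrow> nab x (\<lambda>q. Y q +\<^sub>T Y' q) = nab x Y +\<^sub>T nab x Y'"
    and nab_leibniz: "smooth_fun M U f \<Longrightarrow>
      nab x (\<lambda>q. f q *\<^sub>T Y q) = dir_deriv M x f *\<^sub>T Y p +\<^sub>T f p *\<^sub>T nab x Y"
    and nab_local: "(\<And>q. q \<in> U \<Longrightarrow> Y' q = Y q) \<Longrightarrow> nab x Y' = nab x Y"
proof -
  have *: "(\<forall>p\<in>U. \<forall>x\<in>tspace M p.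
           nab x Y \<in> tspace M p \<and>
           (\<forall>r. nab (r *\<^sub>T x) Y = r *\<^sub>T nab x Y) \<and>
           (\<forall>x'\<in>tspace M p. nab (x +\<^sub>T x') Y = nab x Y +\<^sub>T nab x' Y) \<and>
           (\<forall>Y'. smooth_vf M U Y' \<longrightarrow> nab x (\<lambda>q. Y q +\<^sub>T Y' q) = nab x Y +\<^sub>T nab x Y') \<and>
           (\<forall>f. smooth_fun M U f \<longrightarrow>
              nab x (\<lambda>q. f q *\<^sub>T Y q) = dir_deriv M x f *\<^sub>T Y p +\<^sub>T f p *\<^sub>T nab x Y) \<and>
           (\<forall>Y'. (\<forall>q\<in>U. Y' q = Y q) \<longrightarrow> nab x Y' = nab x Y))"
    using connection[unfolded affine_connection_def, THEN spec, THEN spec, THEN mp, OF conjI[OF assms(1,2)]]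
    by (rule conjunct1)
  note ** = *[THEN bspec, OF assms(3), THEN bspec, OF assms(4)]
  note 1 = conjunct2[OF **] note 2 = conjunct2[OF 1] note 3 = conjunct2[OF 2] note 4 = conjunct2[OF 3]
  show "nab x Y \<in> tspace M p" by (rule conjunct1[OF **])
  show "nab (r *\<^sub>T x) Y = r *\<^sub>T nab x Y" by (rule conjunct1[OF 1, rule_format])
  show "nab (x +\<^sub>T x') Y = nab x Y +\<^sub>T nab x' Y" if "x' \<in> tspace M p"
    by (rule conjunct1[OF 2, rule_format, OF that])
  show "nab x (\<lambda>q. Y q +\<^sub>T Y' q) = nab x Y +\<^sub>T nab x Y'" if "smooth_vf M U Y'"
    by (rule conjunct1[OF 3, rule_format, OF that])
  show "nab x (\<lambda>q. f q *\<^sub>T Y q) = dir_deriv M x f *\<^sub>T Y p +\<^sub>T f p *\<^sub>T nab x Y" if "smooth_fun M U f"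
    by (rule conjunct1[OF 4, rule_format, OF that])
  show "nab x Y' = nab x Y" if "\<And>q. q \<in> U \<Longrightarrow> Y' q = Y q"
    by (rule conjunct2[OF 4, rule_format, OF that])
qed

lemma nab_smooth:
  "openin (mtopology M) U \<Longrightarrow> smooth_vf M U Y \<Longrightarrow> smooth_vf M U X \<Longrightarrow> smooth_vf M U (\<lambda>q. nab (X q) Y)"
  using connection[unfolded affine_connection_def, THEN spec, THEN spec, THEN mp, OF conjI, THEN conjunct2,
    THEN spec, THEN mp] .

lemma smooth_Gam:
  assumes c: "c \<in> M"
  shows "smooth_on (cmap c ` cdom c) (\<lambda>x. Gam c x v w)"
  unfolding Gam_def
  using smooth_vfD(2)[OF nab_smooth[OF openin_cdom[OF c] smooth_vf_const[OF c openin_cdom[OF c]]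
    smooth_vf_const[OF c openin_cdom[OF c]]] c] by simp

text \<open>Linearity in the direction is an axiom of connections. Homogeneity in the field is the
  Leibniz rule for a constant function, whose directional derivative vanishes.\<close>

lemma bilinear_Gam:
  assumes c: "c \<in> M" and x: "x \<in> cmap c ` cdom c"
  shows "bilinear (Gam c x)"
proof -
  define p where "p = cinv c x"
  have p: "p \<in> cdom c" unfolding p_def using cinv_mem[OF c x] by simp
  note U = openin_cdom[OF c]
  note sm = smooth_vf_const[OF c U order_refl]
  note [simp] = c p
  note ax = U sm p tvec_of_tspace[OF c p]
  have "Gam c x v (w + w') = Gam c x v w + Gam c x v w'" for v w w'
  proof -
    have "nab (tvec_of M c p v) (\<lambda>q. tvec_of M c q (w + w')) =
        nab (tvec_of M c p v) (\<lambda>q. tvec_of M c q w +\<^sub>T tvec_of M c q w')"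
      by (rule nab_local[OF U smooth_vf_plus[OF U sm sm] p]) (auto simp: tvec_of_add)
    then show ?thesis unfolding Gam_def p_def[symmetric] nab_add_field[OF ax sm] by simp
  qed
  moreover have "Gam c x v (r *\<^sub>R w) = r *\<^sub>R Gam c x v w" for v w r
  proof -
    have f: "smooth_fun M (cdom c) (\<lambda>_. r)"
      by (rule smooth_fun_chartI[OF c U]) (auto simp: comp_def smooth_on_const)
    have "dir_deriv M (tvec_of M c p v) (\<lambda>_. r) = 0"
      by (rule dir_deriv_eq[OF c p]) (auto simp: comp_def)
    moreover have "nab (tvec_of M c p v) (\<lambda>q. r *\<^sub>T tvec_of M c q w) =
        nab (tvec_of M c p v) (\<lambda>q. tvec_of M c q (r *\<^sub>R w))"
      by (rule nab_local[OF U sm p]) (auto simp: tvec_of_scale)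
    ultimately show ?thesis
      unfolding Gam_def p_def[symmetric]
      using arg_cong[OF nab_leibniz[OF ax f, of v w], of "\<lambda>\<xi>. tcoord \<xi> c"] by simp
  qed
  moreover have "Gam c x (v + v') w = Gam c x v w + Gam c x v' w" for v v' w
    unfolding Gam_def p_def[symmetric] tvec_of_add[OF c p] nab_add[OF ax tvec_of_tspace[OF c p]] by simp
  moreover have "Gam c x (r *\<^sub>R v) w = r *\<^sub>R Gam c x v w" for r v w
    unfolding Gam_def p_def[symmetric] tvec_of_scale[OF c p] nab_scale[OF ax] by simp
  ultimately show ?thesis unfolding bilinear_def by (intro conjI allI linearI) simp_all
qed

text \<open>On a neighbourhood inside the chart, \<open>Y\<close> is a combination of constant
  coordinate fields with its coordinates as coefficients. Additivity and the Leibniz rule then give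
  the derivative of the coefficients plus a Christoffel term.\<close>

lemma tcoord_nab:
  assumes U: "openin (mtopology M) U" and Y: "smooth_vf M U Y"
    and p: "p \<in> U" "c \<in> M" "p \<in> cdom c" and X: "X \<in> tspace M p"
  shows "tcoord (nab X Y) c = frechet_derivative (\<lambda>x. tcoord (Y (cinv c x)) c) (at (cmap c p)) (tcoord X c) +
    Gam c (cmap c p) (tcoord X c) (tcoord (Y p) c)"
proof -
  note c = p(2)
  define V where "V = U \<inter> cdom c"
  have V: "openin (mtopology M) V" "V \<subseteq> cdom c" "p \<in> V" "V \<subseteq> U"
    unfolding V_def using openin_Int_cdom[OF U p(2)] p by auto
  define y where "y x = tcoord (Y (cinv c x)) c" for x
  define y' where "y' = frechet_derivative y (at (cmap c p))"
  have ysm: "smooth_on (cmap c ` V) y"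
    unfolding y_def using smooth_on_tcoord_subset[OF Y c V(4,2)] .
  have yD: "(y has_derivative y') (at (cmap c p))"
    unfolding y'_def by (rule smooth_on_has_derivative[OF ysm]) (use V in auto)
  have oV: "open (cmap c ` V)" by (rule open_chart_subset[OF V(1) c V(2)])
  \<comment> \<open>The part of \<open>Y\<close> belonging to the basis vectors in \<open>B\<close>;
    induction on \<open>B\<close> builds up \<open>Y\<close> one coordinate field at a time.\<close>
  define Z where "Z B q = tvec_of M c q (\<Sum>b\<in>B. (tcoord (Y q) c \<bullet> b) *\<^sub>R b)" for B q
  have Zsm: "smooth_vf M V (Z B)" for B
  proof (rule smooth_vf_chartI[OF c V(1,2)])
    have "smooth_on (cmap c ` V) (\<lambda>x. \<Sum>b\<in>B. (y x \<bullet> b) *\<^sub>R b)"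
      by (intro smooth_on_sum[OF oV] smooth_on_scaleR[OF oV] smooth_on_inner[OF oV] ysm smooth_on_const)
    then show "smooth_on (cmap c ` V) (\<lambda>x. tcoord (Z B (cinv c x)) c)"
      by (rule smooth_on_transform[OF oV])
        (use c V(2) cinv_mem[OF c _ V(2)] in \<open>auto simp: Z_def y_def subset_iff\<close>)
  qed (use V(2) c in \<open>auto simp: Z_def\<close>)
  have lin: "linear (Gam c (cmap c p) (tcoord X c))"
    using bilinear_Gam[OF c, of "cmap c p"] p unfolding bilinear_def by auto
  have E: "nab X (\<lambda>q. tvec_of M c q b) = nab (tvec_of M c p (tcoord X c)) (\<lambda>q. tvec_of M c q b)" for b
    using X p by simp
  have main: "tcoord (nab X (Z B)) c = (\<Sum>b\<in>B. (y' (tcoord X c) \<bullet> b) *\<^sub>R b +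
      (tcoord (Y p) c \<bullet> b) *\<^sub>R Gam c (cmap c p) (tcoord X c) b)" if "finite B" for B
    using that
  proof (induction B)
    case empty
    \<comment> \<open>The zero field is 0 times itself, so the Leibniz rule with the constant
      function 0 shows that its covariant derivative vanishes.\<close>
    have f: "smooth_fun M V (\<lambda>_. 0)"
      by (rule smooth_fun_chartI[OF c V(1,2)]) (auto simp: comp_def smooth_on_const)
    have "dir_deriv M X (\<lambda>_. 0) = 0"
      by (rule dir_deriv_eq[OF c p(3) X]) (auto simp: comp_def)
    moreover have "nab X (\<lambda>q. 0 *\<^sub>T Z {} q) = nab X (Z {})"
      by (rule nab_local[OF V(1) Zsm V(3) X])
        (use V(2) c in \<open>auto simp: Z_def tvec_of_scale[symmetric] subset_iff\<close>)
    ultimately show ?case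
      using arg_cong[OF nab_leibniz[OF V(1) Zsm V(3) X f, of "{}"], of "\<lambda>\<xi>. tcoord \<xi> c"] by simp
  next
    case (insert b B)
    define f where "f q = tcoord (Y q) c \<bullet> b" for q
    have f: "smooth_fun M V f"
    proof (rule smooth_fun_chartI[OF c V(1,2)])
      have "smooth_on (cmap c ` V) (\<lambda>x. y x \<bullet> b)"
        by (intro smooth_on_inner[OF oV] ysm smooth_on_const)
      then show "smooth_on (cmap c ` V) (f \<circ> cinv c)" by (simp add: comp_def f_def y_def)
    qed
    have fD: "dir_deriv M X f = y' (tcoord X c) \<bullet> b"
    proof (rule dir_deriv_eq[OF c p(3) X])
      have "((\<lambda>x. y x \<bullet> b) has_derivative (\<lambda>v. y' v \<bullet> b)) (at (cmap c p))"
        by (rule has_derivative_inner_left[OF yD])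
      then show "((f \<circ> cinv c) has_derivative (\<lambda>v. y' v \<bullet> b)) (at (cmap c p))"
        by (simp add: comp_def f_def y_def)
    qed
    note Esm = smooth_vf_const[OF c V(1,2)]
    have fE: "smooth_vf M V (\<lambda>q. f q *\<^sub>T tvec_of M c q b)"
    proof (rule smooth_vf_cong[OF V(1) Zsm[of "{b}"]])
      show "f q *\<^sub>T tvec_of M c q b = Z {b} q" if "q \<in> V" for q
        using that V(2) c by (auto simp: Z_def f_def tvec_of_scale)
    qed
    have "nab X (Z (insert b B)) = nab X (\<lambda>q. f q *\<^sub>T tvec_of M c q b +\<^sub>T Z B q)"
      by (rule nab_local[OF V(1) smooth_vf_plus[OF V(1) fE Zsm] V(3) X])
        (use insert.hyps V(2) c in \<open>auto simp: Z_def f_def tvec_of_add tvec_of_scale\<close>)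
    also have "\<dots> = nab X (\<lambda>q. f q *\<^sub>T tvec_of M c q b) +\<^sub>T nab X (Z B)"
      by (rule nab_add_field[OF V(1) fE V(3) X Zsm])
    also have "nab X (\<lambda>q. f q *\<^sub>T tvec_of M c q b) =
        dir_deriv M X f *\<^sub>T tvec_of M c p b +\<^sub>T f p *\<^sub>T nab X (\<lambda>q. tvec_of M c q b)"
      by (rule nab_leibniz[OF V(1) Esm V(3) X f])
    finally show ?case using insert p c by (simp add: fD E Gam_def f_def)
  qed
  have "nab X Y = nab X (Z Basis)"
    by (rule nab_local[OF V(1) Zsm V(3) X])
      (use V(2,4) c smooth_vfD(1)[OF Y] in \<open>auto simp: Z_def euclidean_representation subset_iff\<close>)
  then have "tcoord (nab X Y) c = (\<Sum>b\<in>Basis. (y' (tcoord X c) \<bullet> b) *\<^sub>R b) +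
      (\<Sum>b\<in>Basis. (tcoord (Y p) c \<bullet> b) *\<^sub>R Gam c (cmap c p) (tcoord X c) b)"
    using main[OF finite_Basis] by (simp add: sum.distrib)
  then show ?thesis
    unfolding linear_eq_sum_Basis[OF lin, of "tcoord (Y p) c"] y'_def y_def
    by (simp add: euclidean_representation)
qed

end

section \<open>The metric in coordinates and the Levi-Civita conditions\<close>

locale levi_civita_atlas = atlas_connection M nab
  for M :: "('a, 'e::euclidean_space) atlas" and nab +
  fixes g :: "('a, 'e) tvec \<Rightarrow> ('a, 'e) tvec \<Rightarrow> real"
  assumes metric: "riemannian_metric M g" and levi_civita: "levi_civita M g nab"
begin

definition Gm :: "('a, 'e) chart \<Rightarrow> 'e \<Rightarrow> 'e \<Rightarrow> 'e \<Rightarrow> real" where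
  "Gm c x v w = g (tvec_of M c (cinv c x) v) (tvec_of M c (cinv c x) w)"

lemma metric_axioms:
  assumes "p \<in> points M" "x \<in> tspace M p" "y \<in> tspace M p" "z \<in> tspace M p"
  shows "g x y = g y x \<and> g (x +\<^sub>T y) z = g x z + g y z \<and> g (r *\<^sub>T x) y = r * g x y"
  using metric[unfolded riemannian_metric_def, THEN conjunct1, THEN bspec, OF assms(1), THEN bspec, OF assms(2),
    THEN bspec, OF assms(3), THEN bspec, OF assms(4), THEN spec] .

lemmas g_add = metric_axioms[THEN conjunct2, THEN conjunct1]

lemma g_sym:
  assumes "p \<in> points M" "x \<in> tspace M p" "y \<in> tspace M p"
  shows "g x y = g y x"
  using metric_axioms[OF assms assms(2)] by auto

lemma g_pos: "p \<in> points M \<Longrightarrow> x \<in> tspace M p \<Longrightarrow> x \<noteq> tzero p \<Longrightarrow> g x x > 0"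
  using metric[unfolded riemannian_metric_def, THEN conjunct2, THEN conjunct1, rule_format] .

lemma g_smooth: "openin (mtopology M) U \<Longrightarrow> smooth_vf M U X \<Longrightarrow> smooth_vf M U Y \<Longrightarrow> smooth_fun M U (\<lambda>p. g (X p) (Y p))"
  using metric[unfolded riemannian_metric_def, THEN conjunct2, THEN conjunct2, THEN spec, THEN spec, THEN spec,
    THEN mp, OF conjI, OF _ conjI] .

lemma nab_torsion: "openin (mtopology M) U \<Longrightarrow> smooth_vf M U X \<Longrightarrow> smooth_vf M U Y \<Longrightarrow> p \<in> U \<Longrightarrow>
    nab (X p) Y -\<^sub>T nab (Y p) X = lie_bracket M X Y p"
  using levi_civita[unfolded levi_civita_def, THEN conjunct2, THEN conjunct1, THEN spec, THEN spec, THEN spec,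
    THEN mp, OF conjI, OF _ conjI, THEN bspec] .

lemma nab_metric: "openin (mtopology M) U \<Longrightarrow> smooth_vf M U Y \<Longrightarrow> smooth_vf M U Z \<Longrightarrow> p \<in> U \<Longrightarrow> x \<in> tspace M p \<Longrightarrow>
    dir_deriv M x (\<lambda>q. g (Y q) (Z q)) = g (nab x Y) (Z p) + g (Y p) (nab x Z)"
  using levi_civita[unfolded levi_civita_def, THEN conjunct2, THEN conjunct2, THEN spec, THEN spec, THEN spec,
    THEN mp, OF conjI, OF _ conjI, THEN bspec, THEN bspec] .

lemma g_eq_Gm:
  "c \<in> M \<Longrightarrow> p \<in> cdom c \<Longrightarrow> X \<in> tspace M p \<Longrightarrow> Y \<in> tspace M p \<Longrightarrow> g X Y = Gm c (cmap c p) (tcoord X c) (tcoord Y c)"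
  by (simp add: Gm_def)

lemma Gm_sym:
  assumes "c \<in> M" "x \<in> cmap c ` cdom c"
  shows "Gm c x v w = Gm c x w v"
proof -
  obtain p where p: "p \<in> cdom c" "x = cmap c p" using assms(2) by blast
  have "p \<in> points M" using p assms(1) unfolding points_def by blast
  then show ?thesis unfolding Gm_def using p assms(1) by (intro g_sym[of p]) auto
qed

lemma bilinear_Gm:
  assumes c: "c \<in> M" and x: "x \<in> cmap c ` cdom c"
  shows "bilinear (Gm c x)"
proof -
  obtain p where p: "p \<in> cdom c" "x = cmap c p" using x by blast
  have P: "p \<in> points M" using p c unfolding points_def by blast
  have "Gm c x (v + v') w = Gm c x v w + Gm c x v' w" "Gm c x (r *\<^sub>R v) w = r *\<^sub>R Gm c x v w" for v v' w r
    unfolding Gm_def p(2) cinv_cmap[OF c p(1)] tvec_of_add[OF c p(1)] tvec_of_scale[OF c p(1)]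
    using metric_axioms[OF P tvec_of_tspace[OF c p(1)] tvec_of_tspace[OF c p(1)] tvec_of_tspace[OF c p(1)]]
    by simp_all
  then have "linear (\<lambda>v. Gm c x v w)" for w by (auto intro: linearI)
  moreover have "linear (Gm c x v)" for v
  proof -
    have "Gm c x v = (\<lambda>w. Gm c x w v)" by (rule ext) (rule Gm_sym[OF c x])
    then show ?thesis using calculation[of v] by simp
  qed
  ultimately show ?thesis unfolding bilinear_def by blast
qed

lemma Gm_pos:
  assumes c: "c \<in> M" and x: "x \<in> cmap c ` cdom c" and "v \<noteq> 0"
  shows "Gm c x v v > 0"
proof -
  obtain p where p: "p \<in> cdom c" "x = cmap c p" using x by blast
  have P: "p \<in> points M" using p c unfolding points_def by blast
  have "tvec_of M c p v \<noteq> tzero p"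
  proof
    assume "tvec_of M c p v = tzero p"
    then have "tcoord (tvec_of M c p v) c = tcoord (tzero p) c" by simp
    then show False using c p assms(3) by simp
  qed
  then show ?thesis unfolding Gm_def using g_pos[OF P] c p by simp
qed

lemma smooth_Gm:
  assumes c: "c \<in> M"
  shows "smooth_on (cmap c ` cdom c) (\<lambda>x. Gm c x v w)"
proof -
  have "smooth_fun M (cdom c) (\<lambda>q. g (tvec_of M c q v) (tvec_of M c q w))"
    by (intro g_smooth openin_cdom[OF c] smooth_vf_const[OF c openin_cdom[OF c]] order_refl)
  then have "smooth_on (cmap c ` (cdom c \<inter> cdom c)) ((\<lambda>q. g (tvec_of M c q v) (tvec_of M c q w)) \<circ> cinv c)"
    using c unfolding smooth_fun_def by blast
  then show ?thesis by (simp add: comp_def Gm_def)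
qed

text \<open>Constant coordinate fields have vanishing bracket, so this is the torsion condition for
  them.\<close>

lemma Gam_sym:
  assumes c: "c \<in> M" and x: "x \<in> cmap c ` cdom c"
  shows "Gam c x v w = Gam c x w v"
proof -
  obtain p where p: "p \<in> cdom c" "x = cmap c p" using x by blast
  note U = openin_cdom[OF c]
  have D: "((\<lambda>x. tcoord (tvec_of M c (cinv c x) v) c) has_derivative (\<lambda>_. 0)) (at (cmap c p))" for v
    by (rule has_derivative_transform_within_open[OF has_derivative_const[of v] open_cmap_cdom[OF c]])
      (use c p in auto)
  have "tcoord (lie_bracket M (\<lambda>q. tvec_of M c q v) (\<lambda>q. tvec_of M c q w) p) c = 0"
    unfolding lie_bracket_def using c p by (simp add: frechet_derivative_eqI[OF D])
  then have "tcoord (nab (tvec_of M c p v) (\<lambda>q. tvec_of M c q w) -\<^sub>T nab (tvec_of M c p w) (\<lambda>q. tvec_of M c q v)) c = 0"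
    using nab_torsion[OF U smooth_vf_const[OF c U order_refl] smooth_vf_const[OF c U order_refl] p(1), of v w] by simp
  then show ?thesis unfolding Gam_def using c p by simp
qed

text \<open>Metric compatibility for constant coordinate fields. It allows every derivative of the
  metric coefficients to be replaced by Christoffel symbols from here on.\<close>

lemma Gm_compat:
  assumes c: "c \<in> M" and x: "x \<in> cmap c ` cdom c"
  shows "((\<lambda>x. Gm c x v w) has_derivative (\<lambda>a. Gm c x (Gam c x a v) w + Gm c x v (Gam c x a w))) (at x)"
proof -
  obtain p where p: "p \<in> cdom c" "x = cmap c p" using x by blast
  note U = openin_cdom[OF c]
  note sm = smooth_vf_const[OF c U order_refl]
  have D: "((\<lambda>x. Gm c x v w) has_derivative frechet_derivative (\<lambda>x. Gm c x v w) (at x)) (at x)"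
    by (rule smooth_on_has_derivative[OF smooth_Gm[OF c] x])
  have "frechet_derivative (\<lambda>x. Gm c x v w) (at x) a = Gm c x (Gam c x a v) w + Gm c x v (Gam c x a w)" for a
  proof -
    have tm: "nab (tvec_of M c p a) (\<lambda>q. tvec_of M c q w) \<in> tspace M p" for w
      by (rule nab_tspace[OF U sm p(1)]) (use c p in auto)
    have "dir_deriv M (tvec_of M c p a) (\<lambda>q. g (tvec_of M c q v) (tvec_of M c q w)) =
        frechet_derivative (\<lambda>x. Gm c x v w) (at x) (tcoord (tvec_of M c p a) c)"
      by (rule dir_deriv_eq[OF c p(1)]) (use D p c in \<open>auto simp: Gm_def comp_def\<close>)
    moreover have "dir_deriv M (tvec_of M c p a) (\<lambda>q. g (tvec_of M c q v) (tvec_of M c q w)) =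
        g (nab (tvec_of M c p a) (\<lambda>q. tvec_of M c q v)) (tvec_of M c p w) +
        g (tvec_of M c p v) (nab (tvec_of M c p a) (\<lambda>q. tvec_of M c q w))"
      by (rule nab_metric[OF U sm sm p(1)]) (use c p in auto)
    ultimately show ?thesis
      using tm c p by (simp add: g_eq_Gm[OF c p(1)] Gam_def)
  qed
  then show ?thesis using D by presburger
qed

end

section \<open>Charts of the tangent bundle and the connection map\<close>

context atlas begin

lemma cdom_tchart: "w \<in> cdom (tchart M c) \<longleftrightarrow> tbase w \<in> cdom c \<and> w \<in> tspace M (tbase w)"
proof
  assume "w \<in> cdom (tchart M c)"
  then obtain p where p: "p \<in> cdom c" "w \<in> tspace M p" unfolding tchart_def by auto
  then show "tbase w \<in> cdom c \<and> w \<in> tspace M (tbase w)" using tspaceD(1)[OF p(2)] by simp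
qed (auto simp: tchart_def)

lemma cmap_tchart: "cmap (tchart M c) w = (cmap c (tbase w), tcoord w c)"
  by (simp add: tchart_def)

lemma inj_tchart:
  assumes c: "c \<in> M"
  shows "inj_on (cmap (tchart M c)) (cdom (tchart M c))"
proof (rule inj_onI)
  fix v w assume v: "v \<in> cdom (tchart M c)" and w: "w \<in> cdom (tchart M c)"
    and eq: "cmap (tchart M c) v = cmap (tchart M c) w"
  have b: "tbase v = tbase w"
    by (rule inj_onD[OF inj_cmap[OF c]]) (use eq v w in \<open>auto simp: cdom_tchart cmap_tchart\<close>)
  show "v = w"
    by (rule tspace_eqI[of _ "tbase w" _ c]) (use eq v w b c in \<open>auto simp: cdom_tchart cmap_tchart\<close>)
qed

lemma cinv_tchart:
  assumes c: "c \<in> M" and x: "x \<in> cmap c ` cdom c"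
  shows "cinv (tchart M c) (x, v) = tvec_of M c (cinv c x) v"
proof -
  have m: "cinv c x \<in> cdom c" "cmap c (cinv c x) = x"
    using cinv_mem[OF c x] cmap_cinv[OF x] by simp_all
  show ?thesis
    unfolding cinv_def[of "tchart M c"]
    by (rule inv_into_f_eq[OF inj_tchart[OF c]]) (use m c in \<open>simp_all add: cdom_tchart cmap_tchart\<close>)
qed

lemma image_tchart:
  assumes c: "c \<in> M" and S: "S \<subseteq> cdom c"
  shows "cmap (tchart M c) ` {w \<in> cdom (tchart M c). tbase w \<in> S} = (cmap c ` S) \<times> UNIV"
proof (intro equalityI subsetI)
  fix z assume "z \<in> (cmap c ` S) \<times> (UNIV :: 'e set)"
  then obtain p where p: "p \<in> S" "fst z = cmap c p" by auto
  have "z = cmap (tchart M c) (tvec_of M c p (snd z))"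
    using p S c unfolding cmap_tchart by (auto simp: prod_eq_iff)
  moreover have "tvec_of M c p (snd z) \<in> {w \<in> cdom (tchart M c). tbase w \<in> S}"
    using p S c unfolding cdom_tchart by auto
  ultimately show "z \<in> cmap (tchart M c) ` {w \<in> cdom (tchart M c). tbase w \<in> S}" by blast
qed (auto simp: cmap_tchart)

lemma tchart_overlap:
  "cdom (tchart M c) \<inter> cdom (tchart M d) = {w \<in> cdom (tchart M c). tbase w \<in> cdom c \<inter> cdom d}"
  by (auto simp: cdom_tchart)

lemma image_tchart_overlap:
  "c \<in> M \<Longrightarrow> cmap (tchart M c) ` (cdom (tchart M c) \<inter> cdom (tchart M d)) = (cmap c ` (cdom c \<inter> cdom d)) \<times> UNIV"
  unfolding tchart_overlap by (rule image_tchart) auto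

lemma transition_tchart:
  assumes c: "c \<in> M" "d \<in> M" and x: "x \<in> cmap c ` (cdom c \<inter> cdom d)"
  shows "(cmap (tchart M d) \<circ> cinv (tchart M c)) (x, v) =
    ((cmap d \<circ> cinv c) x, frechet_derivative (cmap d \<circ> cinv c) (at x) v)"
proof -
  obtain p where p: "p \<in> cdom c" "p \<in> cdom d" "x = cmap c p" using x by blast
  have "x \<in> cmap c ` cdom c" using p by blast
  then show ?thesis
    using p c by (simp add: cinv_tchart[OF c(1)] cmap_tchart) (simp add: tvec_of_def)
qed

text \<open>The transition maps send (x, v) to (\<phi>(x), D\<phi>(x) v) with \<phi> a transition
  map of \<open>M\<close>; the second component is smooth in point and direction together.\<close>

lemma smooth_atlas_TM: "smooth_atlas (TM M)"
  unfolding smooth_atlas_def TM_def ball_simps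
proof (intro conjI ballI)
  fix c assume c: "c \<in> M"
  show "inj_on (cmap (tchart M c)) (cdom (tchart M c))" by (rule inj_tchart[OF c])
  show "open (cmap (tchart M c) ` cdom (tchart M c))"
    using image_tchart_overlap[OF c, of c] open_cmap_cdom[OF c] by (simp add: open_Times)
  fix d assume d: "d \<in> M"
  let ?O = "cmap c ` (cdom c \<inter> cdom d)"
  have O: "open ?O" by (rule open_overlap[OF c d])
  then have O': "open (?O \<times> (UNIV :: 'e set))" by (simp add: open_Times)
  show "open (cmap (tchart M c) ` (cdom (tchart M c) \<inter> cdom (tchart M d)))"
    unfolding image_tchart_overlap[OF c] by (rule O')
  have f: "smooth_on (?O \<times> UNIV) (fst :: 'e \<times> 'e \<Rightarrow> 'e)" "smooth_on (?O \<times> UNIV) (snd :: 'e \<times> 'e \<Rightarrow> 'e)"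
    by (rule smooth_on_bounded_linear[OF bounded_linear_fst] smooth_on_bounded_linear[OF bounded_linear_snd])+
  have im: "fst ` (?O \<times> (UNIV :: 'e set)) \<subseteq> ?O" by auto
  have "smooth_on (?O \<times> UNIV) (\<lambda>z. ((cmap d \<circ> cinv c) (fst z),
      frechet_derivative (cmap d \<circ> cinv c) (at (fst z)) (snd z)))"
    by (rule smooth_on_Pair[OF O' smooth_on_compose[OF O' O smooth_transition[OF c d] f(1) im]
      smooth_on_frechet_derivative_apply[OF O' O smooth_transition[OF c d] f(1) im f(2)]])
  then show "smooth_on (cmap (tchart M c) ` (cdom (tchart M c) \<inter> cdom (tchart M d)))
      (cmap (tchart M d) \<circ> cinv (tchart M c))"
    unfolding image_tchart_overlap[OF c]
  proof (rule smooth_on_transform[OF O'])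
    fix z assume "z \<in> ?O \<times> (UNIV :: 'e set)"
    then have "fst z \<in> ?O" by auto
    from transition_tchart[OF c d this, of "snd z"]
    show "(cmap (tchart M d) \<circ> cinv (tchart M c)) z = ((cmap d \<circ> cinv c) (fst z),
      frechet_derivative (cmap d \<circ> cinv c) (at (fst z)) (snd z))" by simp
  qed
qed

lemma atlas_TM: "atlas (TM M)"
  by (rule atlas.intro) (rule smooth_atlas_TM)

lemma tchart_TM: "c \<in> M \<Longrightarrow> tchart M c \<in> TM M"
  unfolding TM_def by blast

lemma points_TM: "w \<in> points (TM M) \<longleftrightarrow> tbase w \<in> points M \<and> w \<in> tspace M (tbase w)"
  unfolding points_def TM_def by (auto simp: cdom_tchart)

text \<open>The first component of a transition map of \<open>TM M\<close> depends on the base point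
  alone, so first components of vectors tangent to \<open>TM M\<close> transform like vectors
  tangent to \<open>M\<close>. This is what makes d\<pi> well defined in coordinates.\<close>

lemma fst_tcoord_TM:
  assumes \<xi>: "\<xi> \<in> tspace (TM M) w" and c: "c \<in> M" "tbase w \<in> cdom c" and d: "d \<in> M" "tbase w \<in> cdom d"
    and w: "w \<in> tspace M (tbase w)"
  shows "fst (tcoord \<xi> (tchart M d)) =
    frechet_derivative (cmap d \<circ> cinv c) (at (cmap c (tbase w))) (fst (tcoord \<xi> (tchart M c)))"
proof -
  interpret T: atlas "TM M" by (rule atlas_TM)
  let ?O = "cmap c ` (cdom c \<inter> cdom d)" and ?z = "cmap (tchart M c) w"
  let ?t = "cmap (tchart M d) \<circ> cinv (tchart M c)"
  have wc: "w \<in> cdom (tchart M c)" "w \<in> cdom (tchart M d)" using c d w by (auto simp: cdom_tchart)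
  have z: "?z \<in> ?O \<times> UNIV" "fst ?z = cmap c (tbase w)" using c d by (auto simp: cmap_tchart)
  have O': "open (?O \<times> (UNIV :: 'e set))" using open_overlap[OF c(1) d(1)] by (simp add: open_Times)
  have D1: "((\<lambda>z. fst (?t z)) has_derivative (\<lambda>k. fst (frechet_derivative ?t (at ?z) k))) (at ?z)"
    by (rule has_derivative_fst[OF T.transition_has_derivative[OF tchart_TM[OF c(1)] tchart_TM[OF d(1)] wc]])
  have "((\<lambda>z. (cmap d \<circ> cinv c) (fst z)) has_derivative
      (\<lambda>k. frechet_derivative (cmap d \<circ> cinv c) (at (cmap c (tbase w))) (fst k))) (at ?z)"
    by (rule has_derivative_compose[OF bounded_linear_imp_has_derivative[OF bounded_linear_fst]
      transition_has_derivative[OF c(1) d(1) c(2) d(2), folded z(2)], unfolded z(2)])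
  then have D2: "((\<lambda>z. fst (?t z)) has_derivative
      (\<lambda>k. frechet_derivative (cmap d \<circ> cinv c) (at (cmap c (tbase w))) (fst k))) (at ?z)"
  proof (rule has_derivative_transform_within_open[OF _ O' z(1)])
    fix y assume "y \<in> ?O \<times> (UNIV :: 'e set)"
    then have "fst y \<in> ?O" by auto
    from transition_tchart[OF c(1) d(1) this, of "snd y"]
    show "(cmap d \<circ> cinv c) (fst y) = fst (?t y)" by simp
  qed
  show ?thesis
    using fun_cong[OF has_derivative_unique[OF D1 D2], of "tcoord \<xi> (tchart M c)"]
      T.tspaceD(2)[OF \<xi> tchart_TM[OF c(1)] tchart_TM[OF d(1)] wc] by simp
qed

text \<open>In the induced charts the projection is \<open>fst\<close>, a linear map, hence its own
  derivative.\<close>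

lemma
  assumes \<xi>: "\<xi> \<in> tspace (TM M) w" and w: "w \<in> tspace M (tbase w)"
  shows tcoord_dpi: "c \<in> M \<Longrightarrow> tbase w \<in> cdom c \<Longrightarrow> tcoord (dpi M \<xi>) c = fst (tcoord \<xi> (tchart M c))"
    and dpi_tspace: "dpi M \<xi> \<in> tspace M (tbase w)"
proof -
  interpret T: atlas "TM M" by (rule atlas_TM)
  have b: "tbase \<xi> = w" by (rule T.tspaceD(1)[OF \<xi>])
  show *: "tcoord (dpi M \<xi>) c = fst (tcoord \<xi> (tchart M c))" if c: "c \<in> M" "tbase w \<in> cdom c" for c
  proof (rule T.tcoord_tdiff[where f = tbase and p = w, OF tchart_TM[OF c(1)] _ \<xi> c(1) c(2)])
    show "w \<in> cdom (tchart M c)" using c w by (simp add: cdom_tchart)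
    let ?O = "cmap c ` cdom c"
    have O': "open (?O \<times> (UNIV :: 'e set))" using open_cmap_cdom[OF c(1)] by (simp add: open_Times)
    have "(fst has_derivative fst) (at (cmap (tchart M c) w))"
      by (rule bounded_linear_imp_has_derivative[OF bounded_linear_fst])
    then show "((cmap c \<circ> tbase \<circ> cinv (tchart M c)) has_derivative fst) (at (cmap (tchart M c) w))"
    proof (rule has_derivative_transform_within_open[OF _ O'])
      show "cmap (tchart M c) w \<in> ?O \<times> UNIV" using c by (simp add: cmap_tchart)
      fix z assume "z \<in> ?O \<times> (UNIV :: 'e set)"
      then have f: "fst z \<in> ?O" by auto
      from cinv_tchart[OF c(1) f, of "snd z"] cmap_cinv[OF f]
      show "fst z = (cmap c \<circ> tbase \<circ> cinv (tchart M c)) z" by simp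
    qed
  qed
  show "dpi M \<xi> \<in> tspace M (tbase w)"
  proof (rule tspaceI_transition)
    show "tbase (dpi M \<xi>) = tbase w" using b by (simp add: tdiff_def Let_def)
    show "tcoord (dpi M \<xi>) c = 0" if "\<not> (c \<in> M \<and> tbase w \<in> cdom c)" for c
      using that b by (auto simp: tdiff_def Let_def)
    fix c d assume a: "c \<in> M" "d \<in> M" "tbase w \<in> cdom c" "tbase w \<in> cdom d"
    show "tcoord (dpi M \<xi>) d = frechet_derivative (cmap d \<circ> cinv c) (at (cmap c (tbase w))) (tcoord (dpi M \<xi>) c)"
      unfolding *[OF a(1,3)] *[OF a(2,4)] by (rule fst_tcoord_TM[OF \<xi> a(1,3,2,4) w])
  qed
qed

text \<open>In coordinates a section is the graph of its coordinate function, so its differential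
  sends \<open>a\<close> to (a, h'(a)). It serves to recognise a prescribed vector of the double
  tangent bundle as some dZ(X).\<close>

lemma tdiff_section:
  assumes c: "c \<in> M" "p \<in> cdom c" and U: "openin (mtopology M) U" "p \<in> U" and Z: "smooth_vf M U Z"
    and X: "X \<in> tspace M p" and h: "((\<lambda>x. tcoord (Z (cinv c x)) c) has_derivative h') (at (cmap c p))"
    and \<xi>: "\<xi> \<in> tspace (TM M) (Z p)" "tcoord \<xi> (tchart M c) = (tcoord X c, h' (tcoord X c))"
  shows "tdiff M (TM M) Z X = \<xi>"
proof (rule tvec.expand, intro conjI ext)
  interpret T: atlas "TM M" by (rule atlas_TM)
  have bX: "tbase X = p" by (rule tspaceD(1)[OF X])
  show "tbase (tdiff M (TM M) Z X) = tbase \<xi>"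
    using T.tspaceD(1)[OF \<xi>(1)] bX by (simp add: tdiff_def Let_def)
  fix d'
  have Zp: "Z p \<in> tspace M p" by (rule smooth_vfD(1)[OF Z U(2)])
  then have bZ: "tbase (Z p) = p" by (rule tspaceD(1))
  show "tcoord (tdiff M (TM M) Z X) d' = tcoord \<xi> d'"
  proof (cases "d' \<in> TM M \<and> Z p \<in> cdom d'")
    case False
    then show ?thesis using T.tspaceD(3)[OF \<xi>(1) False] bX by (auto simp: tdiff_def Let_def)
  next
    case True
    then obtain d where d: "d \<in> M" "d' = tchart M d" "p \<in> cdom d"
      using bZ unfolding TM_def by (auto simp: cdom_tchart)
    have Zc: "Z p \<in> cdom (tchart M c)" using c Zp bZ by (simp add: cdom_tchart)
    let ?h = "\<lambda>x. tcoord (Z (cinv c x)) c"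
    let ?O = "cmap c ` (U \<inter> (cdom c \<inter> cdom d))"
    have O: "open ?O"
      by (rule open_chart_subset) (use U(1) c(1) d(1) openin_cdom in blast)+
    have cz: "cmap (tchart M c) (Z p) = (cmap c p, ?h (cmap c p))" using c bZ by (simp add: cmap_tchart)
    have t: "((cmap d' \<circ> cinv (tchart M c)) has_derivative
        frechet_derivative (cmap d' \<circ> cinv (tchart M c)) (at (cmap (tchart M c) (Z p)))) (at (cmap c p, ?h (cmap c p)))"
      unfolding cz[symmetric] by (rule T.transition_has_derivative[OF tchart_TM[OF c(1)]]) (use True Zc in auto)
    have "((\<lambda>x. (cmap d' \<circ> cinv (tchart M c)) (x, ?h x)) has_derivative
        (\<lambda>k. frechet_derivative (cmap d' \<circ> cinv (tchart M c)) (at (cmap (tchart M c) (Z p))) (k, h' k))) (at (cmap c p))"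
      by (rule has_derivative_compose[OF has_derivative_Pair[OF has_derivative_ident h] t])
    then have "((cmap d' \<circ> Z \<circ> cinv c) has_derivative
        (\<lambda>k. frechet_derivative (cmap d' \<circ> cinv (tchart M c)) (at (cmap (tchart M c) (Z p))) (k, h' k))) (at (cmap c p))"
    proof (rule has_derivative_transform_within_open[OF _ O])
      show "cmap c p \<in> ?O" using c U d by blast
      fix x assume "x \<in> ?O"
      then obtain q where q: "q \<in> U" "q \<in> cdom c" "q \<in> cdom d" "x = cmap c q" by blast
      have "cinv (tchart M c) (x, ?h x) = tvec_of M c (cinv c x) (?h x)"
        by (rule cinv_tchart[OF c(1)]) (use q in blast)
      also have "\<dots> = Z (cinv c x)"
        using q c(1) tvec_of_tcoord[OF c(1) q(2) smooth_vfD(1)[OF Z q(1)]] by simp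
      finally show "(cmap d' \<circ> cinv (tchart M c)) (x, ?h x) = (cmap d' \<circ> Z \<circ> cinv c) x" by simp
    qed
    then have "tcoord (tdiff M (TM M) Z X) d' =
        frechet_derivative (cmap d' \<circ> cinv (tchart M c)) (at (cmap (tchart M c) (Z p))) (tcoord X c, h' (tcoord X c))"
      by (rule tcoord_tdiff[where f = Z and p = p, OF c X conjunct1[OF True] conjunct2[OF True]])
    also have "\<dots> = tcoord \<xi> d'"
      unfolding \<xi>(2)[symmetric]
      by (rule T.tspaceD(2)[OF \<xi>(1) tchart_TM[OF c(1)], symmetric]) (use True Zc in auto)
    finally show ?thesis .
  qed
qed

end

section \<open>The connection map in coordinates\<close>

locale connection_map_atlas = atlas_connection M nab
  for M :: "('a, 'e::euclidean_space) atlas" and nab +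
  fixes K :: "(('a, 'e) tvec, 'e \<times> 'e) tvec \<Rightarrow> ('a, 'e) tvec"
  assumes connection_map: "connection_map M nab K"
begin

lemma K_linear:
  assumes "u \<in> points (TM M)" "\<xi> \<in> tspace (TM M) u"
  shows K_tspace: "K \<xi> \<in> tspace M (tbase u)"
    and K_add: "\<eta> \<in> tspace (TM M) u \<Longrightarrow> K (\<xi> +\<^sub>T \<eta>) = K \<xi> +\<^sub>T K \<eta>"
    and K_scale: "K (r *\<^sub>T \<xi>) = r *\<^sub>T K \<xi>"
proof -
  note * = connection_map[unfolded connection_map_def, THEN conjunct1, THEN bspec, OF assms(1), THEN bspec, OF assms(2)]
  show "K \<xi> \<in> tspace M (tbase u)" by (rule conjunct1[OF *])
  show "K (\<xi> +\<^sub>T \<eta>) = K \<xi> +\<^sub>T K \<eta>" if "\<eta> \<in> tspace (TM M) u"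
    by (rule conjunct1[OF conjunct2[OF *], THEN bspec, OF that])
  show "K (r *\<^sub>T \<xi>) = r *\<^sub>T K \<xi>" by (rule conjunct2[OF conjunct2[OF *], THEN spec])
qed

lemma K_tdiff:
  "openin (mtopology M) U \<Longrightarrow> smooth_vf M U Z \<Longrightarrow> p \<in> U \<Longrightarrow> X \<in> tspace M p \<Longrightarrow> K (tdiff M (TM M) Z X) = nab X Z"
  using connection_map[unfolded connection_map_def, THEN conjunct2, THEN spec, THEN spec, THEN mp, OF conjI,
    THEN bspec, THEN bspec] .

text \<open>A vector (a, b) with \<open>a\<close> nonzero equals dZ(a) for a field Z through
  \<open>w\<close> that is affine in the chart and has derivative \<open>b\<close> in the direction
  \<open>a\<close>, so K is the covariant derivative of Z there. For vertical vectors linearity of K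
  is used.\<close>

lemma tcoord_K:
  assumes c: "c \<in> M" "tbase w \<in> cdom c" and w: "w \<in> tspace M (tbase w)" and \<xi>: "\<xi> \<in> tspace (TM M) w"
  shows "tcoord (K \<xi>) c = snd (tcoord \<xi> (tchart M c)) +
    Gam c (cmap c (tbase w)) (fst (tcoord \<xi> (tchart M c))) (tcoord w c)"
proof -
  interpret T: atlas "TM M" by (rule atlas_TM)
  define p where "p = tbase w"
  define E where "E a b = tvec_of (TM M) (tchart M c) w (a, b)" for a b
  note tc = tchart_TM[OF c(1)]
  have wc: "w \<in> cdom (tchart M c)" using c w by (simp add: cdom_tchart)
  have wP: "w \<in> points (TM M)" using wc tc unfolding points_def by blast
  have E: "E a b \<in> tspace (TM M) w" for a b unfolding E_def using tc wc by (rule T.tvec_of_tspace)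
  have Ec: "tcoord (E a b) (tchart M c) = (a, b)" for a b unfolding E_def using tc wc by (rule T.tcoord_tvec_of)
  have p: "p \<in> cdom c" "w \<in> tspace M p" using c w unfolding p_def by auto
  have lin: "linear (\<lambda>a. Gam c (cmap c p) a v)" for v
    using bilinear_Gam[OF c(1), of "cmap c p"] p unfolding bilinear_def by blast
  have nonvert: "tcoord (K (E a b)) c = b + Gam c (cmap c p) a (tcoord w c)" if a: "a \<noteq> 0" for a b
  proof -
    \<comment> \<open>A rank-one linear map with \<open>L a = b\<close>; the division by
      \<open>a \<bullet> a\<close> is where \<open>a\<close> must be nonzero.\<close>
    define L where "L y = ((y \<bullet> a) / (a \<bullet> a)) *\<^sub>R b" for y
    have L: "bounded_linear L"
      unfolding L_def by (intro bounded_linear_scaleR_left[THEN bounded_linear_compose]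
          bounded_linear_divide[THEN bounded_linear_compose] bounded_linear_inner_left)
    define Z where "Z q = tvec_of M c q (tcoord w c + L (cmap c q - cmap c p))" for q
    note U = openin_cdom[OF c(1)]
    note oS = open_cmap_cdom[OF c(1)]
    have Zc: "tcoord (Z (cinv c x)) c = tcoord w c + L (x - cmap c p)" if "x \<in> cmap c ` cdom c" for x
      using that c(1) unfolding Z_def by auto
    have Zs: "smooth_vf M (cdom c) Z"
    proof (rule smooth_vf_chartI[OF c(1) U order_refl])
      have "smooth_on (cmap c ` cdom c) (\<lambda>x. (tcoord w c + L x) - L (cmap c p))"
        by (intro smooth_on_diff smooth_on_add oS smooth_on_const smooth_on_bounded_linear[OF L])
      then show "smooth_on (cmap c ` cdom c) (\<lambda>x. tcoord (Z (cinv c x)) c)"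
        by (rule smooth_on_transform[OF oS])
          (simp only: Zc linear_diff[OF bounded_linear.linear[OF L]] add_diff_eq)
    qed (use c(1) in \<open>simp add: Z_def\<close>)
    have Zp: "Z p = w"
      unfolding Z_def using tvec_of_tcoord[OF c(1) p] bounded_linear.linear[OF L] by (simp add: linear_0)
    have hD: "((\<lambda>x. tcoord (Z (cinv c x)) c) has_derivative L) (at (cmap c p))"
    proof -
      have "((\<lambda>x. tcoord w c + L (x - cmap c p)) has_derivative (\<lambda>k. 0 + L (k - 0))) (at (cmap c p))"
        by (intro has_derivative_add has_derivative_diff has_derivative_const has_derivative_ident
            bounded_linear.has_derivative[OF L])
      then have "((\<lambda>x. tcoord w c + L (x - cmap c p)) has_derivative L) (at (cmap c p))" by simp
      then show ?thesis
        by (rule has_derivative_transform_within_open[OF _ oS]) (use p Zc in auto)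
    qed
    have X: "tvec_of M c p a \<in> tspace M p" using c(1) p by simp
    have La: "L a = b" unfolding L_def using a by simp
    have "tdiff M (TM M) Z (tvec_of M c p a) = E a b"
      by (rule tdiff_section[OF c(1) p(1) U p(1) Zs X hD]) (use E Ec Zp La c(1) p in auto)
    then have "K (E a b) = nab (tvec_of M c p a) Z"
      using K_tdiff[OF U Zs p(1) X] by simp
    then show ?thesis
      using tcoord_nab[OF U Zs p(1) c(1) p(1) X] c(1) p Zp La by (simp add: frechet_derivative_eqI[OF hD])
  qed
  have main: "tcoord (K (E a b)) c = b + Gam c (cmap c p) a (tcoord w c)" for a b
  proof (cases "a = 0")
    case True
    \<comment> \<open>A vertical vector is a difference of two non-vertical ones: (0, b) = (e, b) -
      (e, 0), and the Christoffel terms of the two cancel.\<close>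
    obtain e :: 'e where e: "e \<in> Basis" by fastforce
    then have e0: "e \<noteq> 0" by auto
    have "E e b +\<^sub>T (-1) *\<^sub>T E e 0 = E 0 b"
      by (rule T.tspace_eqI[OF _ E tc wc]) (use E Ec in auto)
    then have "K (E 0 b) = K (E e b) +\<^sub>T (-1) *\<^sub>T K (E e 0)"
      using K_add[OF wP E T.tscale_tspace[OF E], of e b "-1" e 0] K_scale[OF wP E, of "-1" e 0] by simp
    then show ?thesis using True nonvert[OF e0] linear_0[OF lin] by simp
  qed (rule nonvert)
  have "\<xi> = E (fst (tcoord \<xi> (tchart M c))) (snd (tcoord \<xi> (tchart M c)))"
    unfolding E_def using tc wc \<xi> by simp
  then show ?thesis unfolding p_def[symmetric] using main by metis
qed

text \<open>The coordinate expression (a, b) -> (a, b + \<Gamma>(a, v)) of (d\<pi>, K) is triangular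
  and hence inverted explicitly. This settles existence and uniqueness behind the definite
  description of lifts.\<close>

lemma tvec_with_eq:
  assumes c: "c \<in> M" "tbase w \<in> cdom c" and w: "w \<in> tspace M (tbase w)"
    and X: "X \<in> tspace M (tbase w)" and Y: "Y \<in> tspace M (tbase w)"
  shows "tvec_with M K w X Y = tvec_of (TM M) (tchart M c) w
    (tcoord X c, tcoord Y c - Gam c (cmap c (tbase w)) (tcoord X c) (tcoord w c))"
    (is "_ = ?\<xi>")
  unfolding tvec_with_def
proof (rule the_equality)
  interpret T: atlas "TM M" by (rule atlas_TM)
  note tc = tchart_TM[OF c(1)]
  have wc: "w \<in> cdom (tchart M c)" using c w by (simp add: cdom_tchart)
  have wP: "w \<in> points (TM M)" using wc tc unfolding points_def by blast
  have m: "?\<xi> \<in> tspace (TM M) w" using tc wc by simp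
  have "dpi M ?\<xi> = X"
    by (rule tspace_eqI[OF dpi_tspace[OF m w] X c]) (use tcoord_dpi[OF m w c] tc wc in simp)
  moreover have "K ?\<xi> = Y"
    by (rule tspace_eqI[OF K_tspace[OF wP m] Y c]) (use tcoord_K[OF c w m] tc wc in simp)
  ultimately show "?\<xi> \<in> tspace (TM M) w \<and> dpi M ?\<xi> = X \<and> K ?\<xi> = Y" using m by blast
  fix \<xi> assume "\<xi> \<in> tspace (TM M) w \<and> dpi M \<xi> = X \<and> K \<xi> = Y"
  then have \<xi>: "\<xi> \<in> tspace (TM M) w" "dpi M \<xi> = X" "K \<xi> = Y" by auto
  have "fst (tcoord \<xi> (tchart M c)) = tcoord X c" using tcoord_dpi[OF \<xi>(1) w c] \<xi>(2) by simp
  moreover have "snd (tcoord \<xi> (tchart M c)) = tcoord Y c - Gam c (cmap c (tbase w)) (tcoord X c) (tcoord w c)"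
    using tcoord_K[OF c w \<xi>(1)] \<xi>(3) calculation by simp
  ultimately have "tcoord \<xi> (tchart M c) = tcoord ?\<xi> (tchart M c)" using tc wc by (simp add: prod_eq_iff)
  then show "\<xi> = ?\<xi>" by (rule T.tspace_eqI[OF \<xi>(1) m tc wc])
qed

end

section \<open>Curvature in charts\<close>

lemma has_derivative_frechet_derivative_apply:
  fixes f :: "'a::euclidean_space \<Rightarrow> 'b::real_normed_vector"
  assumes S: "open S" "x \<in> S" and f: "smooth_on S f" and h: "(h has_derivative h') (at x)"
  shows "((\<lambda>s. frechet_derivative f (at s) (h s)) has_derivative
    (\<lambda>k. frechet_derivative (\<lambda>s. frechet_derivative f (at s) (h x)) (at x) k + frechet_derivative f (at x) (h' k))) (at x)"
proof -
  have lin: "linear (frechet_derivative f (at s))" if "s \<in> S" for s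
    by (rule linear_frechet_derivative[OF smooth_on_imp_differentiable[OF f that]])
  \<comment> \<open>The dummy scalar \<open>r\<close> makes the derivative of \<open>f\<close> a
    bilinear map depending on the point, so that the rule for parametrised bilinear maps applies;
    \<open>r\<close> is then held constant at 1.\<close>
  define \<phi> where "\<phi> s b r = r *\<^sub>R frechet_derivative f (at s) b" for s b and r :: real
  have bil: "bilinear (\<phi> s)" if "s \<in> S" for s
    unfolding \<phi>_def bilinear_def using lin[OF that]
    by (intro conjI allI linearI)
      (simp_all add: linear_add[OF lin[OF that]] linear_scale[OF lin[OF that]] algebra_simps)
  have "((\<lambda>s. \<phi> s (h s) 1) has_derivative (\<lambda>k. frechet_derivative (\<lambda>p. \<phi> p (h x) 1) (at x) k + \<phi> x (h' k) 1 + \<phi> x (h x) 0)) (at x)"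
  proof (rule has_derivative_bilinear_param[where x = "\<lambda>s. s" and z = "\<lambda>_. 1", OF S(1) S(2) bil _ has_derivative_ident h has_derivative_const])
    show "(\<lambda>p. \<phi> p b c) differentiable at x" for b c
      unfolding \<phi>_def by (intro differentiable_scaleR differentiable_const
        smooth_on_imp_differentiable[OF smooth_on_frechet_derivative[OF f] S(2)])
  qed
  then show ?thesis by (simp add: \<phi>_def)
qed

text \<open>The classical argument: four cyclic sums, one for each choice of the last argument, are
  combined, and the two skew symmetries cancel or identify all other terms.\<close>

lemma curvature_pair_symmetry:
  fixes r :: "'a \<Rightarrow> 'a \<Rightarrow> 'a \<Rightarrow> 'a \<Rightarrow> real"
  assumes s12: "\<And>a b c d. r a b c d = - r b a c d" and s34: "\<And>a b c d. r a b c d = - r a b d c"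
    and bianchi: "\<And>a b c d. r a b c d + r b c a d + r c a b d = 0"
  shows "r a b c d = r c d a b"
  using bianchi[of a b c d] bianchi[of b c d a] bianchi[of c d a b] bianchi[of d a b c]
    s34[of b c d a] s34[of c d b a] s12[of a c d b] s34[of c a d b] s34[of d a b c] s34[of a b d c]
    s12[of b d a c] s34[of d b a c]
  by linarith

context levi_civita_atlas begin

definition dGam :: "('a, 'e) chart \<Rightarrow> 'e \<Rightarrow> 'e \<Rightarrow> 'e \<Rightarrow> 'e \<Rightarrow> 'e" where
  "dGam c x a b d = frechet_derivative (\<lambda>y. Gam c y b d) (at x) a"

text \<open>R(a, b)d in the stated sign convention, written out for constant coordinate fields; no
  bracket term appears because these fields commute.\<close>

definition Riem :: "('a, 'e) chart \<Rightarrow> 'e \<Rightarrow> 'e \<Rightarrow> 'e \<Rightarrow> 'e \<Rightarrow> 'e" where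
  "Riem c x a b d = dGam c x a b d - dGam c x b a d + Gam c x a (Gam c x b d) - Gam c x b (Gam c x a d)"

lemma Gam_has_derivative:
  assumes "c \<in> M" "x \<in> cmap c ` cdom c"
  shows "((\<lambda>y. Gam c y b d) has_derivative (\<lambda>a. dGam c x a b d)) (at x)"
  unfolding dGam_def by (rule smooth_on_has_derivative[OF smooth_Gam[OF assms(1)] assms(2)])

lemma dGam_sym:
  assumes "c \<in> M" "x \<in> cmap c ` cdom c"
  shows "dGam c x a b d = dGam c x a d b"
proof -
  have "frechet_derivative (\<lambda>y. Gam c y b d) (at x) = frechet_derivative (\<lambda>y. Gam c y d b) (at x)"
    by (rule frechet_derivative_cong_open[OF open_cmap_cdom[OF assms(1)] assms(2)]) (rule Gam_sym[OF assms(1)])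
  then show ?thesis unfolding dGam_def by (rule fun_cong)
qed

lemma Gam_param_has_derivative:
  assumes c: "c \<in> M" and x: "x t \<in> cmap c ` cdom c"
    and "(x has_derivative x') (at t)" "(y has_derivative y') (at t)" "(z has_derivative z') (at t)"
  shows "((\<lambda>s. Gam c (x s) (y s) (z s)) has_derivative
    (\<lambda>h. dGam c (x t) (x' h) (y t) (z t) + Gam c (x t) (y' h) (z t) + Gam c (x t) (y t) (z' h))) (at t)"
  unfolding dGam_def
  by (rule has_derivative_bilinear_param[OF open_cmap_cdom[OF c] x bilinear_Gam[OF c]
    smooth_on_imp_differentiable[OF smooth_Gam[OF c] x] assms(3-5)])

lemma Gm_param_has_derivative:
  assumes c: "c \<in> M" and x: "x t \<in> cmap c ` cdom c"
    and "(x has_derivative x') (at t)" "(y has_derivative y') (at t)" "(z has_derivative z') (at t)"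
  shows "((\<lambda>s. Gm c (x s) (y s) (z s)) has_derivative
    (\<lambda>h. (Gm c (x t) (Gam c (x t) (x' h) (y t)) (z t) + Gm c (x t) (y t) (Gam c (x t) (x' h) (z t))) +
      Gm c (x t) (y' h) (z t) + Gm c (x t) (y t) (z' h))) (at t)"
  using has_derivative_bilinear_param[OF open_cmap_cdom[OF c] x bilinear_Gm[OF c]
    smooth_on_imp_differentiable[OF smooth_Gm[OF c] x] assms(3-5)]
  unfolding frechet_derivative_eqI[OF Gm_compat[OF c x]] .

lemma linear_Gam:
  assumes "c \<in> M" "x \<in> cmap c ` cdom c"
  shows linear_Gam1: "linear (\<lambda>v. Gam c x v w)" and linear_Gam2: "linear (Gam c x v)"
  using bilinear_Gam[OF assms] unfolding bilinear_def by blast+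

lemmas Gam_simps =
  linear_add[OF linear_Gam1] linear_add[OF linear_Gam2] linear_diff[OF linear_Gam1] linear_diff[OF linear_Gam2]
  linear_neg[OF linear_Gam1] linear_neg[OF linear_Gam2] linear_scale[OF linear_Gam1] linear_scale[OF linear_Gam2]
  linear_0[OF linear_Gam1] linear_0[OF linear_Gam2]

lemma linear_Gm:
  assumes "c \<in> M" "x \<in> cmap c ` cdom c"
  shows linear_Gm1: "linear (\<lambda>v. Gm c x v w)" and linear_Gm2: "linear (Gm c x v)"
  using bilinear_Gm[OF assms] unfolding bilinear_def by blast+

lemmas Gm_simps =
  linear_add[OF linear_Gm1] linear_add[OF linear_Gm2] linear_diff[OF linear_Gm1] linear_diff[OF linear_Gm2]
  linear_neg[OF linear_Gm1] linear_neg[OF linear_Gm2] linear_scale[OF linear_Gm1] linear_scale[OF linear_Gm2]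
  linear_0[OF linear_Gm1] linear_0[OF linear_Gm2]

lemma Riem_skew: "Riem c x a b d = - Riem c x b a d"
  by (simp add: Riem_def)

text \<open>Since \<Gamma> and hence its derivative are symmetric in the last two arguments, the
  cyclic sum cancels in pairs.\<close>

lemma Riem_bianchi:
  assumes "c \<in> M" "x \<in> cmap c ` cdom c"
  shows "Riem c x a b d + Riem c x b d a + Riem c x d a b = 0"
  unfolding Riem_def
  using dGam_sym[OF assms, of a b d] dGam_sym[OF assms, of b d a] dGam_sym[OF assms, of d a b]
    Gam_sym[OF assms, of a b] Gam_sym[OF assms, of b d] Gam_sym[OF assms, of d a]
  by simp

text \<open>The second derivatives of the metric coefficient g(v, w) in the directions
  \<open>a\<close> and \<open>b\<close> commute. Computed by metric compatibility, their difference
  is g(R(a,b)v, w) + g(v, R(a,b)w).\<close>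

lemma Riem_metric_skew:
  assumes c: "c \<in> M" and x: "x \<in> cmap c ` cdom c"
  shows "Gm c x (Riem c x a b v) w = - Gm c x v (Riem c x a b w)"
proof -
  let ?S = "cmap c ` cdom c"
  have D1: "frechet_derivative (\<lambda>s. Gm c s v w) (at s) b = Gm c s (Gam c s b v) w + Gm c s v (Gam c s b w)"
    if "s \<in> ?S" for s b
    by (simp add: frechet_derivative_eqI[OF Gm_compat[OF c that]])
  have D2: "frechet_derivative (\<lambda>s. frechet_derivative (\<lambda>s. Gm c s v w) (at s) b) (at x) a =
      ((Gm c x (Gam c x a (Gam c x b v)) w + Gm c x (Gam c x b v) (Gam c x a w)) +
        Gm c x (dGam c x a b v) w + Gm c x (Gam c x b v) 0) +
      ((Gm c x (Gam c x a v) (Gam c x b w) + Gm c x v (Gam c x a (Gam c x b w))) +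
        Gm c x 0 (Gam c x b w) + Gm c x v (dGam c x a b w))" for a b
  proof -
    have "((\<lambda>s. Gm c s (Gam c s b v) w + Gm c s v (Gam c s b w)) has_derivative (\<lambda>a.
      ((Gm c x (Gam c x a (Gam c x b v)) w + Gm c x (Gam c x b v) (Gam c x a w)) +
        Gm c x (dGam c x a b v) w + Gm c x (Gam c x b v) 0) +
      ((Gm c x (Gam c x a v) (Gam c x b w) + Gm c x v (Gam c x a (Gam c x b w))) +
        Gm c x 0 (Gam c x b w) + Gm c x v (dGam c x a b w)))) (at x)"
      by (intro has_derivative_add Gm_param_has_derivative[OF c, where x = "\<lambda>s. s"] x has_derivative_ident
          Gam_has_derivative[OF c x] has_derivative_const)
    moreover have "frechet_derivative (\<lambda>s. frechet_derivative (\<lambda>s. Gm c s v w) (at s) b) (at x) =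
        frechet_derivative (\<lambda>s. Gm c s (Gam c s b v) w + Gm c s v (Gam c s b w)) (at x)"
      by (rule frechet_derivative_cong_open[OF open_cmap_cdom[OF c] x]) (rule D1)
    ultimately show ?thesis by (simp only: frechet_derivative_eqI)
  qed
  have "frechet_derivative (\<lambda>s. frechet_derivative (\<lambda>s. Gm c s v w) (at s) b) (at x) a =
      frechet_derivative (\<lambda>s. frechet_derivative (\<lambda>s. Gm c s v w) (at s) a) (at x) b"
    by (rule mixed_derivatives_commute[OF open_cmap_cdom[OF c] x smooth_Gm[OF c]])
  then show ?thesis unfolding D2 Riem_def by (simp add: Gm_simps[OF c x])
qed

lemma Riem_pair:
  assumes c: "c \<in> M" and x: "x \<in> cmap c ` cdom c"
  shows "Gm c x (Riem c x a b v) w = Gm c x (Riem c x v w a) b"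
proof (rule curvature_pair_symmetry[where r = "\<lambda>a b v w. Gm c x (Riem c x a b v) w"])
  show "Gm c x (Riem c x a b v) w = - Gm c x (Riem c x b a v) w" for a b v w
    by (subst Riem_skew) (simp add: Gm_simps[OF c x])
  show "Gm c x (Riem c x a b v) w = - Gm c x (Riem c x a b w) v" for a b v w
    using Riem_metric_skew[OF c x] Gm_sym[OF c x] by metis
  show "Gm c x (Riem c x a b v) w + Gm c x (Riem c x b v a) w + Gm c x (Riem c x v a b) w = 0" for a b v w
    using arg_cong[OF Riem_bianchi[OF c x, of a b v], of "\<lambda>y. Gm c x y w"] by (simp add: Gm_simps[OF c x])
qed

text \<open>The expression depends on the fields only through their values at \<open>p\<close>:
  second derivatives of \<open>Z\<close> cancel by symmetry, derivatives of \<open>X\<close> and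
  \<open>Y\<close> cancel against the bracket term, and the products of \<Gamma> with first
  derivatives of \<open>Z\<close> cancel in pairs.\<close>

lemma curvature_expression:
  assumes c: "c \<in> M" "p \<in> cdom c"
    and U: "openin (mtopology M) U" "p \<in> U" and X: "smooth_vf M U X" and Y: "smooth_vf M U Y" and Z: "smooth_vf M U Z"
  shows "nab (X p) (\<lambda>q. nab (Y q) Z) -\<^sub>T nab (Y p) (\<lambda>q. nab (X q) Z) -\<^sub>T nab (lie_bracket M X Y p) Z =
    tvec_of M c p (Riem c (cmap c p) (tcoord (X p) c) (tcoord (Y p) c) (tcoord (Z p) c))"
    (is "?e = _")
proof -
  let ?x = "cmap c p"
  have x: "?x \<in> cmap c ` cdom c" using c by blast
  define V where "V = U \<inter> cdom c"
  have V: "openin (mtopology M) V" "V \<subseteq> cdom c" "p \<in> V" "V \<subseteq> U"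
    unfolding V_def using openin_Int_cdom[OF U(1) c(1)] U c by auto
  have oV: "open (cmap c ` V)" by (rule open_chart_subset[OF V(1) c(1) V(2)])
  have xV: "?x \<in> cmap c ` V" using V by blast
  define h where "h X x = tcoord (X (cinv c x)) c" for X :: "'a \<Rightarrow> ('a, 'e) tvec" and x
  define D where "D X = frechet_derivative (h X) (at ?x)" for X
  have hx: "h X ?x = tcoord (X p) c" for X unfolding h_def using c by simp
  have hD: "(h X has_derivative D X) (at ?x)" if "smooth_vf M U X" for X
    unfolding D_def h_def by (rule tcoord_has_derivative[OF U(1) that c(1) U(2) c(2)])
  have hsm: "smooth_on (cmap c ` V) (h X)" if "smooth_vf M U X" for X
    unfolding h_def by (rule smooth_on_tcoord_subset[OF that c(1) V(4,2)])
  note tsp = smooth_vfD(1)[OF _ U(2)]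
  have nabc: "tcoord (nab v Z) c = D Z (tcoord v c) + Gam c ?x (tcoord v c) (tcoord (Z p) c)" if "v \<in> tspace M p" for v
    unfolding D_def h_def using tcoord_nab[OF U(1) Z U(2) c(1,2) that] .
  define D2 where "D2 a b = frechet_derivative (\<lambda>s. frechet_derivative (h Z) (at s) b) (at ?x) a" for a b
  have D2sym: "D2 a b = D2 b a" for a b
    unfolding D2_def by (rule mixed_derivatives_commute[OF oV xV hsm[OF Z]])
  \<comment> \<open>Stated for arbitrary fields \<open>X\<close> and \<open>Y\<close>, because it is
    used in both orders.\<close>
  have second: "tcoord (nab (X p) (\<lambda>q. nab (Y q) Z)) c =
      (D2 (tcoord (X p) c) (tcoord (Y p) c) + D Z (D Y (tcoord (X p) c))) +
      (dGam c ?x (tcoord (X p) c) (tcoord (Y p) c) (tcoord (Z p) c) + Gam c ?x (D Y (tcoord (X p) c)) (tcoord (Z p) c) +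
        Gam c ?x (tcoord (Y p) c) (D Z (tcoord (X p) c))) +
      Gam c ?x (tcoord (X p) c) (D Z (tcoord (Y p) c) + Gam c ?x (tcoord (Y p) c) (tcoord (Z p) c))"
    if X: "smooth_vf M U X" and Y: "smooth_vf M U Y" for X Y
  proof -
    have nsm: "smooth_vf M U (\<lambda>q. nab (Y q) Z)" by (rule nab_smooth[OF U(1) Z Y])
    have eq: "tcoord (nab (Y (cinv c s)) Z) c = frechet_derivative (h Z) (at s) (h Y s) + Gam c s (h Y s) (h Z s)"
      if "s \<in> cmap c ` V" for s
    proof -
      obtain q where q: "q \<in> V" "s = cmap c q" using \<open>s \<in> cmap c ` V\<close> by blast
      then have q': "q \<in> U" "q \<in> cdom c" using V by auto
      show ?thesis
        using tcoord_nab[OF U(1) Z q'(1) c(1) q'(2) smooth_vfD(1)[OF Y q'(1)]] c(1) q' q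
        unfolding h_def by simp
    qed
    have "((\<lambda>s. frechet_derivative (h Z) (at s) (h Y s) + Gam c s (h Y s) (h Z s)) has_derivative
      (\<lambda>k. (D2 k (h Y ?x) + D Z (D Y k)) + (dGam c ?x k (h Y ?x) (h Z ?x) + Gam c ?x (D Y k) (h Z ?x) +
        Gam c ?x (h Y ?x) (D Z k)))) (at ?x)"
      unfolding D2_def
      using has_derivative_frechet_derivative_apply[OF oV xV hsm[OF Z] hD[OF Y], folded D_def]
      by (intro has_derivative_add Gam_param_has_derivative[OF c(1), where x = "\<lambda>s. s"] x has_derivative_ident
        hD Y Z)
    moreover have "frechet_derivative (\<lambda>s. tcoord (nab (Y (cinv c s)) Z) c) (at ?x) =
        frechet_derivative (\<lambda>s. frechet_derivative (h Z) (at s) (h Y s) + Gam c s (h Y s) (h Z s)) (at ?x)"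
      by (rule frechet_derivative_cong_open[OF oV xV]) (rule eq)
    ultimately have "frechet_derivative (\<lambda>s. tcoord (nab (Y (cinv c s)) Z) c) (at ?x) =
      (\<lambda>k. (D2 k (h Y ?x) + D Z (D Y k)) + (dGam c ?x k (h Y ?x) (h Z ?x) + Gam c ?x (D Y k) (h Z ?x) +
        Gam c ?x (h Y ?x) (D Z k)))"
      by (simp only: frechet_derivative_eqI)
    then show ?thesis
      unfolding tcoord_nab[OF U(1) nsm U(2) c(1,2) tsp[OF X]] nabc[OF tsp[OF Y]] hx by simp
  qed
  have br: "lie_bracket M X Y p \<in> tspace M p"
    unfolding nab_torsion[OF U(1) X Y U(2), symmetric]
    by (intro tminus_tspace nab_tspace[OF U(1) _ U(2)] X Y tsp)
  have brc: "tcoord (lie_bracket M X Y p) c = D Y (tcoord (X p) c) - D X (tcoord (Y p) c)"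
    unfolding lie_bracket_def D_def h_def using c by simp
  have lin: "linear (D Z)" by (rule has_derivative_linear[OF hD[OF Z]])
  have mem: "?e \<in> tspace M p"
    by (intro tminus_tspace nab_tspace[OF U(1) nab_smooth[OF U(1)] U(2)] nab_tspace[OF U(1) _ U(2)] X Y Z tsp br)
  show ?thesis
  proof (rule tspace_eqI[OF mem tvec_of_tspace[OF c] c])
    show "tcoord ?e c = tcoord (tvec_of M c p (Riem c ?x (tcoord (X p) c) (tcoord (Y p) c) (tcoord (Z p) c))) c"
      unfolding tcoord_simps tcoord_tvec_of[OF c] second[OF X Y] second[OF Y X] nabc[OF br] brc Riem_def
        D2sym[of "tcoord (Y p) c"]
      by (simp add: Gam_simps[OF c(1) x] linear_diff[OF lin])
  qed
qed

text \<open>Every extension gives the same value, so the value satisfies the defining condition; it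
  is the only one doing so because extensions exist, namely constant coordinate fields.\<close>

lemma curvature_eq:
  assumes c: "c \<in> M" "p \<in> cdom c" and t: "x \<in> tspace M p" "y \<in> tspace M p" "z \<in> tspace M p"
  shows "curvature M nab x y z = tvec_of M c p (Riem c (cmap c p) (tcoord x c) (tcoord y c) (tcoord z c))"
  unfolding curvature_def
proof (rule the_equality)
  have p: "tbase x = p" by (rule tspaceD(1)[OF t(1)])
  show "\<forall>U X Y Z. openin (mtopology M) U \<and> tbase x \<in> U \<and> smooth_vf M U X \<and> smooth_vf M U Y \<and> smooth_vf M U Z \<and>
     X (tbase x) = x \<and> Y (tbase x) = y \<and> Z (tbase x) = z \<longrightarrow>
     tvec_of M c p (Riem c (cmap c p) (tcoord x c) (tcoord y c) (tcoord z c)) =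
     nab x (\<lambda>q. nab (Y q) Z) -\<^sub>T nab y (\<lambda>q. nab (X q) Z) -\<^sub>T nab (lie_bracket M X Y (tbase x)) Z"
    unfolding p using curvature_expression[OF c] by metis
  fix w
  assume w: "\<forall>U X Y Z. openin (mtopology M) U \<and> tbase x \<in> U \<and> smooth_vf M U X \<and> smooth_vf M U Y \<and> smooth_vf M U Z \<and>
     X (tbase x) = x \<and> Y (tbase x) = y \<and> Z (tbase x) = z \<longrightarrow>
     w = nab x (\<lambda>q. nab (Y q) Z) -\<^sub>T nab y (\<lambda>q. nab (X q) Z) -\<^sub>T nab (lie_bracket M X Y (tbase x)) Z"
  \<comment> \<open>The extension by constant coordinates on the chart domain, which pins down any
    candidate \<open>w\<close>.\<close>
  define E where "E v = (\<lambda>q. tvec_of M c q (tcoord v c))" for v :: "('a, 'e) tvec"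
  have E: "smooth_vf M (cdom c) (E v)" for v
    unfolding E_def by (rule smooth_vf_const[OF c(1) openin_cdom[OF c(1)] order_refl])
  have Ep: "E v p = v" if "v \<in> tspace M p" for v unfolding E_def using that c by simp
  note cs = w[THEN spec[of _ "cdom c"], THEN spec[of _ "E x"], THEN spec[of _ "E y"], THEN spec[of _ "E z"],
    THEN mp, unfolded p]
  have "w = nab x (\<lambda>q. nab (E y q) (E z)) -\<^sub>T nab y (\<lambda>q. nab (E x q) (E z)) -\<^sub>T nab (lie_bracket M (E x) (E y) p) (E z)"
    by (rule cs) (intro conjI E Ep t openin_cdom c)
  then show "w = tvec_of M c p (Riem c (cmap c p) (tcoord x c) (tcoord y c) (tcoord z c))"
    using curvature_expression[OF c openin_cdom[OF c(1)] c(2) E E E, of x y z] unfolding Ep[OF t(1)] Ep[OF t(2)] Ep[OF t(3)]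
    by simp
qed

end

section \<open>Christoffel symbols of the tangent bundle\<close>

text \<open>Pointwise data: \<open>g\<close>, \<open>\<Gamma>\<close>, \<open>R\<close> are the metric, the Christoffel symbols and the curvature of \<open>M\<close>, and
  \<open>\<alpha>\<close>, \<open>k\<close> the horizontal and vertical components of the Christoffel symbol of \<open>TM\<close> at the point with fibre
  coordinate \<open>v\<close>, applied to the vectors with components \<open>(F, G)\<close> and \<open>(A, B)\<close>. \<open>T\<close> is the derivative of the
  metric of \<open>TM\<close> in coordinates. Testing with \<open>(z, 0)\<close> and \<open>(0, z)\<close> gives a linear system for \<open>\<alpha>\<close>, \<open>k\<close> with
  determinant \<open>\<Delta>\<close>.\<close>

lemma koszul_solution:
  fixes g :: "'e::euclidean_space \<Rightarrow> 'e \<Rightarrow> real" and \<Gamma> :: "'e \<Rightarrow> 'e \<Rightarrow> 'e" and R P :: "'e \<Rightarrow> 'e \<Rightarrow> 'e \<Rightarrow> 'e"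
  assumes g: "bilinear g" "\<And>v w. g v w = g w v" "\<And>v. v \<noteq> 0 \<Longrightarrow> g v v > 0"
    and \<Gamma>: "\<And>v w. \<Gamma> v w = \<Gamma> w v" "\<And>v. \<Gamma> v 0 = 0"
    and P: "\<And>a \<kappa> a' \<kappa>'. P a \<kappa> a' - P a' \<kappa>' a = R a a' v + \<Gamma> a' \<kappa> - \<Gamma> a \<kappa>'"
    and R: "\<And>a b c d. g (R a b c) d = g (R c d a) b" "\<And>a b c. R a b c + R b c a + R c a b = 0"
      "\<And>a b c. R a b c = - R b a c"
    and \<Delta>: "\<Delta> = m1 * m3 - m2\<^sup>2" "\<Delta> \<noteq> 0"
    and T: "\<And>a \<kappa> a' \<kappa>' a'' \<kappa>''. T a \<kappa> a' \<kappa>' a'' \<kappa>'' = m1 * (g (\<Gamma> a a') a'' + g a' (\<Gamma> a a'')) +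
      m2 * ((g (\<Gamma> a a') \<kappa>'' + g a' (\<Gamma> a \<kappa>'')) + g a' (P a \<kappa> a'') +
        ((g (\<Gamma> a \<kappa>') a'' + g \<kappa>' (\<Gamma> a a'')) + g (P a \<kappa> a') a'')) +
      m3 * ((g (\<Gamma> a \<kappa>') \<kappa>'' + g \<kappa>' (\<Gamma> a \<kappa>'')) + g (P a \<kappa> a') \<kappa>'' + g \<kappa>' (P a \<kappa> a''))"
    and koszul: "\<And>z \<kappa>. 2 * (m1 * g \<alpha> z + m2 * (g \<alpha> \<kappa> + g k z) + m3 * g k \<kappa>) =
      T F G A B z \<kappa> + T A B F G z \<kappa> - T z \<kappa> F G A B"
  shows "\<alpha> = \<Gamma> F A + (1 / \<Delta>) *\<^sub>R ((m2 * m3) *\<^sub>R R v F A + (m2 * m3 / 2) *\<^sub>R R F A v +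
      (m3\<^sup>2 / 2) *\<^sub>R R v B F + (m3\<^sup>2 / 2) *\<^sub>R R v G A)" (is ?thesis1)
    and "k = \<Gamma> F B + P F G A - (1 / \<Delta>) *\<^sub>R (m2\<^sup>2 *\<^sub>R R v F A + (m1 * m3 / 2) *\<^sub>R R F A v +
      (m2 * m3 / 2) *\<^sub>R R v B F + (m2 * m3 / 2) *\<^sub>R R v G A)" (is ?thesis2)
proof -
  have l1: "linear (\<lambda>v. g v w)" and l2: "linear (g w)" for w using g(1) unfolding bilinear_def by blast+
  note gs = linear_add[OF l1] linear_add[OF l2] linear_diff[OF l1] linear_diff[OF l2] linear_scale[OF l1]
    linear_scale[OF l2] linear_0[OF l1] linear_0[OF l2] linear_neg[OF l1] linear_neg[OF l2]
  have eqI: "x = y" if "\<And>z. g x z = g y z" for x y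
  proof (rule ccontr)
    assume "x \<noteq> y"
    then have "g (x - y) (x - y) > 0" by (intro g(3)) simp
    then show False using that[of "x - y"] by (simp add: gs)
  qed
  have \<Gamma>0: "\<Gamma> 0 w = 0" for w using \<Gamma>(1)[of 0 w] \<Gamma>(2) by simp
  \<comment> \<open>In the first two Koszul terms the test vector \<open>z\<close> is the vector
    being differentiated, in the third it is the direction. Exchanging the roles makes the
    non-tensorial terms \<open>P z \<kappa> F\<close> and \<open>P z \<kappa> A\<close> cancel and
    leaves curvature.\<close>
  have Pz: "P F G z = P z \<kappa> F + R F z v + \<Gamma> z G - \<Gamma> F \<kappa>" "P A B z = P z \<kappa> A + R A z v + \<Gamma> z B - \<Gamma> A \<kappa>" for z \<kappa>
    using P[of F G z \<kappa>] P[of A B z \<kappa>] by (simp_all add: algebra_simps)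
  have PA: "P A B F = P F G A - R F A v - \<Gamma> A G + \<Gamma> F B"
    using P[of F G A B] by (simp add: algebra_simps)
  \<comment> \<open>Pair symmetry moves \<open>z\<close> out of the curvature tensor into a slot of
    \<open>g\<close>, as required for removing \<open>z\<close> by nondegeneracy.\<close>
  have Rz: "g (R F z v) y = g (R v y F) z" "g (R A z v) y = g (R v y A) z" for y z using R(1) by blast+
  \<comment> \<open>The Bianchi identity merges the three curvature terms with coefficient m2,
    namely R(v,A)F + R(v,F)A - R(F,A)v, into 2R(v,F)A.\<close>
  have RvA: "R v A F = R v F A + R F A v"
    using R(2)[of v F A] R(3)[of A v F] by (simp add: algebra_simps eq_neg_iff_add_eq_0)
  have e1: "m1 *\<^sub>R \<alpha> + m2 *\<^sub>R k = m1 *\<^sub>R \<Gamma> F A + m2 *\<^sub>R (\<Gamma> F B + P F G A + R v F A) + (m3 / 2) *\<^sub>R (R v B F + R v G A)"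
  proof (rule eqI)
    fix z
    have "2 * (m1 * g \<alpha> z + m2 * g k z) = T F G A B z 0 + T A B F G z 0 - T z 0 F G A B"
      using koszul[of z 0] by (simp add: gs)
    also have "\<dots> = m1 * (2 * g (\<Gamma> F A) z) + m2 * (2 * g (\<Gamma> F B) z + 2 * g (P F G A) z + 2 * g (R v F A) z) +
        m3 * (g (R v B F) z + g (R v G A) z)"
    proof -
      have gP: "g y (P F G z) = g y (P z 0 F) + g y (R F z v) + g y (\<Gamma> z G)"
        "g y (P A B z) = g y (P z 0 A) + g y (R A z v) + g y (\<Gamma> z B)" for y
        by (simp_all add: Pz[of z 0] gs \<Gamma>(2))
      have gR: "g y (R F z v) = g (R v y F) z" "g y (R A z v) = g (R v y A) z" for y
        using Rz g(2) by metis+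
      have gPA: "g (P A B F) z = g (P F G A) z - g (R F A v) z - g (\<Gamma> A G) z + g (\<Gamma> F B) z"
        "g (R v A F) z = g (R v F A) z + g (R F A v) z"
        by (simp_all add: PA RvA gs)
      \<comment> \<open>The facts \<open>1\<close>, \<open>2\<close>, \<open>3\<close> are the
        coefficients of m1, m2, m3. The first is the Koszul identity of \<open>M\<close> itself; the
        third consists of curvature alone.\<close>
      have 1: "g (\<Gamma> F A) z + g A (\<Gamma> F z) + (g (\<Gamma> A F) z + g F (\<Gamma> A z)) - (g (\<Gamma> z F) A + g F (\<Gamma> z A)) = 2 * g (\<Gamma> F A) z"
        unfolding \<Gamma>(1)[of A F] \<Gamma>(1)[of z F] \<Gamma>(1)[of z A] using g(2)[of A "\<Gamma> F z"] by linarith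
      have 2: "g A (P F G z) + ((g (\<Gamma> F B) z + g B (\<Gamma> F z)) + g (P F G A) z) +
          (g F (P A B z) + ((g (\<Gamma> A G) z + g G (\<Gamma> A z)) + g (P A B F) z)) -
          ((g (\<Gamma> z F) B + g F (\<Gamma> z B)) + g F (P z 0 A) + ((g (\<Gamma> z G) A + g G (\<Gamma> z A)) + g (P z 0 F) A)) =
        2 * g (\<Gamma> F B) z + 2 * g (P F G A) z + 2 * g (R v F A) z"
        unfolding \<Gamma>(1)[of z F] \<Gamma>(1)[of z A] gP gR gPA
        using g(2)[of A "P z 0 F"] g(2)[of A "\<Gamma> z G"] g(2)[of B "\<Gamma> F z"] by linarith
      have 3: "g B (P F G z) + g G (P A B z) - ((g (\<Gamma> z G) B + g G (\<Gamma> z B)) + g (P z 0 F) B + g G (P z 0 A)) =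
        g (R v B F) z + g (R v G A) z"
        unfolding gP gR using g(2)[of B "P z 0 F"] g(2)[of B "\<Gamma> z G"] by linarith
      have "T F G A B z 0 + T A B F G z 0 - T z 0 F G A B =
        m1 * (g (\<Gamma> F A) z + g A (\<Gamma> F z) + (g (\<Gamma> A F) z + g F (\<Gamma> A z)) - (g (\<Gamma> z F) A + g F (\<Gamma> z A))) +
        m2 * (g A (P F G z) + ((g (\<Gamma> F B) z + g B (\<Gamma> F z)) + g (P F G A) z) +
          (g F (P A B z) + ((g (\<Gamma> A G) z + g G (\<Gamma> A z)) + g (P A B F) z)) -
          ((g (\<Gamma> z F) B + g F (\<Gamma> z B)) + g F (P z 0 A) + ((g (\<Gamma> z G) A + g G (\<Gamma> z A)) + g (P z 0 F) A))) +
        m3 * (g B (P F G z) + g G (P A B z) - ((g (\<Gamma> z G) B + g G (\<Gamma> z B)) + g (P z 0 F) B + g G (P z 0 A)))"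
        unfolding T \<Gamma>(2) linear_0[OF l1] linear_0[OF l2] by (simp add: algebra_simps)
      then show ?thesis unfolding 1 2 3 .
    qed
    finally show "g (m1 *\<^sub>R \<alpha> + m2 *\<^sub>R k) z = g (m1 *\<^sub>R \<Gamma> F A + m2 *\<^sub>R (\<Gamma> F B + P F G A + R v F A) +
        (m3 / 2) *\<^sub>R (R v B F + R v G A)) z"
      by (simp add: gs algebra_simps)
  qed
  have e2: "m2 *\<^sub>R \<alpha> + m3 *\<^sub>R k = m2 *\<^sub>R \<Gamma> F A + m3 *\<^sub>R (\<Gamma> F B + P F G A) - (m3 / 2) *\<^sub>R R F A v"
  proof (rule eqI)
    fix z
    \<comment> \<open>The test vector is now vertical, so the curvature terms that contain its
      horizontal component vanish.\<close>
    have R0: "g y (R F 0 v) = 0" "g y (R A 0 v) = 0" for y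
      using Rz[of 0 y] g(2)[of y] linear_0[OF l2] by metis+
    have gP: "g y (P F G 0) = g y (P 0 z F) - g y (\<Gamma> F z)" "g y (P A B 0) = g y (P 0 z A) - g y (\<Gamma> A z)" for y
      using Pz[of 0 z] by (simp_all add: \<Gamma>0 gs R0)
    have gPA: "g (P A B F) z = g (P F G A) z - g (R F A v) z - g (\<Gamma> A G) z + g (\<Gamma> F B) z"
      by (simp add: PA gs)
    have "2 * (m2 * g \<alpha> z + m3 * g k z) = T F G A B 0 z + T A B F G 0 z - T 0 z F G A B"
      using koszul[of 0 z] by (simp add: gs)
    also have "\<dots> = m2 * (2 * g (\<Gamma> F A) z) + m3 * (2 * g (\<Gamma> F B) z + 2 * g (P F G A) z - g (R F A v) z)"
    proof -
      have 1: "g (\<Gamma> F A) z + g A (\<Gamma> F z) + g A (P F G 0) + (g (\<Gamma> A F) z + g F (\<Gamma> A z) + g F (P A B 0)) -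
          (g F (P 0 z A) + g (P 0 z F) A) = 2 * g (\<Gamma> F A) z"
        unfolding \<Gamma>(1)[of A F] gP using g(2)[of A "P 0 z F"] by linarith
      have 2: "g (\<Gamma> F B) z + g B (\<Gamma> F z) + g (P F G A) z + g B (P F G 0) +
          (g (\<Gamma> A G) z + g G (\<Gamma> A z) + g (P A B F) z + g G (P A B 0)) - (g (P 0 z F) B + g G (P 0 z A)) =
        2 * g (\<Gamma> F B) z + 2 * g (P F G A) z - g (R F A v) z"
        unfolding gP gPA using g(2)[of B "P 0 z F"] by linarith
      have "T F G A B 0 z + T A B F G 0 z - T 0 z F G A B =
        m2 * (g (\<Gamma> F A) z + g A (\<Gamma> F z) + g A (P F G 0) + (g (\<Gamma> A F) z + g F (\<Gamma> A z) + g F (P A B 0)) -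
          (g F (P 0 z A) + g (P 0 z F) A)) +
        m3 * (g (\<Gamma> F B) z + g B (\<Gamma> F z) + g (P F G A) z + g B (P F G 0) +
          (g (\<Gamma> A G) z + g G (\<Gamma> A z) + g (P A B F) z + g G (P A B 0)) - (g (P 0 z F) B + g G (P 0 z A)))"
        unfolding T \<Gamma>(2) \<Gamma>0 linear_0[OF l1] linear_0[OF l2] by (simp add: algebra_simps)
      then show ?thesis unfolding 1 2 .
    qed
    finally show "g (m2 *\<^sub>R \<alpha> + m3 *\<^sub>R k) z = g (m2 *\<^sub>R \<Gamma> F A + m3 *\<^sub>R (\<Gamma> F B + P F G A) - (m3 / 2) *\<^sub>R R F A v) z"
      by (simp add: gs algebra_simps)
  qed
  have "\<Delta> *\<^sub>R \<alpha> = m3 *\<^sub>R (m1 *\<^sub>R \<alpha> + m2 *\<^sub>R k) - m2 *\<^sub>R (m2 *\<^sub>R \<alpha> + m3 *\<^sub>R k)"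
    unfolding \<Delta>(1) by (simp add: algebra_simps power2_eq_square)
  also have "\<dots> = \<Delta> *\<^sub>R \<Gamma> F A + ((m2 * m3) *\<^sub>R R v F A + (m2 * m3 / 2) *\<^sub>R R F A v +
      (m3\<^sup>2 / 2) *\<^sub>R R v B F + (m3\<^sup>2 / 2) *\<^sub>R R v G A)"
    unfolding e1 e2 \<Delta>(1) by (simp add: algebra_simps power2_eq_square)
  finally have "(1 / \<Delta>) *\<^sub>R (\<Delta> *\<^sub>R \<alpha>) = (1 / \<Delta>) *\<^sub>R (\<Delta> *\<^sub>R \<Gamma> F A + ((m2 * m3) *\<^sub>R R v F A + (m2 * m3 / 2) *\<^sub>R R F A v +
      (m3\<^sup>2 / 2) *\<^sub>R R v B F + (m3\<^sup>2 / 2) *\<^sub>R R v G A))" by simp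
  then show ?thesis1 unfolding scaleR_add_right[of "1 / \<Delta>" "\<Delta> *\<^sub>R _"] using \<Delta>(2) by simp
  have "\<Delta> *\<^sub>R k = m1 *\<^sub>R (m2 *\<^sub>R \<alpha> + m3 *\<^sub>R k) - m2 *\<^sub>R (m1 *\<^sub>R \<alpha> + m2 *\<^sub>R k)"
    unfolding \<Delta>(1) by (simp add: algebra_simps power2_eq_square)
  also have "\<dots> = \<Delta> *\<^sub>R (\<Gamma> F B + P F G A) - (m2\<^sup>2 *\<^sub>R R v F A + (m1 * m3 / 2) *\<^sub>R R F A v +
      (m2 * m3 / 2) *\<^sub>R R v B F + (m2 * m3 / 2) *\<^sub>R R v G A)"
    unfolding e1 e2 \<Delta>(1) by (simp add: algebra_simps power2_eq_square)
  finally have "(1 / \<Delta>) *\<^sub>R (\<Delta> *\<^sub>R k) = (1 / \<Delta>) *\<^sub>R (\<Delta> *\<^sub>R (\<Gamma> F B + P F G A) - (m2\<^sup>2 *\<^sub>R R v F A + (m1 * m3 / 2) *\<^sub>R R F A v +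
      (m2 * m3 / 2) *\<^sub>R R v B F + (m2 * m3 / 2) *\<^sub>R R v G A))" by simp
  then show ?thesis2 unfolding scaleR_diff_right[of "1 / \<Delta>" "\<Delta> *\<^sub>R _"] using \<Delta>(2) by simp
qed

section \<open>The metric of the tangent bundle and its Christoffel symbols\<close>

locale tangent_metric =
  levi_civita_atlas M nab g + connection_map_atlas M nab K + T: levi_civita_atlas "TM M" nabbar gbar
  for M :: "('a, 'e::euclidean_space) atlas" and nab g K nabbar gbar +
  fixes m1 m2 m3 :: real
  assumes gbar_lift: "\<And>w X Y. w \<in> points (TM M) \<Longrightarrow> X \<in> tspace M (tbase w) \<Longrightarrow> Y \<in> tspace M (tbase w) \<Longrightarrow>
           gbar (hlift M K w X) (hlift M K w Y) = m1 * g X Y \<and>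
           gbar (hlift M K w X) (vlift M K w Y) = m2 * g X Y \<and>
           gbar (vlift M K w X) (vlift M K w Y) = m3 * g X Y"
begin

text \<open>\<open>Kc c x v\<close> is the connection map at the point with coordinates \<open>(x, v)\<close>, and \<open>dKc c x v a \<kappa> a'\<close> the
  derivative of \<open>\<lambda>(x, v). Kc c x v (a', b')\<close> in the direction \<open>(a, b)\<close> with \<open>Kc c x v (a, b) = \<kappa>\<close>; it does not
  depend on \<open>b'\<close>.\<close>

definition Kc :: "('a, 'e) chart \<Rightarrow> 'e \<Rightarrow> 'e \<Rightarrow> 'e \<times> 'e \<Rightarrow> 'e" where
  "Kc c x v z = snd z + Gam c x (fst z) v"

definition dKc :: "('a, 'e) chart \<Rightarrow> 'e \<Rightarrow> 'e \<Rightarrow> 'e \<Rightarrow> 'e \<Rightarrow> 'e \<Rightarrow> 'e" where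
  "dKc c x v a \<kappa> a' = dGam c x a a' v + Gam c x a' (\<kappa> - Gam c x a v)"

lemma lift_eq:
  assumes c: "c \<in> M" "tbase w \<in> cdom c" and w: "w \<in> tspace M (tbase w)" and X: "X \<in> tspace M (tbase w)"
  shows "hlift M K w X = tvec_of (TM M) (tchart M c) w (tcoord X c, - Gam c (cmap c (tbase w)) (tcoord X c) (tcoord w c))"
    and "vlift M K w X = tvec_of (TM M) (tchart M c) w (0, tcoord X c)"
proof -
  have x: "cmap c (tbase w) \<in> cmap c ` cdom c" using c by blast
  show "hlift M K w X = tvec_of (TM M) (tchart M c) w (tcoord X c, - Gam c (cmap c (tbase w)) (tcoord X c) (tcoord w c))"
    "vlift M K w X = tvec_of (TM M) (tchart M c) w (0, tcoord X c)"
    unfolding hlift_def vlift_def tvec_with_eq[OF c w X tzero_tspace] tvec_with_eq[OF c w tzero_tspace X]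
    by (simp_all add: Gam_simps[OF c(1) x])
qed

text \<open>Every vector is the horizontal lift of its projection plus the vertical lift of its
  K-component; bilinearity reduces the metric to the three prescribed values on lifts.\<close>

lemma Gm_TM:
  assumes c: "c \<in> M" and x: "x \<in> cmap c ` cdom c"
  shows "T.Gm (tchart M c) (x, v) z z' = m1 * Gm c x (fst z) (fst z') +
    m2 * (Gm c x (fst z) (Kc c x v z') + Gm c x (Kc c x v z) (fst z')) + m3 * Gm c x (Kc c x v z) (Kc c x v z')"
proof -
  obtain p where p: "p \<in> cdom c" "x = cmap c p" using x by blast
  define w where "w = tvec_of M c p v"
  have w: "tbase w = p" "w \<in> tspace M (tbase w)" "tcoord w c = v" using c p by (auto simp: w_def)
  have cw: "tbase w \<in> cdom c" using w p by simp
  note tc = tchart_TM[OF c]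
  have wc: "w \<in> cdom (tchart M c)" using cw w by (simp add: cdom_tchart)
  have wP: "w \<in> points (TM M)" using wc tc unfolding points_def by blast
  define h where "h z = tvec_of M c p (fst z)" for z :: "'e \<times> 'e"
  define k where "k z = tvec_of M c p (Kc c x v z)" for z
  have hk: "h z \<in> tspace M (tbase w)" "k z \<in> tspace M (tbase w)" "tcoord (h z) c = fst z" "tcoord (k z) c = Kc c x v z" for z
    unfolding h_def k_def using c p w by auto
  have H: "hlift M K w (h z) \<in> tspace (TM M) w" "vlift M K w (k z) \<in> tspace (TM M) w" for z
    using lift_eq[OF c cw w(2) hk(1)] lift_eq[OF c cw w(2) hk(2)] tc wc by auto
  have split: "tvec_of (TM M) (tchart M c) w z = hlift M K w (h z) +\<^sub>T vlift M K w (k z)" for z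
    by (rule T.tspace_eqI[OF _ _ tc wc])
      (use H tc wc hk lift_eq[OF c cw w(2) hk(1)] lift_eq[OF c cw w(2) hk(2)] w p in
        \<open>auto simp: Kc_def prod_eq_iff\<close>)
  have add2: "gbar X (Y +\<^sub>T Z) = gbar X Y + gbar X Z"
    if "X \<in> tspace (TM M) w" "Y \<in> tspace (TM M) w" "Z \<in> tspace (TM M) w" for X Y Z
    using T.g_add[OF wP that(2,3,1)] T.g_sym[OF wP] that by simp
  \<comment> \<open>The value on a vertical and a horizontal lift is prescribed only in the opposite
    order, so symmetry of both metrics is used.\<close>
  have vh: "gbar (vlift M K w (k z)) (hlift M K w (h z')) = m2 * g (k z) (h z')" for z z'
  proof -
    have P: "p \<in> points M" using p c unfolding points_def by blast
    show ?thesis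
      using T.g_sym[OF wP H(2) H(1), of z z'] gbar_lift[OF wP hk(1)[of z'] hk(2)[of z]] g_sym[OF P, of "h z'" "k z"] hk w
      by simp
  qed
  have gG: "g X Y = Gm c x (tcoord X c) (tcoord Y c)" if "X \<in> tspace M (tbase w)" "Y \<in> tspace M (tbase w)" for X Y
    using g_eq_Gm[OF c p(1)] that w p by simp
  have "T.Gm (tchart M c) (x, v) z z' = gbar (tvec_of (TM M) (tchart M c) w z) (tvec_of (TM M) (tchart M c) w z')"
    unfolding T.Gm_def cinv_tchart[OF c x] w_def using p c by simp
  also have "\<dots> = (gbar (hlift M K w (h z)) (hlift M K w (h z')) + gbar (hlift M K w (h z)) (vlift M K w (k z'))) +
      (gbar (vlift M K w (k z)) (hlift M K w (h z')) + gbar (vlift M K w (k z)) (vlift M K w (k z')))"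
    unfolding split using H by (simp add: T.g_add[OF wP] add2)
  also have "\<dots> = (m1 * g (h z) (h z') + m2 * g (h z) (k z')) + (m2 * g (k z) (h z') + m3 * g (k z) (k z'))"
    using gbar_lift[OF wP hk(1)[of z] hk(1)[of z']] gbar_lift[OF wP hk(1)[of z] hk(2)[of z']]
      gbar_lift[OF wP hk(2)[of z] hk(2)[of z']] vh by simp
  also have "\<dots> = m1 * Gm c x (fst z) (fst z') +
    m2 * (Gm c x (fst z) (Kc c x v z') + Gm c x (Kc c x v z) (fst z')) + m3 * Gm c x (Kc c x v z) (Kc c x v z')"
    by (simp add: gG hk algebra_simps)
  finally show ?thesis .
qed

lemma mem_image_tchart: "c \<in> M \<Longrightarrow> x \<in> cmap c ` cdom c \<Longrightarrow> (x, v) \<in> cmap (tchart M c) ` cdom (tchart M c)"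
  using image_tchart_overlap[of c c] by simp

lemma Kc_has_derivative:
  assumes c: "c \<in> M" and x: "x \<in> cmap c ` cdom c"
  shows "((\<lambda>y. Kc c (fst y) (snd y) z) has_derivative (\<lambda>h. dKc c x v (fst h) (Kc c x v h) (fst z))) (at (x, v))"
proof -
  have "((\<lambda>y. snd z + Gam c (fst y) (fst z) (snd y)) has_derivative
      (\<lambda>h. 0 + (dGam c (fst (x, v)) (fst h) (fst z) (snd (x, v)) + Gam c (fst (x, v)) 0 (snd (x, v)) +
        Gam c (fst (x, v)) (fst z) (snd h)))) (at (x, v))"
    by (intro has_derivative_add has_derivative_const Gam_param_has_derivative[OF c]
      has_derivative_fst has_derivative_snd has_derivative_ident) (use x in simp)
  then show ?thesis by (simp add: Kc_def dKc_def Gam_simps[OF c x])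
qed

text \<open>The metric coefficients of \<open>TM M\<close> are differentiated twice over: once by
  compatibility with \<open>nabbar\<close>, once from their explicit formula. Uniqueness of the
  derivative equates the results and constrains the unknown Christoffel symbols of
  \<open>TM M\<close>.\<close>

lemma Gm_TM_compat:
  assumes c: "c \<in> M" and x: "x \<in> cmap c ` cdom c"
  shows "T.Gm (tchart M c) (x, v) (T.Gam (tchart M c) (x, v) h z) z' + T.Gm (tchart M c) (x, v) z (T.Gam (tchart M c) (x, v) h z') =
    m1 * (Gm c x (Gam c x (fst h) (fst z)) (fst z') + Gm c x (fst z) (Gam c x (fst h) (fst z'))) +
    m2 * ((Gm c x (Gam c x (fst h) (fst z)) (Kc c x v z') + Gm c x (fst z) (Gam c x (fst h) (Kc c x v z'))) +
        Gm c x (fst z) (dKc c x v (fst h) (Kc c x v h) (fst z')) +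
      ((Gm c x (Gam c x (fst h) (Kc c x v z)) (fst z') + Gm c x (Kc c x v z) (Gam c x (fst h) (fst z'))) +
        Gm c x (dKc c x v (fst h) (Kc c x v h) (fst z)) (fst z'))) +
    m3 * ((Gm c x (Gam c x (fst h) (Kc c x v z)) (Kc c x v z') + Gm c x (Kc c x v z) (Gam c x (fst h) (Kc c x v z'))) +
      Gm c x (dKc c x v (fst h) (Kc c x v h) (fst z)) (Kc c x v z') +
      Gm c x (Kc c x v z) (dKc c x v (fst h) (Kc c x v h) (fst z')))"
    (is "_ = ?D h")
proof -
  let ?O = "(cmap c ` cdom c) \<times> (UNIV :: 'e set)"
  have O: "open ?O" using open_cmap_cdom[OF c] by (simp add: open_Times)
  have xv: "(x, v) \<in> ?O" using x by simp
  have x': "fst (x, v) \<in> cmap c ` cdom c" using x by simp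
  note F = has_derivative_fst[OF has_derivative_ident]
  note C = has_derivative_const
  note KD = Kc_has_derivative[OF c x]
  note GD = Gm_param_has_derivative[OF c, of fst "(x, v)", OF x' F]
  have "((\<lambda>y. m1 * Gm c (fst y) (fst z) (fst z') +
    m2 * (Gm c (fst y) (fst z) (Kc c (fst y) (snd y) z') + Gm c (fst y) (Kc c (fst y) (snd y) z) (fst z')) +
    m3 * Gm c (fst y) (Kc c (fst y) (snd y) z) (Kc c (fst y) (snd y) z')) has_derivative ?D) (at (x, v))"
    using has_derivative_add[OF has_derivative_add[OF has_derivative_mult_right[OF GD[OF C C], of m1]
      has_derivative_mult_right[OF has_derivative_add[OF GD[OF C KD] GD[OF KD C]], of m2]]
      has_derivative_mult_right[OF GD[OF KD KD], of m3], of "fst z" "fst z'" "fst z" z' z "fst z'" z z']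
    by (simp add: Gm_simps[OF c x])
  then have "((\<lambda>y. T.Gm (tchart M c) y z z') has_derivative ?D) (at (x, v))"
  proof (rule has_derivative_transform_within_open[OF _ O xv])
    fix y assume "y \<in> ?O"
    then have "fst y \<in> cmap c ` cdom c" by auto
    from Gm_TM[OF c this, of "snd y" z z']
    show "m1 * Gm c (fst y) (fst z) (fst z') +
      m2 * (Gm c (fst y) (fst z) (Kc c (fst y) (snd y) z') + Gm c (fst y) (Kc c (fst y) (snd y) z) (fst z')) +
      m3 * Gm c (fst y) (Kc c (fst y) (snd y) z) (Kc c (fst y) (snd y) z') = T.Gm (tchart M c) y z z'" by simp
  qed
  from has_derivative_unique[OF T.Gm_compat[OF tchart_TM[OF c] mem_image_tchart[OF c x]] this]
  show ?thesis by (rule fun_cong)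
qed

text \<open>The derivatives of \<Gamma> occur skew-symmetrically on the left, and with the quadratic
  terms in \<Gamma> they form the curvature: it measures how far the horizontal distribution is from
  integrable.\<close>

lemma dKc_commute:
  assumes "c \<in> M" "x \<in> cmap c ` cdom c"
  shows "dKc c x v a \<kappa> a' - dKc c x v a' \<kappa>' a = Riem c x a a' v + Gam c x a' \<kappa> - Gam c x a \<kappa>'"
  by (simp add: dKc_def Riem_def Gam_simps[OF assms])

lemma Gam_TM:
  assumes c: "c \<in> M" and x: "x \<in> cmap c ` cdom c" and \<Delta>: "\<Delta> = m1 * m3 - m2\<^sup>2" "\<Delta> \<noteq> 0"
  shows "fst (T.Gam (tchart M c) (x, v) X Y) = Gam c x (fst X) (fst Y) + (1 / \<Delta>) *\<^sub>R
      ((m2 * m3) *\<^sub>R Riem c x v (fst X) (fst Y) + (m2 * m3 / 2) *\<^sub>R Riem c x (fst X) (fst Y) v +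
      (m3\<^sup>2 / 2) *\<^sub>R Riem c x v (Kc c x v Y) (fst X) + (m3\<^sup>2 / 2) *\<^sub>R Riem c x v (Kc c x v X) (fst Y))"
    and "Kc c x v (T.Gam (tchart M c) (x, v) X Y) = Gam c x (fst X) (Kc c x v Y) + dKc c x v (fst X) (Kc c x v X) (fst Y) -
      (1 / \<Delta>) *\<^sub>R (m2\<^sup>2 *\<^sub>R Riem c x v (fst X) (fst Y) + (m1 * m3 / 2) *\<^sub>R Riem c x (fst X) (fst Y) v +
      (m2 * m3 / 2) *\<^sub>R Riem c x v (Kc c x v Y) (fst X) + (m2 * m3 / 2) *\<^sub>R Riem c x v (Kc c x v X) (fst Y))"
proof -
  note tc = tchart_TM[OF c] and xv = mem_image_tchart[OF c x, of v]
  define T where "T a \<kappa> a' \<kappa>' a'' \<kappa>'' =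
    m1 * (Gm c x (Gam c x a a') a'' + Gm c x a' (Gam c x a a'')) +
    m2 * ((Gm c x (Gam c x a a') \<kappa>'' + Gm c x a' (Gam c x a \<kappa>'')) + Gm c x a' (dKc c x v a \<kappa> a'') +
      ((Gm c x (Gam c x a \<kappa>') a'' + Gm c x \<kappa>' (Gam c x a a'')) + Gm c x (dKc c x v a \<kappa> a') a'')) +
    m3 * ((Gm c x (Gam c x a \<kappa>') \<kappa>'' + Gm c x \<kappa>' (Gam c x a \<kappa>'')) + Gm c x (dKc c x v a \<kappa> a') \<kappa>'' +
      Gm c x \<kappa>' (dKc c x v a \<kappa> a''))" for a \<kappa> a' \<kappa>' a'' \<kappa>''
  have compat: "T.Gm (tchart M c) (x, v) (T.Gam (tchart M c) (x, v) h z) z' +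
      T.Gm (tchart M c) (x, v) z (T.Gam (tchart M c) (x, v) h z') =
    T (fst h) (Kc c x v h) (fst z) (Kc c x v z) (fst z') (Kc c x v z')" for h z z'
    unfolding T_def by (rule Gm_TM_compat[OF c x])
  have kos: "2 * (m1 * Gm c x (fst (T.Gam (tchart M c) (x, v) X Y)) a +
      m2 * (Gm c x (fst (T.Gam (tchart M c) (x, v) X Y)) \<kappa> + Gm c x (Kc c x v (T.Gam (tchart M c) (x, v) X Y)) a) +
      m3 * Gm c x (Kc c x v (T.Gam (tchart M c) (x, v) X Y)) \<kappa>) =
    T (fst X) (Kc c x v X) (fst Y) (Kc c x v Y) a \<kappa> + T (fst Y) (Kc c x v Y) (fst X) (Kc c x v X) a \<kappa> -
    T a \<kappa> (fst X) (Kc c x v X) (fst Y) (Kc c x v Y)" for a \<kappa>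
  proof -
    \<comment> \<open>The vector with horizontal component \<open>a\<close> and K-component
      \<kappa>; since every pair is attained, the test components may be chosen freely.\<close>
    define Z where "Z = (a, \<kappa> - Gam c x a v)"
    have Z: "fst Z = a" "Kc c x v Z = \<kappa>" unfolding Z_def Kc_def by simp_all
    have "2 * T.Gm (tchart M c) (x, v) (T.Gam (tchart M c) (x, v) X Y) Z =
      T (fst X) (Kc c x v X) (fst Y) (Kc c x v Y) a \<kappa> + T (fst Y) (Kc c x v Y) (fst X) (Kc c x v X) a \<kappa> -
      T a \<kappa> (fst X) (Kc c x v X) (fst Y) (Kc c x v Y)"
      \<comment> \<open>The Koszul combination: first plus second minus third compatibility
        identity; by symmetry of the Christoffel symbols of \<open>TM M\<close> only twice the
        wanted term survives.\<close>
      using compat[of X Y Z] compat[of Y X Z] compat[of Z X Y]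
        T.Gam_sym[OF tc xv, of X Y] T.Gam_sym[OF tc xv, of X Z] T.Gam_sym[OF tc xv, of Y Z]
        T.Gm_sym[OF tc xv, of "T.Gam (tchart M c) (x, v) Z X" Y]
      unfolding Z by simp
    then show ?thesis unfolding Gm_TM[OF c x] Z by simp
  qed
  have G0: "Gam c x w 0 = 0" for w by (rule linear_0[OF linear_Gam2[OF c x]])
  note sol = koszul_solution[where g = "Gm c x" and \<Gamma> = "Gam c x" and R = "Riem c x" and P = "dKc c x v" and T = T,
    OF bilinear_Gm[OF c x] Gm_sym[OF c x] Gm_pos[OF c x] Gam_sym[OF c x] G0 dKc_commute[OF c x] Riem_pair[OF c x]
    Riem_bianchi[OF c x] Riem_skew \<Delta> T_def kos]
  show "fst (T.Gam (tchart M c) (x, v) X Y) = Gam c x (fst X) (fst Y) + (1 / \<Delta>) *\<^sub>R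
      ((m2 * m3) *\<^sub>R Riem c x v (fst X) (fst Y) + (m2 * m3 / 2) *\<^sub>R Riem c x (fst X) (fst Y) v +
      (m3\<^sup>2 / 2) *\<^sub>R Riem c x v (Kc c x v Y) (fst X) + (m3\<^sup>2 / 2) *\<^sub>R Riem c x v (Kc c x v X) (fst Y))"
    by (rule sol(1))
  show "Kc c x v (T.Gam (tchart M c) (x, v) X Y) = Gam c x (fst X) (Kc c x v Y) + dKc c x v (fst X) (Kc c x v X) (fst Y) -
      (1 / \<Delta>) *\<^sub>R (m2\<^sup>2 *\<^sub>R Riem c x v (fst X) (fst Y) + (m1 * m3 / 2) *\<^sub>R Riem c x (fst X) (fst Y) v +
      (m2 * m3 / 2) *\<^sub>R Riem c x v (Kc c x v Y) (fst X) + (m2 * m3 / 2) *\<^sub>R Riem c x v (Kc c x v X) (fst Y))"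
    by (rule sol(2))
qed

end

section \<open>Horizontal curves and fibre derivatives\<close>

context atlas begin

lemma
  assumes c: "c \<in> M" and I: "open I" and z: "smooth_on I z" "z ` I \<subseteq> cmap c ` cdom c"
  shows smooth_curve_chart: "smooth_curve M I (\<lambda>t. cinv c (z t))"
    and velocity_chart: "t \<in> I \<Longrightarrow> velocity M (\<lambda>t. cinv c (z t)) t = tvec_of M c (cinv c (z t)) (vector_derivative z (at t))"
proof -
  have m: "cinv c (z t) \<in> cdom c" "cmap c (cinv c (z t)) = z t" if "t \<in> I" for t
    using cinv_mem[OF c, of "z t" "cdom c"] cmap_cinv[of "z t" c "cdom c"] z(2) that by auto
  show "smooth_curve M I (\<lambda>t. cinv c (z t))"
    unfolding smooth_curve_def
  proof (intro conjI ballI)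
    show "(\<lambda>t. cinv c (z t)) ` I \<subseteq> points M" using m(1) c unfolding points_def by blast
    fix d assume d: "d \<in> M"
    let ?O = "cmap c ` (cdom c \<inter> cdom d)"
    have eq: "{t \<in> I. cinv c (z t) \<in> cdom d} = I \<inter> z -` ?O"
    proof (intro equalityI subsetI)
      fix t assume "t \<in> {t \<in> I. cinv c (z t) \<in> cdom d}"
      then show "t \<in> I \<inter> z -` ?O" using m[of t] imageI[of "cinv c (z t)" "cdom c \<inter> cdom d" "cmap c"] by simp
    next
      fix t assume t: "t \<in> I \<inter> z -` ?O"
      then obtain q where "q \<in> cdom c" "q \<in> cdom d" "z t = cmap c q" by blast
      then show "t \<in> {t \<in> I. cinv c (z t) \<in> cdom d}" using t c by simp
    qed
    show o: "open {t \<in> I. cinv c (z t) \<in> cdom d}"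
      unfolding eq
      by (rule continuous_open_preimage[OF smooth_on_imp_continuous_on[OF z(1)] I open_overlap[OF c d]])
    have "smooth_on {t \<in> I. cinv c (z t) \<in> cdom d} (\<lambda>t. (cmap d \<circ> cinv c) (z t))"
      by (rule smooth_on_compose[OF o open_overlap[OF c d] smooth_transition[OF c d] smooth_on_subset[OF z(1)]])
        (auto simp: eq)
    then show "smooth_on {t \<in> I. cinv c (z t) \<in> cdom d} (cmap d \<circ> (\<lambda>t. cinv c (z t)))"
      by (simp add: comp_def)
  qed
  assume t: "t \<in> I"
  have zD: "(z has_derivative (\<lambda>k. k *\<^sub>R vector_derivative z (at t))) (at t)"
    using vector_derivative_works[of z "at t"] smooth_on_imp_differentiable[OF z(1) t]
    unfolding has_vector_derivative_def by blast
  show "velocity M (\<lambda>t. cinv c (z t)) t = tvec_of M c (cinv c (z t)) (vector_derivative z (at t))"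
  proof -
    have "vector_derivative (cmap d \<circ> (\<lambda>t. cinv c (z t))) (at t) =
        frechet_derivative (cmap d \<circ> cinv c) (at (cmap c (cinv c (z t)))) (vector_derivative z (at t))"
      if d: "d \<in> M" "cinv c (z t) \<in> cdom d" for d
    proof -
      let ?D = "frechet_derivative (cmap d \<circ> cinv c) (at (cmap c (cinv c (z t))))"
      have "((cmap d \<circ> cinv c) has_derivative ?D) (at (z t))"
        using transition_has_derivative[OF c d(1) m(1)[OF t] d(2)] unfolding m(2)[OF t] .
      from has_derivative_compose[OF zD this]
      have "((\<lambda>t. (cmap d \<circ> cinv c) (z t)) has_vector_derivative ?D (vector_derivative z (at t))) (at t)"
        unfolding has_vector_derivative_def
        by (simp only: linear_scale[OF linear_transition_derivative[OF c d(1) m(1)[OF t] d(2)]])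
      then show ?thesis using vector_derivative_at by (fastforce simp: comp_def)
    qed
    then show ?thesis unfolding velocity_def tvec_of_def by auto
  qed
qed

text \<open>The base point is fixed, so coordinates in different charts are related by one fixed
  linear map, which commutes with differentiation in \<open>t\<close>.\<close>

lemma fibre_deriv_eq:
  assumes c: "c \<in> M" "p \<in> cdom c" and I: "open I" "0 \<in> I" and \<gamma>: "\<And>t. t \<in> I \<Longrightarrow> \<gamma> t \<in> tspace M p"
    and D: "((\<lambda>t. tcoord (\<gamma> t) c) has_vector_derivative y) (at 0)"
  shows "fibre_deriv M p \<gamma> = tvec_of M c p y"
proof -
  have "vector_derivative (\<lambda>t. tcoord (\<gamma> t) d) (at 0) = frechet_derivative (cmap d \<circ> cinv c) (at (cmap c p)) y"
    if d: "d \<in> M" "p \<in> cdom d" for d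
  proof -
    let ?D = "frechet_derivative (cmap d \<circ> cinv c) (at (cmap c p))"
    have "bounded_linear ?D"
      by (rule linear_conv_bounded_linear[THEN iffD1, OF linear_transition_derivative[OF c(1) d(1) c(2) d(2)]])
    from bounded_linear.has_vector_derivative[OF this D]
    have "((\<lambda>t. ?D (tcoord (\<gamma> t) c)) has_vector_derivative ?D y) (at 0)" .
    then have "((\<lambda>t. tcoord (\<gamma> t) d) has_vector_derivative ?D y) (at 0)"
      by (rule has_vector_derivative_transform_within_open[OF _ I])
        (rule tspaceD(2)[OF \<gamma> c(1) d(1) c(2) d(2), symmetric])
    then show ?thesis by (rule vector_derivative_at)
  qed
  then show ?thesis unfolding fibre_deriv_def tvec_of_def by auto
qed

end

context connection_map_atlas begin

text \<open>A curve over the coordinate line \<open>x + t a\<close> is horizontal iff its fibre coordinate \<open>y\<close> solves the linear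
  equation \<open>y' = - \<Gamma>(a, y)\<close>.\<close>

lemma horizontal_curve_exists:
  assumes c: "c \<in> M" "tbase u \<in> cdom c" and u: "u \<in> tspace M (tbase u)"
    and W: "openin (mtopology (TM M)) W" "u \<in> W"
  obtains \<delta> z where "\<delta> > 0" "z 0 = cmap (tchart M c) u"
    "(z has_vector_derivative (a, - Gam c (cmap c (tbase u)) a (tcoord u c))) (at 0)"
    "z ` {-\<delta><..<\<delta>} \<subseteq> cmap (tchart M c) ` (W \<inter> cdom (tchart M c))"
    "horizontal_curve M K {-\<delta><..<\<delta>} (\<lambda>t. cinv (tchart M c) (z t))"
proof -
  interpret T: atlas "TM M" by (rule atlas_TM)
  note tc = tchart_TM[OF c(1)]
  let ?x = "cmap c (tbase u)" and ?S = "cmap c ` cdom c"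
  let ?O = "cmap (tchart M c) ` (W \<inter> cdom (tchart M c))"
  have uc: "u \<in> cdom (tchart M c)" using c u by (simp add: cdom_tchart)
  have oS: "open ?S" by (rule open_cmap_cdom[OF c(1)])
  have oO: "open ?O" by (rule T.open_chart_image[OF W(1) tc])
  have "continuous_on UNIV (\<lambda>t. ?x + t *\<^sub>R a)" by (intro continuous_intros)
  then have "open ((\<lambda>t::real. ?x + t *\<^sub>R a) -` ?S)" by (intro open_vimage oS) auto
  moreover have "0 \<in> (\<lambda>t::real. ?x + t *\<^sub>R a) -` ?S" using c by simp
  ultimately obtain r where r: "r > 0" "ball 0 r \<subseteq> (\<lambda>t::real. ?x + t *\<^sub>R a) -` ?S"
    by (meson open_contains_ball)
  have inS: "?x + t *\<^sub>R a \<in> ?S" if "t \<in> {-r<..<r}" for t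
    using r(2) that by (auto simp: subset_iff dist_real_def abs_less_iff)
  have smx: "smooth_on J (\<lambda>t::real. ?x + t *\<^sub>R a)" if "open J" for J
    by (intro smooth_on_add that smooth_on_const smooth_on_bounded_linear bounded_linear_scaleR_left)
  define A where "A t b = - Gam c (?x + t *\<^sub>R a) a b" for t b
  have Alin: "linear (A t)" if "t \<in> {-r<..<r}" for t
  proof -
    have l: "linear (Gam c (?x + t *\<^sub>R a) a)"
      using bilinear_Gam[OF c(1) inS[OF that]] unfolding bilinear_def by blast
    show ?thesis by (rule linearI) (simp_all add: A_def linear_add[OF l] linear_scale[OF l])
  qed
  have Asm: "smooth_on {-r<..<r} (\<lambda>t. A t b)" for b
  proof -
    have "smooth_on {-r<..<r} (\<lambda>t. Gam c (?x + t *\<^sub>R a) a b)"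
      by (rule smooth_on_compose[OF _ oS smooth_Gam[OF c(1)] smx]) (use inS in auto)
    from smooth_on_diff[OF _ smooth_on_const[of _ 0] this] show ?thesis by (simp add: A_def)
  qed
  obtain \<delta>1 y where y: "0 < \<delta>1" "\<delta>1 \<le> r" "y 0 = tcoord u c" "smooth_on {-\<delta>1<..<\<delta>1} y"
      "\<And>t. t \<in> {-\<delta>1<..<\<delta>1} \<Longrightarrow> (y has_vector_derivative A t (y t)) (at t)"
    using linear_ode_local_solution[OF r(1) Alin Asm, of "tcoord u c"] by metis
  define z where "z t = (?x + t *\<^sub>R a, y t)" for t
  have zsm: "smooth_on {-\<delta>1<..<\<delta>1} z" unfolding z_def by (intro smooth_on_Pair smx y) auto
  have z0: "z 0 = cmap (tchart M c) u" using y(3) by (simp add: z_def cmap_tchart)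
  \<comment> \<open>The interval is shrunk once more so that the curve stays in \<open>W\<close>:
    vanishing is known only along horizontal curves inside \<open>W\<close>.\<close>
  have "open ({-\<delta>1<..<\<delta>1} \<inter> z -` ?O)"
    by (rule continuous_open_preimage[OF smooth_on_imp_continuous_on[OF zsm] _ oO]) auto
  moreover have "0 \<in> {-\<delta>1<..<\<delta>1} \<inter> z -` ?O" using y(1) z0 uc W(2) by auto
  ultimately obtain \<delta> where \<delta>: "\<delta> > 0" "ball 0 \<delta> \<subseteq> {-\<delta>1<..<\<delta>1} \<inter> z -` ?O"
    by (meson open_contains_ball)
  let ?I = "{-\<delta><..<\<delta>}"
  have I: "t \<in> {-\<delta>1<..<\<delta>1}" "z t \<in> ?O" if "t \<in> ?I" for t
    using subsetD[OF \<delta>(2), of t] that by (auto simp: dist_real_def abs_less_iff)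
  have zD: "(z has_vector_derivative (a, A t (y t))) (at t)" if "t \<in> {-\<delta>1<..<\<delta>1}" for t
  proof -
    have "((\<lambda>t. ?x + t *\<^sub>R a) has_vector_derivative a) (at t)" by (auto intro!: derivative_eq_intros)
    from has_vector_derivative_Pair[OF this y(5)[OF that]] show ?thesis unfolding z_def .
  qed
  have zI: "smooth_on ?I z" using zsm I(1) by (auto intro: smooth_on_subset)
  have zim: "z ` ?I \<subseteq> cmap (tchart M c) ` cdom (tchart M c)" using I(2) by blast
  have "horizontal_curve M K ?I (\<lambda>t. cinv (tchart M c) (z t))"
    unfolding horizontal_curve_def
  proof (intro conjI ballI)
    show "smooth_curve (TM M) ?I (\<lambda>t. cinv (tchart M c) (z t))"
      by (rule T.smooth_curve_chart[OF tc _ zI zim]) simp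
    fix t assume t: "t \<in> ?I"
    define w where "w = cinv (tchart M c) (z t)"
    have w: "w \<in> cdom (tchart M c)" "cmap (tchart M c) w = z t"
      unfolding w_def using T.cinv_mem[OF tc _ order_refl, of "z t"] T.cmap_cinv[OF _ order_refl, of "z t" "tchart M c"]
        subsetD[OF zim imageI[OF t]] by simp_all
    then have wM: "tbase w \<in> cdom c" "w \<in> tspace M (tbase w)" "cmap c (tbase w) = ?x + t *\<^sub>R a" "tcoord w c = y t"
      by (auto simp: cdom_tchart cmap_tchart z_def)
    have wP: "w \<in> points (TM M)" using w tc unfolding points_def by blast
    have vel: "velocity (TM M) (\<lambda>t. cinv (tchart M c) (z t)) t = tvec_of (TM M) (tchart M c) w (a, A t (y t))"
      unfolding T.velocity_chart[OF tc _ zI zim t, simplified] w_def[symmetric]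
      using vector_derivative_at[OF zD[OF I(1)[OF t]]] by simp
    have m: "tvec_of (TM M) (tchart M c) w (a, A t (y t)) \<in> tspace (TM M) w" using tc w by simp
    have "K (tvec_of (TM M) (tchart M c) w (a, A t (y t))) = tzero (tbase w)"
      by (rule tspace_eqI[OF K_tspace[OF wP m] tzero_tspace c(1) wM(1)])
        (use tcoord_K[OF c(1) wM(1,2) m] tc w wM A_def in simp)
    then show "velocity (TM M) (\<lambda>t. cinv (tchart M c) (z t)) t \<in> hspace M K (cinv (tchart M c) (z t))"
      unfolding vel w_def[symmetric] hspace_def using m by simp
  qed
  moreover have "(z has_vector_derivative (a, - Gam c ?x a (tcoord u c))) (at 0)"
    using zD[of 0] y(1,3) by (simp add: A_def)
  ultimately show thesis using that[of \<delta> z] \<delta>(1) z0 I(2) by blast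
qed

text \<open>The pairs (a, -\<Gamma>(a, v)) are the coordinates of the horizontal vectors at
  \<open>u\<close>. Each is the initial velocity of a horizontal curve in \<open>W\<close>, along
  which \<open>E\<close> is identically zero.\<close>

lemma vanishes_horizontally_derivative:
  assumes c: "c \<in> M" "tbase u \<in> cdom c" and u: "u \<in> tspace M (tbase u)"
    and W: "openin (mtopology (TM M)) W" "u \<in> W"
    and E: "smooth_vf (TM M) W E" "vanishes_horizontally M K W u E"
  shows "frechet_derivative (\<lambda>y. tcoord (E (cinv (tchart M c) y)) (tchart M c)) (at (cmap (tchart M c) u))
    (a, - Gam c (cmap c (tbase u)) a (tcoord u c)) = 0"
proof -
  interpret T: atlas "TM M" by (rule atlas_TM)
  note tc = tchart_TM[OF c(1)]
  have uc: "u \<in> cdom (tchart M c)" using c u by (simp add: cdom_tchart)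
  let ?e = "\<lambda>y. tcoord (E (cinv (tchart M c) y)) (tchart M c)"
  let ?D = "frechet_derivative ?e (at (cmap (tchart M c) u))"
  obtain \<delta> z where z: "\<delta> > 0" "z 0 = cmap (tchart M c) u"
    "(z has_vector_derivative (a, - Gam c (cmap c (tbase u)) a (tcoord u c))) (at 0)"
    "z ` {-\<delta><..<\<delta>} \<subseteq> cmap (tchart M c) ` (W \<inter> cdom (tchart M c))"
    "horizontal_curve M K {-\<delta><..<\<delta>} (\<lambda>t. cinv (tchart M c) (z t))"
    using horizontal_curve_exists[OF c u W] by metis
  define \<gamma> where "\<gamma> t = cinv (tchart M c) (z t)" for t
  have \<gamma>0: "\<gamma> 0 = u" unfolding \<gamma>_def z(2) using tc uc by simp
  have "u \<in> \<gamma> ` {-\<delta><..<\<delta>}" using \<gamma>0 z(1) by (intro image_eqI[of _ _ 0]) auto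
  moreover have "\<gamma> ` {-\<delta><..<\<delta>} \<subseteq> W"
    using T.cinv_mem[OF tc, of _ "W \<inter> cdom (tchart M c)"] z(4) unfolding \<gamma>_def by blast
  ultimately have van: "E (\<gamma> t) = tzero (\<gamma> t)" if "t \<in> {-\<delta><..<\<delta>}" for t
    using E(2) z(5) that unfolding vanishes_horizontally_def \<gamma>_def[abs_def] by blast
  have "(?e has_derivative ?D) (at (z 0))"
    unfolding z(2) by (rule T.tcoord_has_derivative[OF W(1) E(1) tc W(2) uc])
  from has_derivative_compose[OF z(3)[unfolded has_vector_derivative_def] this]
  have D: "((\<lambda>t. ?e (z t)) has_derivative (\<lambda>k. ?D (k *\<^sub>R (a, - Gam c (cmap c (tbase u)) a (tcoord u c))))) (at 0)" .
  have "((\<lambda>t. ?e (z t)) has_derivative (\<lambda>k. 0)) (at 0)"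
    by (rule has_derivative_transform_within_open[OF has_derivative_const[of 0], of "{-\<delta><..<\<delta>}"])
      (use van z(1) in \<open>auto simp: \<gamma>_def\<close>)
  from fun_cong[OF has_derivative_unique[OF D this], of 1] show ?thesis by simp
qed

end

section \<open>Covariant derivatives on the tangent bundle\<close>

context tangent_metric begin

lemma dGam_0: "c \<in> M \<Longrightarrow> x \<in> cmap c ` cdom c \<Longrightarrow> dGam c x a 0 d = 0"
proof -
  assume c: "c \<in> M" and x: "x \<in> cmap c ` cdom c"
  have "frechet_derivative (\<lambda>y. Gam c y 0 d) (at x) = frechet_derivative (\<lambda>y. 0) (at x)"
    by (rule frechet_derivative_cong_open[OF open_cmap_cdom[OF c] x]) (simp add: Gam_simps[OF c])
  then show ?thesis by (simp add: dGam_def frechet_derivative_const)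
qed

text \<open>\<open>flat_deriv\<close> records only the d\<pi>-part of \<open>C\<close> and the
  K-part of \<open>D\<close>. Nothing is lost: derivatives at \<open>u\<close> of a horizontal field
  vanishing there are horizontal, and those of a vertical field are vertical, so the ordinary
  coordinate derivatives are recovered in full.\<close>

lemma flat_deriv_eq:
  assumes c: "c \<in> M" "tbase u \<in> cdom c" and u: "u \<in> tspace M (tbase u)" and G: "G \<in> tspace M (tbase u)"
    and W: "openin (mtopology (TM M)) W" "u \<in> W"
    and C: "smooth_vf (TM M) W C" "\<And>w. w \<in> W \<Longrightarrow> C w \<in> hspace M K w" "C u = tzero u"
    and D: "smooth_vf (TM M) W D" "\<And>w. w \<in> W \<Longrightarrow> D w \<in> vspace M w"
  shows "flat_deriv M K u G C D = tvec_of (TM M) (tchart M c) u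
    (frechet_derivative (\<lambda>y. tcoord (C (cinv (tchart M c) y)) (tchart M c)) (at (cmap (tchart M c) u)) (0, tcoord G c) +
     frechet_derivative (\<lambda>y. tcoord (D (cinv (tchart M c) y)) (tchart M c)) (at (cmap (tchart M c) u)) (0, tcoord G c))"
proof -
  let ?p = "tbase u" and ?t = "tchart M c"
  let ?x = "cmap c ?p" and ?v = "tcoord u c" and ?g = "tcoord G c"
  let ?O = "cmap ?t ` (W \<inter> cdom ?t)" and ?u = "cmap ?t u"
  note tc = tchart_TM[OF c(1)]
  have x: "?x \<in> cmap c ` cdom c" using c by blast
  have uc: "u \<in> cdom ?t" using c u by (simp add: cdom_tchart)
  have oO: "open ?O" by (rule T.open_chart_image[OF W(1) tc])
  have uO: "?u \<in> ?O" using uc W(2) by blast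
  have cu: "?u = (?x, ?v)" by (simp add: cmap_tchart)
  define e where "e E y = tcoord (E (cinv ?t y)) ?t" for E :: "('a, 'e) tvec \<Rightarrow> (('a, 'e) tvec, 'e \<times> 'e) tvec" and y
  define d where "d E = frechet_derivative (e E) (at ?u)" for E
  have eD: "(e E has_derivative d E) (at ?u)" if "smooth_vf (TM M) W E" for E
    unfolding d_def e_def by (rule T.tcoord_has_derivative[OF W(1) that tc W(2) uc])
  have O: "\<exists>w. w \<in> W \<and> w = cinv ?t y \<and> tbase w \<in> cdom c \<and> w \<in> tspace M (tbase w) \<and> y = (cmap c (tbase w), tcoord w c)"
    if y: "y \<in> ?O" for y
  proof -
    obtain w where w: "w \<in> W" "w \<in> cdom ?t" "y = cmap ?t w" using y by blast
    then have "cinv ?t y = w" using T.cinv_cmap[OF tc] by simp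
    then show ?thesis using w by (intro exI[of _ w]) (auto simp: cdom_tchart cmap_tchart)
  qed
  have eC: "snd (e C y) = - Gam c (fst y) (fst (e C y)) (snd y)" if y: "y \<in> ?O" for y
  proof -
    obtain w where w: "w \<in> W" "w = cinv ?t y" "tbase w \<in> cdom c" "w \<in> tspace M (tbase w)" "y = (cmap c (tbase w), tcoord w c)"
      using O[OF y] by blast
    have "C w \<in> tspace (TM M) w" "K (C w) = tzero (tbase w)" using C(2)[OF w(1)] unfolding hspace_def by auto
    then have "snd (tcoord (C w) ?t) = - Gam c (cmap c (tbase w)) (fst (tcoord (C w) ?t)) (tcoord w c)"
      using tcoord_K[OF c(1) w(3,4), of "C w"] by (simp add: eq_neg_iff_add_eq_0)
    then show ?thesis unfolding e_def w(2)[symmetric] unfolding w(5) fst_conv snd_conv .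
  qed
  have eDv: "fst (e D y) = 0" if y: "y \<in> ?O" for y
  proof -
    obtain w where w: "w \<in> W" "w = cinv ?t y" "tbase w \<in> cdom c" "w \<in> tspace M (tbase w)" using O[OF y] by blast
    have "D w \<in> tspace (TM M) w" "dpi M (D w) = tzero (tbase w)" using D(2)[OF w(1)] unfolding vspace_def by auto
    then show ?thesis using tcoord_dpi[OF _ w(4) c(1) w(3), of "D w"] unfolding e_def w(2)[symmetric] by simp
  qed
  have e0: "e C ?u = 0" unfolding e_def using T.cinv_cmap[OF tc uc] C(3) by simp
  \<comment> \<open>Horizontality near \<open>u\<close> says that the second component is
    -\<Gamma>(first component, v). As \<open>C\<close> vanishes at \<open>u\<close>, the product
    rule keeps only the term in which \<open>C\<close> is differentiated, so the derivative
    satisfies the same equation.\<close>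
  have dC: "snd (d C h) = - Gam c ?x (fst (d C h)) ?v" for h
  proof -
    have x': "fst ?u \<in> cmap c ` cdom c" using x cu by simp
    have "((\<lambda>y. - Gam c (fst y) (fst (e C y)) (snd y)) has_derivative
      (\<lambda>h. - (dGam c (fst ?u) (fst h) (fst (e C ?u)) (snd ?u) + Gam c (fst ?u) (fst (d C h)) (snd ?u) +
        Gam c (fst ?u) (fst (e C ?u)) (snd h)))) (at ?u)"
      by (intro has_derivative_minus Gam_param_has_derivative[OF c(1), where x = fst, OF x']
        has_derivative_fst has_derivative_snd has_derivative_ident eD C(1))
    then have "((\<lambda>y. - Gam c (fst y) (fst (e C y)) (snd y)) has_derivative (\<lambda>h. - Gam c ?x (fst (d C h)) ?v)) (at ?u)"
      unfolding e0 unfolding cu by (simp add: dGam_0[OF c(1) x] Gam_simps[OF c(1) x])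
    then have "((\<lambda>y. snd (e C y)) has_derivative (\<lambda>h. - Gam c ?x (fst (d C h)) ?v)) (at ?u)"
      by (rule has_derivative_transform_within_open[OF _ oO uO]) (simp add: eC)
    from fun_cong[OF has_derivative_unique[OF has_derivative_snd[OF eD[OF C(1)]] this], of h] show ?thesis .
  qed
  have dD: "fst (d D h) = 0" for h
  proof -
    have "((\<lambda>y. fst (e D y)) has_derivative (\<lambda>h. 0)) (at ?u)"
      by (rule has_derivative_transform_within_open[OF has_derivative_const[of 0] oO uO]) (simp add: eDv)
    from fun_cong[OF has_derivative_unique[OF has_derivative_fst[OF eD[OF D(1)]] this], of h] show ?thesis .
  qed
  \<comment> \<open>The straight line through \<open>u\<close> in the fibre, in coordinates; it
    represents the curve u + sG.\<close>
  define l where "l s = (?x, ?v + s *\<^sub>R ?g)" for s :: real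
  define I where "I = l -` ?O"
  have lc: "continuous_on UNIV l" unfolding l_def by (intro continuous_intros)
  have I: "open I" "0 \<in> I" unfolding I_def using uO by (auto intro: open_vimage[OF oO lc] simp: l_def cu)
  have le: "cinv ?t (l s) = u +\<^sub>T s *\<^sub>T G" for s
  proof -
    have "cinv ?t (l s) = tvec_of M c ?p (?v + s *\<^sub>R ?g)" unfolding l_def cinv_tchart[OF c(1) x] using c by simp
    also have "\<dots> = u +\<^sub>T s *\<^sub>T G" using u G c by (simp add: tvec_of_add tvec_of_scale)
    finally show ?thesis .
  qed
  have lD: "((\<lambda>s. e E (l s)) has_vector_derivative d E (0, ?g)) (at 0)" if E: "smooth_vf (TM M) W E" for E
  proof -
    have l0: "l 0 = ?u" by (simp add: l_def cu)
    have "(l has_derivative (\<lambda>k. (0, 0 + k *\<^sub>R ?g))) (at 0)"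
      unfolding l_def by (intro has_derivative_Pair has_derivative_add has_derivative_const has_derivative_scaleR_left has_derivative_ident)
    from has_derivative_compose[OF this eD[OF E, folded l0]]
    have "((\<lambda>s. e E (l s)) has_derivative (\<lambda>k. d E (0, k *\<^sub>R ?g))) (at 0)" by simp
    moreover have "d E (0, k *\<^sub>R ?g) = k *\<^sub>R d E (0, ?g)" for k
      using linear_scale[OF has_derivative_linear[OF eD[OF E]], of k "(0, ?g)"] by simp
    ultimately show ?thesis unfolding has_vector_derivative_def by simp
  qed
  have ls: "u +\<^sub>T s *\<^sub>T G \<in> W" "tbase (u +\<^sub>T s *\<^sub>T G) = ?p" "u +\<^sub>T s *\<^sub>T G \<in> tspace M (tbase (u +\<^sub>T s *\<^sub>T G))" if "s \<in> I" for s
    using O[of "l s"] that u G unfolding I_def by (auto simp: le)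
  have f1: "fibre_deriv M ?p (\<lambda>s. dpi M (C (u +\<^sub>T s *\<^sub>T G))) = tvec_of M c ?p (fst (d C (0, ?g)))"
  proof (rule fibre_deriv_eq[OF c I])
    fix s assume s: "s \<in> I"
    have m: "C (u +\<^sub>T s *\<^sub>T G) \<in> tspace (TM M) (u +\<^sub>T s *\<^sub>T G)" by (rule T.smooth_vfD(1)[OF C(1) ls(1)[OF s]])
    show "dpi M (C (u +\<^sub>T s *\<^sub>T G)) \<in> tspace M ?p" using dpi_tspace[OF m ls(3)[OF s]] by simp
  next
    have "((\<lambda>s. fst (e C (l s))) has_vector_derivative fst (d C (0, ?g))) (at 0)"
      by (rule bounded_linear.has_vector_derivative[OF bounded_linear_fst lD[OF C(1)]])
    then show "((\<lambda>s. tcoord (dpi M (C (u +\<^sub>T s *\<^sub>T G))) c) has_vector_derivative fst (d C (0, ?g))) (at 0)"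
    proof (rule has_vector_derivative_transform_within_open[OF _ I])
      fix s assume s: "s \<in> I"
      have m: "C (u +\<^sub>T s *\<^sub>T G) \<in> tspace (TM M) (u +\<^sub>T s *\<^sub>T G)" by (rule T.smooth_vfD(1)[OF C(1) ls(1)[OF s]])
      show "fst (e C (l s)) = tcoord (dpi M (C (u +\<^sub>T s *\<^sub>T G))) c"
        unfolding e_def le using tcoord_dpi[OF m ls(3)[OF s] c(1)] c(2) by simp
    qed
  qed
  have f2: "fibre_deriv M ?p (\<lambda>s. K (D (u +\<^sub>T s *\<^sub>T G))) = tvec_of M c ?p (snd (d D (0, ?g)))"
  proof (rule fibre_deriv_eq[OF c I])
    fix s assume s: "s \<in> I"
    have m: "D (u +\<^sub>T s *\<^sub>T G) \<in> tspace (TM M) (u +\<^sub>T s *\<^sub>T G)" by (rule T.smooth_vfD(1)[OF D(1) ls(1)[OF s]])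
    have "u +\<^sub>T s *\<^sub>T G \<in> points (TM M)" unfolding points_TM using ls(3)[OF s] c by (auto simp: points_def)
    from K_tspace[OF this m] show "K (D (u +\<^sub>T s *\<^sub>T G)) \<in> tspace M ?p" by simp
  next
    have "((\<lambda>s. snd (e D (l s))) has_vector_derivative snd (d D (0, ?g))) (at 0)"
      by (rule bounded_linear.has_vector_derivative[OF bounded_linear_snd lD[OF D(1)]])
    then show "((\<lambda>s. tcoord (K (D (u +\<^sub>T s *\<^sub>T G))) c) has_vector_derivative snd (d D (0, ?g))) (at 0)"
    proof (rule has_vector_derivative_transform_within_open[OF _ I])
      fix s assume s: "s \<in> I"
      have m: "D (u +\<^sub>T s *\<^sub>T G) \<in> tspace (TM M) (u +\<^sub>T s *\<^sub>T G)" by (rule T.smooth_vfD(1)[OF D(1) ls(1)[OF s]])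
      have "fst (tcoord (D (u +\<^sub>T s *\<^sub>T G)) ?t) = 0"
        using eDv[of "l s"] s unfolding I_def e_def le by simp
      then show "snd (e D (l s)) = tcoord (K (D (u +\<^sub>T s *\<^sub>T G))) c"
        unfolding e_def le using tcoord_K[OF c(1) _ ls(3)[OF s] m] c(2) by (simp add: Gam_simps[OF c(1) x])
    qed
  qed
  have tv: "tvec_of M c ?p y \<in> tspace M ?p" for y using c by simp
  show ?thesis
    unfolding flat_deriv_def f1 f2 tvec_with_eq[OF c u tv tv] e_def[symmetric] d_def[symmetric]
    using c dC dD by (auto intro!: arg_cong[of _ _ "tvec_of (TM M) ?t u"] simp: prod_eq_iff)
qed

text \<open>The lifted field has coordinates (A, B - \<Gamma>(A, v)). Its coordinate derivative
  along \<xi> is added to the Christoffel symbol of \<open>TM M\<close>; the terms with derivatives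
  of A and B combine with \<Gamma> to the covariant derivatives on \<open>M\<close>.\<close>

lemma nabbar_lift_field:
  assumes c: "c \<in> M" "tbase u \<in> cdom c" and u: "u \<in> tspace M (tbase u)"
    and F: "F \<in> tspace M (tbase u)" and G: "G \<in> tspace M (tbase u)"
    and U: "openin (mtopology M) U" "smooth_vf M U A" "smooth_vf M U B"
    and W: "openin (mtopology (TM M)) W" "u \<in> W" "tbase ` W \<subseteq> U"
    and S: "smooth_vf (TM M) W (\<lambda>w. hlift_vf M K A w +\<^sub>T vlift_vf M K B w)"
    and \<Delta>: "\<Delta> = m1 * m3 - m2\<^sup>2" "\<Delta> > 0"
  shows "dpi M (nabbar (hlift M K u F +\<^sub>T vlift M K u G) (\<lambda>w. hlift_vf M K A w +\<^sub>T vlift_vf M K B w)) =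
           nab F A +\<^sub>T (1 / \<Delta>) *\<^sub>T
             ((m2 * m3) *\<^sub>T curvature M nab u F (A (tbase u))
              +\<^sub>T (m2 * m3 / 2) *\<^sub>T curvature M nab F (A (tbase u)) u
              +\<^sub>T (m3\<^sup>2 / 2) *\<^sub>T curvature M nab u (B (tbase u)) F
              +\<^sub>T (m3\<^sup>2 / 2) *\<^sub>T curvature M nab u G (A (tbase u)))" (is ?dpi)
    and "K (nabbar (hlift M K u F +\<^sub>T vlift M K u G) (\<lambda>w. hlift_vf M K A w +\<^sub>T vlift_vf M K B w)) =
           nab F B -\<^sub>T (1 / \<Delta>) *\<^sub>T
             (m2\<^sup>2 *\<^sub>T curvature M nab u F (A (tbase u))
              +\<^sub>T (m1 * m3 / 2) *\<^sub>T curvature M nab F (A (tbase u)) u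
              +\<^sub>T (m2 * m3 / 2) *\<^sub>T curvature M nab u (B (tbase u)) F
              +\<^sub>T (m2 * m3 / 2) *\<^sub>T curvature M nab u G (A (tbase u)))" (is ?K)
proof -
  define p where "p = tbase u"
  let ?t = "tchart M c"
  let ?u = "cmap ?t u"
  define x where "x = cmap c p"
  define v where "v = tcoord u c"
  let ?S = "\<lambda>w. hlift_vf M K A w +\<^sub>T vlift_vf M K B w"
  note tc = tchart_TM[OF c(1)]
  have x: "x \<in> cmap c ` cdom c" using c unfolding x_def p_def by blast
  have pU: "p \<in> U" using W unfolding p_def by blast
  have cp: "p \<in> cdom c" using c unfolding p_def by simp
  have uc: "u \<in> cdom ?t" using c u by (simp add: cdom_tchart)
  have uP: "u \<in> points (TM M)" using uc tc unfolding points_def by blast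
  have cu: "?u = (x, v)" by (simp add: cmap_tchart x_def v_def p_def)
  define h where "h A x = tcoord (A (cinv c x)) c" for A :: "'a \<Rightarrow> ('a, 'e) tvec" and x
  define d where "d A = frechet_derivative (h A) (at x)" for A
  have hD: "(h A has_derivative d A) (at x)" if "smooth_vf M U A" for A
    unfolding h_def d_def x_def by (rule tcoord_has_derivative[OF U(1) that c(1) pU cp])
  have hx: "h A x = tcoord (A p) c" for A unfolding h_def x_def using c cp by simp
  have nabc: "tcoord (nab F A) c = d A (tcoord F c) + Gam c x (tcoord F c) (tcoord (A p) c)" if "smooth_vf M U A" for A
    unfolding d_def h_def x_def using tcoord_nab[OF U(1) that pU c(1) cp, of F] F p_def by simp
  have Sc: "tcoord (?S w) ?t = (h A (cmap c (tbase w)), h B (cmap c (tbase w)) - Gam c (cmap c (tbase w)) (h A (cmap c (tbase w))) (tcoord w c))"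
    if w: "w \<in> W" "w \<in> cdom ?t" for w
  proof -
    have b: "tbase w \<in> cdom c" "w \<in> tspace M (tbase w)" "tbase w \<in> U" using w W(3) by (auto simp: cdom_tchart)
    show ?thesis
      unfolding hlift_vf_def vlift_vf_def lift_eq(1)[OF c(1) b(1,2) smooth_vfD(1)[OF U(2) b(3)]]
        lift_eq(2)[OF c(1) b(1,2) smooth_vfD(1)[OF U(3) b(3)]]
      using tc w c b by (simp add: h_def)
  qed
  define a where "a = tcoord (A p) c"
  define b where "b = tcoord (B p) c"
  have Su: "tcoord (?S u) ?t = (a, b - Gam c x a v)"
    unfolding Sc[OF W(2) uc] p_def[symmetric] x_def[symmetric] v_def[symmetric] hx a_def b_def ..
  let ?\<xi> = "hlift M K u F +\<^sub>T vlift M K u G"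
  have \<xi>: "?\<xi> \<in> tspace (TM M) u" "tcoord ?\<xi> ?t = (tcoord F c, tcoord G c - Gam c x (tcoord F c) v)"
    unfolding lift_eq(1)[OF c u F] lift_eq(2)[OF c u G] using tc uc by (simp_all add: x_def p_def v_def)
  \<comment> \<open>Besides the derivatives of A and B this contains the derivative of \<Gamma>(A,
    v) in base point, field and fibre coordinate.\<close>
  have SD: "frechet_derivative (\<lambda>y. tcoord (?S (cinv ?t y)) ?t) (at ?u) =
    (\<lambda>k. (d A (fst k), d B (fst k) - (dGam c x (fst k) a v + Gam c x (d A (fst k)) v + Gam c x a (snd k))))"
  proof (rule frechet_derivative_eqI)
    let ?O = "cmap ?t ` (W \<inter> cdom ?t)"
    have oO: "open ?O" by (rule T.open_chart_image[OF W(1) tc])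
    have uO: "?u \<in> ?O" using uc W(2) by blast
    have x': "fst ?u \<in> cmap c ` cdom c" using x cu by simp
    have cmp: "((\<lambda>y. h A (fst y)) has_derivative (\<lambda>k. d A (fst k))) (at ?u)" if "smooth_vf M U A" for A
      by (rule has_derivative_compose[OF has_derivative_fst[OF has_derivative_ident]]) (use hD[OF that] cu in simp)
    have "((\<lambda>y. (h A (fst y), h B (fst y) - Gam c (fst y) (h A (fst y)) (snd y))) has_derivative
      (\<lambda>k. (d A (fst k), d B (fst k) - (dGam c (fst ?u) (fst k) (h A (fst ?u)) (snd ?u) +
        Gam c (fst ?u) (d A (fst k)) (snd ?u) + Gam c (fst ?u) (h A (fst ?u)) (snd k))))) (at ?u)"
      by (intro has_derivative_Pair has_derivative_diff cmp U Gam_param_has_derivative[OF c(1), where x = fst, OF x']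
        has_derivative_fst has_derivative_snd has_derivative_ident)
    then have "((\<lambda>y. (h A (fst y), h B (fst y) - Gam c (fst y) (h A (fst y)) (snd y))) has_derivative
      (\<lambda>k. (d A (fst k), d B (fst k) - (dGam c x (fst k) a v + Gam c x (d A (fst k)) v + Gam c x a (snd k))))) (at ?u)"
      unfolding cu by (simp add: hx a_def)
    then show "((\<lambda>y. tcoord (?S (cinv ?t y)) ?t) has_derivative
      (\<lambda>k. (d A (fst k), d B (fst k) - (dGam c x (fst k) a v + Gam c x (d A (fst k)) v + Gam c x a (snd k))))) (at ?u)"
    proof (rule has_derivative_transform_within_open[OF _ oO uO])
      fix y assume "y \<in> ?O"
      then obtain w where w: "w \<in> W" "w \<in> cdom ?t" "y = cmap ?t w" by blast
      then have i: "cinv ?t y = w" using T.cinv_cmap[OF tc] by simp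
      show "(h A (fst y), h B (fst y) - Gam c (fst y) (h A (fst y)) (snd y)) = tcoord (?S (cinv ?t y)) ?t"
        unfolding i Sc[OF w(1,2)] unfolding w(3) cmap_tchart fst_conv snd_conv ..
    qed
  qed
  define n where "n = nabbar ?\<xi> ?S"
  define \<Gamma> where "\<Gamma> = T.Gam ?t (x, v) (tcoord F c, tcoord G c - Gam c x (tcoord F c) v) (a, b - Gam c x a v)"
  have n: "n \<in> tspace (TM M) u" unfolding n_def by (rule T.nab_tspace[OF W(1) S W(2) \<xi>(1)])
  have nc: "tcoord n ?t = (d A (tcoord F c), d B (tcoord F c) - (dGam c x (tcoord F c) a v +
      Gam c x (d A (tcoord F c)) v + Gam c x a (tcoord G c - Gam c x (tcoord F c) v))) + \<Gamma>"
    unfolding n_def \<Gamma>_def T.tcoord_nab[OF W(1) S W(2) tc uc \<xi>(1)] \<xi>(2) Su SD unfolding cu by simp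
  have Kx: "Kc c x v (tcoord F c, tcoord G c - Gam c x (tcoord F c) v) = tcoord G c"
    "Kc c x v (a, b - Gam c x a v) = b" by (simp_all add: Kc_def)
  note GT = Gam_TM[OF c(1) x \<Delta>(1), where v = v and X = "(tcoord F c, tcoord G c - Gam c x (tcoord F c) v)"
    and Y = "(a, b - Gam c x a v)", unfolded Kx fst_conv, folded \<Gamma>_def]
  have \<Delta>0: "\<Delta> \<noteq> 0" using \<Delta>(2) by simp
  have Ap: "A p \<in> tspace M p" "B p \<in> tspace M p" using smooth_vfD(1)[OF U(2) pU] smooth_vfD(1)[OF U(3) pU] by auto
  have up: "u \<in> tspace M p" "F \<in> tspace M p" "G \<in> tspace M p" using u F G p_def by auto
  have cur: "curvature M nab X Y Z \<in> tspace M p" "tcoord (curvature M nab X Y Z) c = Riem c x (tcoord X c) (tcoord Y c) (tcoord Z c)"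
    if "X \<in> tspace M p" "Y \<in> tspace M p" "Z \<in> tspace M p" for X Y Z
    using curvature_eq[OF c(1) cp that] c cp by (simp_all add: x_def)
  note nabm = nab_tspace[OF U(1) _ pU up(2)]
  have dpin: "tcoord (dpi M n) c = d A (tcoord F c) + fst \<Gamma>"
    using tcoord_dpi[OF n u c] nc by simp
  \<comment> \<open>Applying K absorbs \<Gamma>(dA, v) and leaves -\<open>dKc\<close>, which cancels
    the \<open>dKc\<close> term in the K-component of the Christoffel symbol.\<close>
  have Kn: "tcoord (K n) c = d B (tcoord F c) - dKc c x v (tcoord F c) (tcoord G c) a + Kc c x v \<Gamma>"
    using tcoord_K[OF c u n] unfolding p_def[symmetric] x_def[symmetric] v_def[symmetric] nc
    by (simp add: dKc_def Kc_def Gam_simps[OF c(1) x])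
  show ?dpi
    unfolding n_def[symmetric] p_def[symmetric]
  proof (rule tspace_eqI[OF _ _ c(1) cp])
    show "dpi M n \<in> tspace M p" using dpi_tspace[OF n u] p_def by simp
    show "tcoord (dpi M n) c = tcoord (nab F A +\<^sub>T (1 / \<Delta>) *\<^sub>T
             ((m2 * m3) *\<^sub>T curvature M nab u F (A p) +\<^sub>T (m2 * m3 / 2) *\<^sub>T curvature M nab F (A p) u
              +\<^sub>T (m3\<^sup>2 / 2) *\<^sub>T curvature M nab u (B p) F +\<^sub>T (m3\<^sup>2 / 2) *\<^sub>T curvature M nab u G (A p))) c"
      unfolding dpin tcoord_simps cur(2)[OF up(1,2) Ap(1)] cur(2)[OF up(2) Ap(1) up(1)] cur(2)[OF up(1) Ap(2) up(2)]
        cur(2)[OF up(1,3) Ap(1)] nabc[OF U(2)] GT(1)[OF \<Delta>0] a_def b_def v_def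
      by (simp only: add.assoc)
  qed (intro tplus_tspace tscale_tspace cur nabm up Ap U)
  show ?K
    unfolding n_def[symmetric] p_def[symmetric]
  proof (rule tspace_eqI[OF _ _ c(1) cp])
    show "K n \<in> tspace M p" using K_tspace[OF uP n] p_def by simp
    show "tcoord (K n) c = tcoord (nab F B -\<^sub>T (1 / \<Delta>) *\<^sub>T
             (m2\<^sup>2 *\<^sub>T curvature M nab u F (A p) +\<^sub>T (m1 * m3 / 2) *\<^sub>T curvature M nab F (A p) u
              +\<^sub>T (m2 * m3 / 2) *\<^sub>T curvature M nab u (B p) F +\<^sub>T (m2 * m3 / 2) *\<^sub>T curvature M nab u G (A p))) c"
      unfolding Kn tcoord_simps cur(2)[OF up(1,2) Ap(1)] cur(2)[OF up(2) Ap(1) up(1)] cur(2)[OF up(1) Ap(2) up(2)]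
        cur(2)[OF up(1,3) Ap(1)] nabc[OF U(3)] GT(2)[OF \<Delta>0]
      unfolding a_def b_def v_def by simp
  qed (intro tplus_tspace tminus_tspace tscale_tspace cur nabm up Ap U)
qed

text \<open>The fields vanish at \<open>u\<close>, so the Christoffel symbol contributes nothing and
  the covariant derivative is the coordinate derivative along \<xi>. Its horizontal part is zero
  because the fields vanish along horizontal curves; the vertical part is the flat
  derivative.\<close>

lemma nabbar_vanishing_fields:
  assumes c: "c \<in> M" "tbase u \<in> cdom c" and u: "u \<in> tspace M (tbase u)"
    and F: "F \<in> tspace M (tbase u)" and G: "G \<in> tspace M (tbase u)"
    and W: "openin (mtopology (TM M)) W" "u \<in> W"
    and C: "smooth_vf (TM M) W C" "\<And>w. w \<in> W \<Longrightarrow> C w \<in> hspace M K w" "vanishes_horizontally M K W u C"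
    and D: "smooth_vf (TM M) W D" "\<And>w. w \<in> W \<Longrightarrow> D w \<in> vspace M w" "vanishes_horizontally M K W u D"
  shows "nabbar (hlift M K u F +\<^sub>T vlift M K u G) (\<lambda>w. C w +\<^sub>T D w) = flat_deriv M K u G C D"
proof -
  let ?t = "tchart M c" and ?x = "cmap c (tbase u)" and ?v = "tcoord u c"
  let ?u = "cmap ?t u"
  note tc = tchart_TM[OF c(1)]
  have uc: "u \<in> cdom ?t" using c u by (simp add: cdom_tchart)
  let ?\<xi> = "hlift M K u F +\<^sub>T vlift M K u G"
  \<comment> \<open>The coordinates are written as a vertical plus a horizontal vector, so that
    linearity of the derivative separates the two contributions.\<close>
  have \<xi>: "?\<xi> \<in> tspace (TM M) u"
      "tcoord ?\<xi> ?t = (0, tcoord G c) + (tcoord F c, - Gam c ?x (tcoord F c) ?v)"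
    unfolding lift_eq(1)[OF c u F] lift_eq(2)[OF c u G] using tc uc by simp_all
  have E0: "C u = tzero u" "D u = tzero u" using C(3) D(3) unfolding vanishes_horizontally_def by auto
  have xin: "?u \<in> cmap ?t ` cdom ?t" using uc by blast
  have nE: "tcoord (nabbar ?\<xi> E) ?t =
      frechet_derivative (\<lambda>y. tcoord (E (cinv ?t y)) ?t) (at ?u) (0, tcoord G c)"
    if E: "smooth_vf (TM M) W E" "vanishes_horizontally M K W u E" for E
  proof -
    let ?D = "frechet_derivative (\<lambda>y. tcoord (E (cinv ?t y)) ?t) (at ?u)"
    have lin: "linear ?D" by (rule has_derivative_linear[OF T.tcoord_has_derivative[OF W(1) E(1) tc W(2) uc]])
    have E0: "tcoord (E u) ?t = 0" using E(2) unfolding vanishes_horizontally_def by simp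
    have G0: "T.Gam ?t ?u X 0 = 0" for X
      using T.bilinear_Gam[OF tc xin] unfolding bilinear_def by (blast intro: linear_0)
    show ?thesis
      unfolding T.tcoord_nab[OF W(1) E(1) W(2) tc uc \<xi>(1)] \<xi>(2) E0 G0 linear_add[OF lin]
        vanishes_horizontally_derivative[OF c u W E] by simp
  qed
  have fl: "flat_deriv M K u G C D = tvec_of (TM M) ?t u
      (frechet_derivative (\<lambda>y. tcoord (C (cinv ?t y)) ?t) (at ?u) (0, tcoord G c) +
       frechet_derivative (\<lambda>y. tcoord (D (cinv ?t y)) ?t) (at ?u) (0, tcoord G c))"
    by (rule flat_deriv_eq[OF c u G W C(1) C(2) E0(1) D(1) D(2)])
  note nab_mem = T.nab_tspace[OF W(1) _ W(2) \<xi>(1)]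
  have "nabbar ?\<xi> (\<lambda>w. C w +\<^sub>T D w) = nabbar ?\<xi> C +\<^sub>T nabbar ?\<xi> D"
    by (rule T.nab_add_field[OF W(1) C(1) W(2) \<xi>(1) D(1)])
  also have "\<dots> = flat_deriv M K u G C D"
    unfolding fl
    by (rule T.tspace_eqI[OF T.tplus_tspace[OF nab_mem[OF C(1)] nab_mem[OF D(1)]] T.tvec_of_tspace[OF tc uc] tc uc])
      (simp add: nE C D tc uc)
  finally show ?thesis .
qed

end

section \<open>Assembly in a chart around \<open>p\<close>\<close>

theorem corollary4p1:
  fixes M :: "('a, 'e::euclidean_space) atlas"
    and g :: "('a, 'e) tvec \<Rightarrow> ('a, 'e) tvec \<Rightarrow> real"
    and nab :: "('a, 'e) tvec \<Rightarrow> ('a \<Rightarrow> ('a, 'e) tvec) \<Rightarrow> ('a, 'e) tvec"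
    and K :: "(('a, 'e) tvec, 'e \<times> 'e) tvec \<Rightarrow> ('a, 'e) tvec"
    and m1 m2 m3 \<Delta> :: real
    and gbar :: "(('a, 'e) tvec, 'e \<times> 'e) tvec \<Rightarrow> (('a, 'e) tvec, 'e \<times> 'e) tvec \<Rightarrow> real"
    and nabbar :: "(('a, 'e) tvec, 'e \<times> 'e) tvec \<Rightarrow>
      (('a, 'e) tvec \<Rightarrow> (('a, 'e) tvec, 'e \<times> 'e) tvec) \<Rightarrow> (('a, 'e) tvec, 'e \<times> 'e) tvec"
    and Xbar Ybar C D :: "('a, 'e) tvec \<Rightarrow> (('a, 'e) tvec, 'e \<times> 'e) tvec"
    and p :: 'a and u F G :: "('a, 'e) tvec"
    and U :: "'a set" and A B :: "'a \<Rightarrow> ('a, 'e) tvec" and W :: "('a, 'e) tvec set"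
  assumes "smooth_manifold M" and "riemannian_metric M g" and "levi_civita M g nab"
    and "connection_map M nab K"
    and "m1 > 0" and "m3 > 0" and "\<Delta> = m1 * m3 - m2\<^sup>2" and "\<Delta> > 0"
    and "riemannian_metric (TM M) gbar"
    and "\<And>w X Y. w \<in> points (TM M) \<Longrightarrow> X \<in> tspace M (tbase w) \<Longrightarrow> Y \<in> tspace M (tbase w) \<Longrightarrow>
           gbar (hlift M K w X) (hlift M K w Y) = m1 * g X Y \<and>
           gbar (hlift M K w X) (vlift M K w Y) = m2 * g X Y \<and>
           gbar (vlift M K w X) (vlift M K w Y) = m3 * g X Y"
    and "levi_civita (TM M) gbar nabbar"
    and "smooth_vf (TM M) (points (TM M)) Xbar" and "smooth_vf (TM M) (points (TM M)) Ybar"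
    and "p \<in> points M" and "u \<in> tspace M p"
    and "F \<in> tspace M p" and "G \<in> tspace M p" and "Xbar u = hlift M K u F +\<^sub>T vlift M K u G"
    and "openin (mtopology M) U" and "p \<in> U" and "smooth_vf M U A" and "smooth_vf M U B"
    and "openin (mtopology (TM M)) W" and "u \<in> W" and "tbase ` W \<subseteq> U"
    and "smooth_vf (TM M) W C" and "\<And>w. w \<in> W \<Longrightarrow> C w \<in> hspace M K w"
    and "smooth_vf (TM M) W D" and "\<And>w. w \<in> W \<Longrightarrow> D w \<in> vspace M w"
    and "vanishes_horizontally M K W u C" and "vanishes_horizontally M K W u D"
    and "\<And>w. w \<in> W \<Longrightarrow> Ybar w = hlift_vf M K A w +\<^sub>T vlift_vf M K B w +\<^sub>T C w +\<^sub>T D w"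
  shows "nabbar (Xbar u) Ybar =
           nabbar (hlift M K u F +\<^sub>T vlift M K u G) (\<lambda>w. hlift_vf M K A w +\<^sub>T vlift_vf M K B w)
             +\<^sub>T flat_deriv M K u G C D
       \<and> dpi M (nabbar (hlift M K u F +\<^sub>T vlift M K u G) (\<lambda>w. hlift_vf M K A w +\<^sub>T vlift_vf M K B w)) =
           nab F A +\<^sub>T (1 / \<Delta>) *\<^sub>T
             ((m2 * m3) *\<^sub>T curvature M nab u F (A p)
              +\<^sub>T (m2 * m3 / 2) *\<^sub>T curvature M nab F (A p) u
              +\<^sub>T (m3\<^sup>2 / 2) *\<^sub>T curvature M nab u (B p) F
              +\<^sub>T (m3\<^sup>2 / 2) *\<^sub>T curvature M nab u G (A p))
       \<and> K (nabbar (hlift M K u F +\<^sub>T vlift M K u G) (\<lambda>w. hlift_vf M K A w +\<^sub>T vlift_vf M K B w)) =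
           nab F B -\<^sub>T (1 / \<Delta>) *\<^sub>T
             (m2\<^sup>2 *\<^sub>T curvature M nab u F (A p)
              +\<^sub>T (m1 * m3 / 2) *\<^sub>T curvature M nab F (A p) u
              +\<^sub>T (m2 * m3 / 2) *\<^sub>T curvature M nab u (B p) F
              +\<^sub>T (m2 * m3 / 2) *\<^sub>T curvature M nab u G (A p))"
proof -
  have M: "smooth_atlas M" using assms(1) by (simp add: smooth_manifold_def)
  have TM: "smooth_atlas (TM M)" by (rule atlas.smooth_atlas_TM[OF atlas.intro[OF M]])
  interpret tangent_metric M nab g K nabbar gbar m1 m2 m3
  proof unfold_locales
    show "affine_connection M nab" "affine_connection (TM M) nabbar"
      using assms(3,11) unfolding levi_civita_def by blast+
  qed (fact M TM assms)+
  obtain c where c: "c \<in> M" "p \<in> cdom c" using assms(14) unfolding points_def by blast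
  have u: "tbase u = p" by (rule tspaceD(1)[OF assms(15)])
  have cu: "tbase u \<in> cdom c" "u \<in> tspace M (tbase u)" "F \<in> tspace M (tbase u)" "G \<in> tspace M (tbase u)"
    using c(2) assms(15-17) unfolding u by auto
  note W = assms(23,24)
  let ?S = "\<lambda>w. hlift_vf M K A w +\<^sub>T vlift_vf M K B w" and ?E = "\<lambda>w. C w +\<^sub>T D w"
  let ?\<xi> = "hlift M K u F +\<^sub>T vlift M K u G"
  have Wp: "W \<subseteq> points (TM M)" using W(1) unfolding openin_mtopology atlas_open_def by blast
  have Y: "smooth_vf (TM M) W Ybar" by (rule T.smooth_vf_subset[OF assms(13) Wp])
  \<comment> \<open>Smoothness of the lifted field is read off from the decomposition: on
    \<open>W\<close> it equals \<open>Ybar\<close> minus \<open>C\<close> minus \<open>D\<close>,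
    all of which are smooth there.\<close>
  have S: "smooth_vf (TM M) W ?S"
  proof (rule T.smooth_vf_cong[OF W(1) T.smooth_vf_minus[OF W(1) T.smooth_vf_minus[OF W(1) Y assms(26)] assms(28)]])
    fix w assume "w \<in> W"
    then show "?S w = Ybar w -\<^sub>T C w -\<^sub>T D w"
      unfolding assms(32)[OF \<open>w \<in> W\<close>] by (simp add: tplus_def tminus_def)
  qed
  have E: "smooth_vf (TM M) W ?E" by (rule T.smooth_vf_plus[OF W(1) assms(26,28)])
  have \<xi>: "?\<xi> \<in> tspace (TM M) u"
    unfolding lift_eq(1)[OF c(1) cu(1-3)] lift_eq(2)[OF c(1) cu(1,2,4)]
    using tchart_TM[OF c(1)] cu by (simp add: cdom_tchart)
  have "nabbar (Xbar u) Ybar = nabbar ?\<xi> (\<lambda>w. ?S w +\<^sub>T ?E w)"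
    unfolding assms(18)
    by (rule T.nab_local[OF W(1) T.smooth_vf_plus[OF W(1) S E] W(2) \<xi>])
      (simp add: assms(32) tplus_def add.assoc)
  also have "\<dots> = nabbar ?\<xi> ?S +\<^sub>T nabbar ?\<xi> ?E"
    by (rule T.nab_add_field[OF W(1) S W(2) \<xi> E])
  also have "nabbar ?\<xi> ?E = flat_deriv M K u G C D"
    by (rule nabbar_vanishing_fields[OF c(1) cu W assms(26,27,30,28,29,31)])
  finally show ?thesis
    using nabbar_lift_field[OF c(1) cu assms(19,21,22) W assms(25) S assms(7,8)] unfolding u by blast
qed

end
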